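(* Let $S$ be a codimension-two spacelike submanifold, without umbilical points, in a spacetime $(M,g)$ of dimension $n+2\ge4$. Then $S$ is shear-isotropic and pseudo-umbilical if and only if there exists a (globally defined) stationary and umbilical lightlike normal section $\xi$ on $S$, that is, a lightlike normal vector field $\xi$ whose shape operator satisfies $A_\xi=0$.
   Context: A spacetime $(M,g)$ is a connected time-oriented Lorentzian manifold of signature $(-,+,\dots,+)$. A vector $v$ is lightlike if $g(v,v)=0$ and $v\ne0$. A codimension-two spacelike submanifold is an immersion $\psi\colon S\to M$ of a connected $n$-manifold whose induced metric (also denoted $g$) is Riemannian. $\mathrm{II}$ is the second fundamental form, $A_\zeta$ is the shape operator of a normal field $\zeta$, with $g(A_\zeta X,Y)=g(\mathrm{II}(X,Y),\zeta)$, and $\mathbf H=\frac1n\operatorname{trace}_g\mathrm{II}$. A normal field $\zeta$ is umbilical if $A_\zeta=\rho I$ for some function $\rho$ (then $\rho=g(\zeta,\mathbf H)$), and stationary if $g(\zeta,\mathbf H)=0$, equivalently $\operatorname{trace}(A_\zeta)=0$. $S$ is pseudo-umbilical if $\mathbf H$ is an umbilical section. A point $p\in S$ is umbilical if there is $\zeta\in T_p^\perp S$ with $\mathrm{II}(X,Y)=g(X,Y)\zeta$ for all $X,Y\in T_pS$. The total shear tensor is $\mathring{\mathrm{II}}(X,Y)=\mathrm{II}(X,Y)-g(X,Y)\mathbf H$. $S$ is shear-isotropic if at every $p\in S$ the number $g(\mathring{\mathrm{II}}(X,X),\mathring{\mathrm{II}}(X,X))$ does not depend on the choice of the unit vector $X\in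 T_pS$. *)

theory Defs
  imports "HOL-Analysis.Analysis"
begin

section \<open>Smooth functions on open subsets of a Euclidean space\<close>

primrec Ck_on :: "nat \<Rightarrow> 'a::euclidean_space set \<Rightarrow> ('a \<Rightarrow> 'b::real_normed_vector) \<Rightarrow> bool" where
  "Ck_on 0 U F \<longleftrightarrow> continuous_on U F"
| "Ck_on (Suc k) U F \<longleftrightarrow> (\<forall>x\<in>U. F differentiable (at x)) \<and>
     (\<forall>v. Ck_on k U (\<lambda>x. frechet_derivative F (at x) v))"

definition smooth_on :: "'a::euclidean_space set \<Rightarrow> ('a \<Rightarrow> 'b::real_normed_vector) \<Rightarrow> bool" where
  "smooth_on U F \<longleftrightarrow> (\<forall>k. Ck_on k U F)"


section \<open>Smooth manifolds and their tangent spaces\<close>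

text \<open>
  A manifold is a Hausdorff second countable type with a smooth atlas.  Its dimension is the
  dimension \<open>DIM('e)\<close> of the model space.
\<close>

type_synonym ('a, 'e) chart = "'a set \<times> ('a \<Rightarrow> 'e)"

abbreviation chart_dom :: "('a, 'e) chart \<Rightarrow> 'a set" where "chart_dom c \<equiv> fst c"
abbreviation chart_map :: "('a, 'e) chart \<Rightarrow> 'a \<Rightarrow> 'e" where "chart_map c \<equiv> snd c"

definition chart_inv :: "('a, 'e) chart \<Rightarrow> 'e \<Rightarrow> 'a" where
  "chart_inv c = inv_into (chart_dom c) (chart_map c)"

definition is_chart :: "('a::topological_space, 'e::euclidean_space) chart \<Rightarrow> bool" where
  "is_chart c \<longleftrightarrow> open (chart_dom c) \<and> open (chart_map c ` chart_dom c) \<and>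
     homeomorphism (chart_dom c) (chart_map c ` chart_dom c) (chart_map c) (chart_inv c)"

definition smooth_atlas ::
  "('a::{t2_space, second_countable_topology}, 'e::euclidean_space) chart set \<Rightarrow> bool" where
  "smooth_atlas A \<longleftrightarrow> (\<forall>c\<in>A. is_chart c) \<and> (\<Union>c\<in>A. chart_dom c) = UNIV \<and>
     (\<forall>c\<in>A. \<forall>d\<in>A. smooth_on (chart_map c ` (chart_dom c \<inter> chart_dom d))
        (chart_map d \<circ> chart_inv c))"

text \<open>
  The tangent space at \<open>q\<close> is the model space \<open>'e\<close> itself, a vector being identified with its
  components in one preferred chart \<open>chart_at A q\<close> around \<open>q\<close>.  The preferred chart jumps from
  point to point, so a vector field is a function into \<open>'e\<close> whose regularity has to be tested
  after converting to the components \<open>coord A d q\<close> with respect to a fixed chart \<open>d\<close>;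
  \<open>from_coord A d q\<close> is the inverse conversion.
\<close>

definition chart_at :: "('a, 'e) chart set \<Rightarrow> 'a \<Rightarrow> ('a, 'e) chart" where
  "chart_at A q = (SOME c. c \<in> A \<and> q \<in> chart_dom c)"

definition coord ::
  "('a, 'e::euclidean_space) chart set \<Rightarrow> ('a, 'e) chart \<Rightarrow> 'a \<Rightarrow> 'e \<Rightarrow> 'e" where
  "coord A d q v = frechet_derivative (chart_map d \<circ> chart_inv (chart_at A q))
     (at (chart_map (chart_at A q) q)) v"

definition from_coord ::
  "('a, 'e::euclidean_space) chart set \<Rightarrow> ('a, 'e) chart \<Rightarrow> 'a \<Rightarrow> 'e \<Rightarrow> 'e" where
  "from_coord A d q u = frechet_derivative (chart_map (chart_at A q) \<circ> chart_inv d)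
     (at (chart_map d q)) u"

definition smooth_map ::
  "('a::topological_space, 'd::euclidean_space) chart set
    \<Rightarrow> ('b::topological_space, 'e::euclidean_space) chart set \<Rightarrow> ('a \<Rightarrow> 'b) \<Rightarrow> bool" where
  "smooth_map A B f \<longleftrightarrow> continuous_on UNIV f \<and>
     (\<forall>c\<in>A. \<forall>d\<in>B. smooth_on (chart_map c ` {p \<in> chart_dom c. f p \<in> chart_dom d})
        (\<lambda>x. chart_map d (f (chart_inv c x))))"

definition differential ::
  "('a, 'd::euclidean_space) chart set \<Rightarrow> ('b, 'e::euclidean_space) chart set
    \<Rightarrow> ('a \<Rightarrow> 'b) \<Rightarrow> 'a \<Rightarrow> 'd \<Rightarrow> 'e" where
  "differential A B f p X =
     frechet_derivative (\<lambda>x. chart_map (chart_at B (f p)) (f (chart_inv (chart_at A p) x)))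
       (at (chart_map (chart_at A p) p)) X"

text \<open>Smooth vector fields along \<open>f\<close>, i.e. smooth sections of the pull-back bundle:
  \<open>V p\<close> is a tangent vector at \<open>f p\<close>.\<close>

definition smooth_field_along ::
  "('a, 'd::euclidean_space) chart set \<Rightarrow> ('b, 'e::euclidean_space) chart set
    \<Rightarrow> ('a \<Rightarrow> 'b) \<Rightarrow> ('a \<Rightarrow> 'e) \<Rightarrow> bool" where
  "smooth_field_along A B f V \<longleftrightarrow>
     (\<forall>c\<in>A. \<forall>d\<in>B. smooth_on (chart_map c ` {p \<in> chart_dom c. f p \<in> chart_dom d})
        (\<lambda>x. coord B d (f (chart_inv c x)) (V (chart_inv c x))))"


section \<open>Spacetimes\<close>

text \<open>The time orientation is recorded by a smooth timelike vector field.\<close>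

record ('m, 'e) spacetime_data =
  atlas :: "('m, 'e) chart set"
  metric :: "'m \<Rightarrow> 'e \<Rightarrow> 'e \<Rightarrow> real"
  time_field :: "'m \<Rightarrow> 'e"

definition lorentzian_form :: "('e::euclidean_space \<Rightarrow> 'e \<Rightarrow> real) \<Rightarrow> bool" where
  "lorentzian_form G \<longleftrightarrow> bilinear G \<and> (\<forall>u v. G u v = G v u) \<and>
     (\<exists>B e0. independent B \<and> span B = UNIV \<and> e0 \<in> B \<and>
        (\<forall>b\<in>B. \<forall>c\<in>B. G b c = (if b \<noteq> c then 0 else if b = e0 then - 1 else 1)))"

definition metric_in_chart ::
  "('m, 'e::euclidean_space) spacetime_data \<Rightarrow> ('m, 'e) chart \<Rightarrow> 'e \<Rightarrow> 'e \<Rightarrow> 'e \<Rightarrow> real" where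
  "metric_in_chart M d x u v =
     metric M (chart_inv d x) (from_coord (atlas M) d (chart_inv d x) u)
       (from_coord (atlas M) d (chart_inv d x) v)"

definition spacetime ::
  "('m::{t2_space, second_countable_topology}, 'e::euclidean_space) spacetime_data \<Rightarrow> bool" where
  "spacetime M \<longleftrightarrow>
     connected (UNIV :: 'm set) \<and> smooth_atlas (atlas M) \<and>
     (\<forall>q. lorentzian_form (metric M q)) \<and>
     (\<forall>d\<in>atlas M. \<forall>u v. smooth_on (chart_map d ` chart_dom d)
        (\<lambda>x. metric_in_chart M d x u v)) \<and>
     smooth_field_along (atlas M) (atlas M) id (time_field M) \<and>
     (\<forall>q. metric M q (time_field M q) (time_field M q) < 0)"

definition lightlike :: "('m, 'e::euclidean_space) spacetime_data \<Rightarrow> 'm \<Rightarrow> 'e \<Rightarrow> bool" where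
  "lightlike M q v \<longleftrightarrow> metric M q v v = 0 \<and> v \<noteq> 0"

text \<open>
  The Levi-Civita connection in the chart \<open>d\<close>: \<open>christoffel M d x u v\<close> is the covariant
  derivative at \<open>x\<close>, in the direction \<open>u\<close>, of the field with constant components \<open>v\<close>, given by
  the Koszul formula (fields with constant components commute).
\<close>

definition christoffel ::
  "('m, 'e::euclidean_space) spacetime_data \<Rightarrow> ('m, 'e) chart \<Rightarrow> 'e \<Rightarrow> 'e \<Rightarrow> 'e \<Rightarrow> 'e" where
  "christoffel M d x u v = (THE z. \<forall>w.
     2 * metric_in_chart M d x z w =
       frechet_derivative (\<lambda>y. metric_in_chart M d y v w) (at x) u
     + frechet_derivative (\<lambda>y. metric_in_chart M d y u w) (at x) v
     - frechet_derivative (\<lambda>y. metric_in_chart M d y u v) (at x) w)"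


section \<open>Codimension-two spacelike submanifolds\<close>

record ('s, 'f, 'm) immersed_data =
  dom_atlas :: "('s, 'f) chart set"
  immersion :: "'s \<Rightarrow> 'm"

definition push ::
  "('m, 'e::euclidean_space) spacetime_data \<Rightarrow> ('s, 'f::euclidean_space, 'm) immersed_data
    \<Rightarrow> 's \<Rightarrow> 'f \<Rightarrow> 'e" where
  "push M S p X = differential (dom_atlas S) (atlas M) (immersion S) p X"

definition metric_at ::
  "('m, 'e::euclidean_space) spacetime_data \<Rightarrow> ('s, 'f::euclidean_space, 'm) immersed_data
    \<Rightarrow> 's \<Rightarrow> 'e \<Rightarrow> 'e \<Rightarrow> real" where
  "metric_at M S p u v = metric M (immersion S p) u v"

definition induced_metric ::
  "('m, 'e::euclidean_space) spacetime_data \<Rightarrow> ('s, 'f::euclidean_space, 'm) immersed_data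
    \<Rightarrow> 's \<Rightarrow> 'f \<Rightarrow> 'f \<Rightarrow> real" where
  "induced_metric M S p X Y = metric_at M S p (push M S p X) (push M S p Y)"

definition codim_two_spacelike_submanifold ::
  "('m::{t2_space, second_countable_topology}, 'e::euclidean_space) spacetime_data
    \<Rightarrow> ('s::{t2_space, second_countable_topology}, 'f::euclidean_space, 'm) immersed_data
    \<Rightarrow> bool" where
  "codim_two_spacelike_submanifold M S \<longleftrightarrow>
     DIM('e) = DIM('f) + 2 \<and>
     connected (UNIV :: 's set) \<and> smooth_atlas (dom_atlas S) \<and>
     smooth_map (dom_atlas S) (atlas M) (immersion S) \<and>
     (\<forall>p. inj (push M S p)) \<and>
     (\<forall>p X. X \<noteq> 0 \<longrightarrow> induced_metric M S p X X > 0)"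

definition normal_vec ::
  "('m, 'e::euclidean_space) spacetime_data \<Rightarrow> ('s, 'f::euclidean_space, 'm) immersed_data
    \<Rightarrow> 's \<Rightarrow> 'e \<Rightarrow> bool" where
  "normal_vec M S p v \<longleftrightarrow> (\<forall>X. metric_at M S p v (push M S p X) = 0)"

definition normal_field ::
  "('m, 'e::euclidean_space) spacetime_data \<Rightarrow> ('s, 'f::euclidean_space, 'm) immersed_data
    \<Rightarrow> ('s \<Rightarrow> 'e) \<Rightarrow> bool" where
  "normal_field M S \<zeta> \<longleftrightarrow> (\<forall>p. normal_vec M S p (\<zeta> p)) \<and>
     smooth_field_along (dom_atlas S) (atlas M) (immersion S) \<zeta>"

definition normal_part ::
  "('m, 'e::euclidean_space) spacetime_data \<Rightarrow> ('s, 'f::euclidean_space, 'm) immersed_data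
    \<Rightarrow> 's \<Rightarrow> 'e \<Rightarrow> 'e" where
  "normal_part M S p v = (THE w. normal_vec M S p w \<and> (\<exists>X. v = push M S p X + w))"

text \<open>
  The Levi-Civita derivative at \<open>p\<close>, in the direction \<open>X\<close>, of a vector field \<open>V\<close> along the
  immersion, computed in the preferred charts at \<open>p\<close> and at its image; in that chart the
  components of \<open>V p\<close> are \<open>V p\<close> itself.
\<close>

definition cov_deriv ::
  "('m, 'e::euclidean_space) spacetime_data \<Rightarrow> ('s, 'f::euclidean_space, 'm) immersed_data
    \<Rightarrow> 's \<Rightarrow> 'f \<Rightarrow> ('s \<Rightarrow> 'e) \<Rightarrow> 'e" where
  "cov_deriv M S p X V =
    (let f = immersion S; c = chart_at (dom_atlas S) p; d = chart_at (atlas M) (f p)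
     in frechet_derivative
          (\<lambda>x. coord (atlas M) d (f (chart_inv c x)) (V (chart_inv c x))) (at (chart_map c p)) X
        + christoffel M d (chart_map d (f p)) (push M S p X) (V p))"

text \<open>
  Gauss formula.  The tangent vector \<open>Y\<close> at \<open>p\<close> is extended to the local vector field with
  constant components in the preferred chart at \<open>p\<close>; the normal part does not depend on the
  extension.
\<close>

definition extend_vec ::
  "('s, 'f::euclidean_space, 'm) immersed_data \<Rightarrow> 's \<Rightarrow> 'f \<Rightarrow> 's \<Rightarrow> 'f" where
  "extend_vec S p Y q = from_coord (dom_atlas S) (chart_at (dom_atlas S) p) q Y"

definition second_ff ::
  "('m, 'e::euclidean_space) spacetime_data \<Rightarrow> ('s, 'f::euclidean_space, 'm) immersed_data
    \<Rightarrow> 's \<Rightarrow> 'f \<Rightarrow> 'f \<Rightarrow> 'e" where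
  "second_ff M S p X Y =
     normal_part M S p (cov_deriv M S p X (\<lambda>q. push M S q (extend_vec S p Y q)))"

definition shape_op ::
  "('m, 'e::euclidean_space) spacetime_data \<Rightarrow> ('s, 'f::euclidean_space, 'm) immersed_data
    \<Rightarrow> ('s \<Rightarrow> 'e) \<Rightarrow> 's \<Rightarrow> 'f \<Rightarrow> 'f" where
  "shape_op M S \<zeta> p X =
     (THE Z. \<forall>Y. induced_metric M S p Z Y = metric_at M S p (second_ff M S p X Y) (\<zeta> p))"

definition orthonormal_basis :: "('f::euclidean_space \<Rightarrow> 'f \<Rightarrow> real) \<Rightarrow> 'f set \<Rightarrow> bool" where
  "orthonormal_basis G B \<longleftrightarrow> independent B \<and> span B = UNIV \<and>
     (\<forall>b\<in>B. \<forall>c\<in>B. G b c = (if b = c then 1 else 0))"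

text \<open>The trace of a bilinear map \<open>h\<close> with respect to an inner product \<open>G\<close>; all orthonormal
  bases give the same value.\<close>

definition metric_trace ::
  "('f::euclidean_space \<Rightarrow> 'f \<Rightarrow> real) \<Rightarrow> ('f \<Rightarrow> 'f \<Rightarrow> 'e::euclidean_space) \<Rightarrow> 'e" where
  "metric_trace G h = (\<Sum>b\<in>(SOME B. orthonormal_basis G B). h b b)"

definition mean_curvature ::
  "('m, 'e::euclidean_space) spacetime_data \<Rightarrow> ('s, 'f::euclidean_space, 'm) immersed_data
    \<Rightarrow> 's \<Rightarrow> 'e" where
  "mean_curvature M S p =
     (1 / real DIM('f)) *\<^sub>R metric_trace (induced_metric M S p) (second_ff M S p)"

definition umbilical ::
  "('m, 'e::euclidean_space) spacetime_data \<Rightarrow> ('s, 'f::euclidean_space, 'm) immersed_data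
    \<Rightarrow> ('s \<Rightarrow> 'e) \<Rightarrow> bool" where
  "umbilical M S \<zeta> \<longleftrightarrow> (\<exists>\<rho>. \<forall>p X. shape_op M S \<zeta> p X = \<rho> p *\<^sub>R X)"

definition stationary ::
  "('m, 'e::euclidean_space) spacetime_data \<Rightarrow> ('s, 'f::euclidean_space, 'm) immersed_data
    \<Rightarrow> ('s \<Rightarrow> 'e) \<Rightarrow> bool" where
  "stationary M S \<zeta> \<longleftrightarrow> (\<forall>p. metric_at M S p (\<zeta> p) (mean_curvature M S p) = 0)"

definition pseudo_umbilical ::
  "('m, 'e::euclidean_space) spacetime_data \<Rightarrow> ('s, 'f::euclidean_space, 'm) immersed_data
    \<Rightarrow> bool" where
  "pseudo_umbilical M S \<longleftrightarrow> umbilical M S (mean_curvature M S)"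

definition umbilical_point ::
  "('m, 'e::euclidean_space) spacetime_data \<Rightarrow> ('s, 'f::euclidean_space, 'm) immersed_data
    \<Rightarrow> 's \<Rightarrow> bool" where
  "umbilical_point M S p \<longleftrightarrow> (\<exists>\<zeta>. normal_vec M S p \<zeta> \<and>
     (\<forall>X Y. second_ff M S p X Y = induced_metric M S p X Y *\<^sub>R \<zeta>))"

definition total_shear ::
  "('m, 'e::euclidean_space) spacetime_data \<Rightarrow> ('s, 'f::euclidean_space, 'm) immersed_data
    \<Rightarrow> 's \<Rightarrow> 'f \<Rightarrow> 'f \<Rightarrow> 'e" where
  "total_shear M S p X Y =
     second_ff M S p X Y - induced_metric M S p X Y *\<^sub>R mean_curvature M S p"

definition shear_isotropic ::
  "('m, 'e::euclidean_space) spacetime_data \<Rightarrow> ('s, 'f::euclidean_space, 'm) immersed_data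
    \<Rightarrow> bool" where
  "shear_isotropic M S \<longleftrightarrow> (\<forall>p X Y.
     induced_metric M S p X X = 1 \<longrightarrow> induced_metric M S p Y Y = 1 \<longrightarrow>
     metric_at M S p (total_shear M S p X X) (total_shear M S p X X) =
     metric_at M S p (total_shear M S p Y Y) (total_shear M S p Y Y))"

definition lightlike_normal_section ::
  "('m, 'e::euclidean_space) spacetime_data \<Rightarrow> ('s, 'f::euclidean_space, 'm) immersed_data
    \<Rightarrow> ('s \<Rightarrow> 'e) \<Rightarrow> bool" where
  "lightlike_normal_section M S \<xi> \<longleftrightarrow>
     normal_field M S \<xi> \<and> (\<forall>p. lightlike M (immersion S p) (\<xi> p))"

end

theory Submission
  imports Defs
begin

text \<open>
  The normal plane of the submanifold is Lorentzian, so it has two null directions.  In a null frame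
  \<open>A, C\<close> the number \<open>g(shear(X,X), shear(X,X))\<close> is a multiple of the product of two trace-free
  quadratic forms in \<open>X\<close>; each vanishes on some unit vector, so isotropy makes the product vanish
  identically and the shear takes values in one null direction.  It is nonzero since the point is
  not umbilical, and pseudo-umbilicity then puts \<open>H\<close>, hence all of \<open>II\<close>, into that direction, which
  is also its own orthogonal complement in the normal plane.  The converse reads this backwards.

  The null direction is made into a field by normalising against the time orientation.  For its
  smoothness, smooth null frames exist locally by orthogonalisation, the field is proportional to
  one of the two frame vectors at each point, and continuity of \<open>II\<close> in a fixed chart decides which
  one.  As \<open>II\<close> is defined through charts that vary with the point, this needs its independence of
  charts.
\<close>

text \<open>The calculus is shaped by the smoothness of the null field. Only products
  \<open>g(II(X,Y), w)\<close> with normal \<open>w\<close> are computed: \<open>koszul\<close>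
  expresses them by the metric and its derivatives, so neither Christoffel symbols nor an inverse
  metric have to be shown smooth, and \<open>II\<close> is recovered because the metric is
  nondegenerate on the normal plane. Chart independence of \<open>koszul\<close> rests on two facts:
  the second derivative of a source transition contributes a tangential vector, invisible to normal
  \<open>w\<close>, and the contributions of the second derivative of a target transition cancel by
  its symmetry.

  The absence of umbilical points enters twice: a nonzero shear value forces \<open>H\<close> onto
  the null line, and a nonzero value of \<open>II\<close> keeps the two null lines apart, since they
  cannot both annihilate \<open>II\<close>. A null vector is never orthogonal to the timelike field,
  so it can be scaled to product \<open>-1\<close> with it; this fixes the vector on its line with
  no choice of sign and makes the field a smooth multiple of the selected frame vector.\<close>

abbreviation dv :: "('a::real_normed_vector \<Rightarrow> 'b::real_normed_vector) \<Rightarrow> 'a \<Rightarrow> 'a \<Rightarrow> 'b" where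
  "dv f x \<equiv> frechet_derivative f (at x)"

section \<open>Calculus of smooth functions\<close>

lemma dv_cong:
  assumes "open U" "x \<in> U" "\<And>y. y \<in> U \<Longrightarrow> f y = g y"
  shows "dv f x = dv g x"
proof -
  have "(f has_derivative D) (at x) \<longleftrightarrow> (g has_derivative D) (at x)" for D
    by (metis assms has_derivative_transform_within_open)
  then show ?thesis by (simp add: frechet_derivative_def)
qed

lemma dv_eqI: "(f has_derivative D) (at x) \<Longrightarrow> dv f x = D"
  using frechet_derivative_at by metis

lemma differentiable_cong_open:
  assumes "open U" "x \<in> U" "\<And>y. y \<in> U \<Longrightarrow> f y = g y"
  shows "f differentiable (at x) \<longleftrightarrow> g differentiable (at x)"
  unfolding differentiable_def
  by (metis assms has_derivative_transform_within_open)

lemma Ck_on_cong: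
  assumes "open U" "\<And>y. y \<in> U \<Longrightarrow> f y = g y"
  shows "Ck_on k U f \<longleftrightarrow> Ck_on k U g"
  using assms(2)
proof (induction k arbitrary: f g)
  case 0
  then show ?case by (auto intro: continuous_on_cong)
next
  case (Suc k)
  have "Ck_on k U (\<lambda>x. dv f x v) \<longleftrightarrow> Ck_on k U (\<lambda>x. dv g x v)" for v
    by (rule Suc.IH) (metis dv_cong assms(1) Suc.prems)
  then show ?case
    using differentiable_cong_open[OF assms(1) _ Suc.prems] by simp
qed

lemma Ck_on_SucD: "Ck_on (Suc k) U f \<Longrightarrow> Ck_on k U f"
proof (induction k arbitrary: f)
  case 0
  then show ?case
    by (simp add: continuous_at_imp_continuous_on differentiable_imp_continuous_within)
next
  case (Suc k)
  then show ?case by (metis Ck_on.simps(2))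
qed

lemma Ck_on_subset: "V \<subseteq> U \<Longrightarrow> Ck_on k U f \<Longrightarrow> Ck_on k V f"
  by (induction k arbitrary: f) (auto intro: continuous_on_subset)

lemma Ck_on_local:
  assumes "\<And>x. x \<in> U \<Longrightarrow> \<exists>V. open V \<and> x \<in> V \<and> Ck_on k V f"
  shows "Ck_on k U f"
  using assms
proof (induction k arbitrary: f)
  case 0
  then have "isCont f x" if "x \<in> U" for x
    using that by (metis Ck_on.simps(1) continuous_on_eq_continuous_at)
  then show ?case
    by (simp add: continuous_at_imp_continuous_on)
next
  case (Suc k)
  have "\<exists>V. open V \<and> x \<in> V \<and> Ck_on k V (\<lambda>x. dv f x v)" if "x \<in> U" for x v
    using Suc.prems[OF that] by (metis Ck_on.simps(2))
  moreover have "f differentiable (at x)" if "x \<in> U" for x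
    using Suc.prems[OF that] by (metis Ck_on.simps(2))
  ultimately show ?case using Suc.IH by simp
qed

lemma Ck_on_has_derivative:
  "Ck_on (Suc k) U f \<Longrightarrow> x \<in> U \<Longrightarrow> (f has_derivative dv f x) (at x)"
  by (simp add: frechet_derivative_works)

text \<open>The recursion of \<open>Ck_on\<close> speaks of \<open>frechet_derivative\<close>; this
  rule lets a closure proof exhibit the derivative in the form a calculus rule delivers and continue
  the induction with that form.\<close>

lemma Ck_on_SucI:
  assumes "open U"
    and "\<And>x. x \<in> U \<Longrightarrow> (f has_derivative D x) (at x)"
    and "\<And>v. Ck_on k U (\<lambda>x. D x v)"
  shows "Ck_on (Suc k) U f"
proof -
  have "Ck_on k U (\<lambda>x. dv f x v)" for v
    by (subst Ck_on_cong[OF assms(1), of _ "\<lambda>x. D x v"]) (simp_all add: dv_eqI[OF assms(2)] assms(3))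
  moreover have "f differentiable (at x)" if "x \<in> U" for x
    using assms(2)[OF that] by (rule differentiableI)
  ultimately show ?thesis by simp
qed

section \<open>Closure of \<open>Ck_on\<close> under algebraic operations and composition\<close>

lemma Ck_on_const [simp]: "Ck_on k U (\<lambda>x. c)"
  by (induction k arbitrary: c) auto

lemma Ck_on_add:
  "open U \<Longrightarrow> Ck_on k U f \<Longrightarrow> Ck_on k U g \<Longrightarrow> Ck_on k U (\<lambda>x. f x + g x)"
proof (induction k arbitrary: f g)
  case 0
  then show ?case by (auto intro: continuous_intros)
next
  case (Suc k)
  show ?case
    by (rule Ck_on_SucI[where D = "\<lambda>x v. dv f x v + dv g x v"])
      (use Suc in \<open>auto simp: frechet_derivative_works intro!: has_derivative_add\<close>)
qed

lemma Ck_on_sum: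
  assumes "open U" "\<And>i. i \<in> I \<Longrightarrow> Ck_on k U (f i)"
  shows "Ck_on k U (\<lambda>x. \<Sum>i\<in>I. f i x)"
  using assms(2) by (induction I rule: infinite_finite_induct) (simp_all add: Ck_on_add[OF assms(1)])

lemma Ck_on_bounded_linear:
  assumes "open U" "bounded_linear L" "Ck_on k U f"
  shows "Ck_on k U (\<lambda>x. L (f x))"
  using assms(3)
proof (induction k arbitrary: f)
  case 0
  then show ?case using assms(2) by (auto intro: bounded_linear.continuous_on)
next
  case (Suc k)
  show ?case
  proof (rule Ck_on_SucI[where D = "\<lambda>x v. L (dv f x v)"])
    show "((\<lambda>x. L (f x)) has_derivative (\<lambda>v. L (dv f x v))) (at x)" if "x \<in> U" for x
      by (rule bounded_linear.has_derivative[OF assms(2) Ck_on_has_derivative[OF Suc.prems that]])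
    show "Ck_on k U (\<lambda>x. L (dv f x v))" for v
      using Suc.IH[of "\<lambda>x. dv f x v"] Suc.prems by simp
  qed (rule assms(1))
qed

lemma Ck_on_scaleR:
  fixes f :: "'a::euclidean_space \<Rightarrow> real" and g :: "'a \<Rightarrow> 'b::real_normed_vector"
  assumes "open U" "Ck_on k U f" "Ck_on k U g"
  shows "Ck_on k U (\<lambda>x. f x *\<^sub>R g x)"
  using assms(2,3)
proof (induction k arbitrary: f g)
  case 0
  then show ?case by (auto intro: continuous_intros)
next
  case (Suc k)
  have *: "Ck_on k U f" "Ck_on k U g" using Suc.prems by (blast dest: Ck_on_SucD)+
  show ?case
    by (rule Ck_on_SucI[where D = "\<lambda>x v. f x *\<^sub>R dv g x v + dv f x v *\<^sub>R g x"])
      (use Suc assms(1) * in \<open>auto simp: frechet_derivative_works intro!: has_derivative_scaleR Ck_on_add\<close>)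
qed

lemma Ck_on_mult:
  fixes f g :: "'a::euclidean_space \<Rightarrow> real"
  assumes "open U" "Ck_on k U f" "Ck_on k U g"
  shows "Ck_on k U (\<lambda>x. f x * g x)"
  using Ck_on_scaleR[OF assms] by simp

text \<open>The derivative of \<open>1/f\<close> is built from \<open>dv f\<close> and two factors
  \<open>1/f\<close>, so the lower-order claim for \<open>1/f\<close> itself drives the
  induction.\<close>

lemma Ck_on_inverse:
  fixes f :: "'a::euclidean_space \<Rightarrow> real"
  assumes "open U" "\<And>x. x \<in> U \<Longrightarrow> f x \<noteq> 0" "Ck_on k U f"
  shows "Ck_on k U (\<lambda>x. inverse (f x))"
  using assms(3)
proof (induction k)
  case 0
  then show ?case using assms(2) by (auto intro: continuous_intros)
next
  case (Suc k)
  then have *: "Ck_on k U (\<lambda>x. inverse (f x))" by (blast dest: Ck_on_SucD)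
  show ?case
  proof (rule Ck_on_SucI[where D = "\<lambda>x v. (-1) * (inverse (f x) * dv f x v * inverse (f x))"])
    show "((\<lambda>x. inverse (f x)) has_derivative (\<lambda>v. (-1) * (inverse (f x) * dv f x v * inverse (f x)))) (at x)"
      if "x \<in> U" for x
      using Deriv.has_derivative_inverse[OF assms(2)[OF that] Ck_on_has_derivative[OF Suc.prems that]] by simp
    show "Ck_on k U (\<lambda>x. (-1) * (inverse (f x) * dv f x v * inverse (f x)))" for v
      by (intro Ck_on_mult Ck_on_const * assms(1)) (use Suc.prems in simp)
  qed (rule assms(1))
qed

lemma Ck_on_sqrt:
  fixes f :: "'a::euclidean_space \<Rightarrow> real"
  assumes "open U" "\<And>x. x \<in> U \<Longrightarrow> f x > 0" "Ck_on k U f"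
  shows "Ck_on k U (\<lambda>x. sqrt (f x))"
  using assms(3)
proof (induction k)
  case 0
  then show ?case by (auto intro: continuous_intros)
next
  case (Suc k)
  then have *: "Ck_on k U (\<lambda>x. sqrt (f x))" by (blast dest: Ck_on_SucD)
  have **: "Ck_on k U (\<lambda>x. inverse (sqrt (f x)))"
    by (rule Ck_on_inverse[OF assms(1) _ *]) (use assms(2) in force)
  show ?case
  proof (rule Ck_on_SucI[where D = "\<lambda>x v. dv f x v * (inverse (sqrt (f x)) * (1/2))"])
    show "((\<lambda>x. sqrt (f x)) has_derivative (\<lambda>v. dv f x v * (inverse (sqrt (f x)) * (1/2)))) (at x)"
      if "x \<in> U" for x
      using has_derivative_real_sqrt[OF assms(2)[OF that] Ck_on_has_derivative[OF Suc.prems that]] by simp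
    show "Ck_on k U (\<lambda>x. dv f x v * (inverse (sqrt (f x)) * (1/2)))" for v
      by (intro Ck_on_mult Ck_on_const ** assms(1)) (use Suc.prems in simp)
  qed (rule assms(1))
qed

lemma linear_basis_expansion:
  assumes "linear h"
  shows "h (v::'a::euclidean_space) = (\<Sum>b\<in>Basis. (v \<bullet> b) *\<^sub>R h b)"
proof -
  have "h v = h (\<Sum>b\<in>Basis. (v \<bullet> b) *\<^sub>R b)" by (simp only: euclidean_representation)
  also have "\<dots> = (\<Sum>b\<in>Basis. (v \<bullet> b) *\<^sub>R h b)"
    by (simp only: linear_sum[OF assms] linear_scale[OF assms])
  finally show ?thesis .
qed

text \<open>Expanding \<open>V x\<close> in the standard basis turns the evaluation into a finite
  sum of products, so \<open>H\<close> needs to be regular on fixed vectors only. Chain rules and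
  metrics in charts both lead to such evaluations.\<close>

lemma Ck_on_linear_apply:
  fixes H :: "'a::euclidean_space \<Rightarrow> 'b::euclidean_space \<Rightarrow> 'c::real_normed_vector"
  assumes "open U" "\<And>x. x \<in> U \<Longrightarrow> linear (H x)" "\<And>v. Ck_on k U (\<lambda>x. H x v)" "Ck_on k U V"
  shows "Ck_on k U (\<lambda>x. H x (V x))"
proof -
  have "Ck_on k U (\<lambda>x. \<Sum>b\<in>Basis. (V x \<bullet> b) *\<^sub>R H x b)"
    by (rule Ck_on_sum[OF assms(1)], rule Ck_on_scaleR[OF assms(1) _ assms(3)],
        rule Ck_on_bounded_linear[OF assms(1) bounded_linear_inner_left assms(4)])
  moreover have "H x (V x) = (\<Sum>b\<in>Basis. (V x \<bullet> b) *\<^sub>R H x b)" if "x \<in> U" for x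
    using linear_basis_expansion[OF assms(2)[OF that]] .
  ultimately show ?thesis
    using Ck_on_cong[OF assms(1), of "\<lambda>x. H x (V x)" "\<lambda>x. \<Sum>b\<in>Basis. (V x \<bullet> b) *\<^sub>R H x b" k]
    by blast
qed

lemma Ck_on_bilinear_apply:
  fixes H :: "'a::euclidean_space \<Rightarrow> 'b::euclidean_space \<Rightarrow> 'd::euclidean_space \<Rightarrow> 'c::real_normed_vector"
  assumes "open U" "\<And>x. x \<in> U \<Longrightarrow> bilinear (H x)" "\<And>v w. Ck_on k U (\<lambda>x. H x v w)"
    "Ck_on k U V" "Ck_on k U W"
  shows "Ck_on k U (\<lambda>x. H x (V x) (W x))"
proof (rule Ck_on_linear_apply[where H = "\<lambda>x v. H x v (W x)", OF assms(1) _ _ assms(4)])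
  show "linear (\<lambda>v. H x v (W x))" if "x \<in> U" for x
    using assms(2)[OF that] by (simp add: bilinear_def)
  show "Ck_on k U (\<lambda>x. H x v (W x))" for v
  proof (rule Ck_on_linear_apply[OF assms(1) _ assms(3) assms(5)])
    show "linear (H x v)" if "x \<in> U" for x
      using assms(2)[OF that] by (simp add: bilinear_def)
  qed
qed

lemma has_derivative_linear_apply:
  fixes H :: "'a::real_normed_vector \<Rightarrow> 'b::euclidean_space \<Rightarrow> 'c::real_normed_vector"
  assumes "open U" "x \<in> U" "\<And>y. y \<in> U \<Longrightarrow> linear (H y)"
    and "\<And>v. ((\<lambda>y. H y v) has_derivative D v) (at x)"
    and "(V has_derivative V') (at x)"
  shows "((\<lambda>y. H y (V y)) has_derivative (\<lambda>u. D (V x) u + H x (V' u))) (at x)"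
proof -
  \<comment> \<open>\<open>D v\<close> is given separately for each \<open>v\<close>; uniqueness of
    derivatives makes it linear in \<open>v\<close>, which identifies the final sum.\<close>
  have 1: "D v = (\<lambda>u. \<Sum>b\<in>Basis. (v \<bullet> b) *\<^sub>R D b u)" for v
  proof (rule has_derivative_unique[OF assms(4)])
    have "((\<lambda>y. \<Sum>b\<in>Basis. (v \<bullet> b) *\<^sub>R H y b) has_derivative (\<lambda>u. \<Sum>b\<in>Basis. (v \<bullet> b) *\<^sub>R D b u)) (at x)"
      by (intro has_derivative_sum has_derivative_scaleR_right assms(4))
    then show "((\<lambda>y. H y v) has_derivative (\<lambda>u. \<Sum>b\<in>Basis. (v \<bullet> b) *\<^sub>R D b u)) (at x)"
      by (rule has_derivative_transform_within_open[OF _ assms(1,2)])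
        (rule linear_basis_expansion[OF assms(3), symmetric])
  qed
  have 2: "((\<lambda>y. \<Sum>b\<in>Basis. (V y \<bullet> b) *\<^sub>R H y b) has_derivative
      (\<lambda>u. \<Sum>b\<in>Basis. (V x \<bullet> b) *\<^sub>R D b u + (V' u \<bullet> b) *\<^sub>R H x b)) (at x)"
    by (intro has_derivative_sum has_derivative_scaleR assms(4) has_derivative_inner_left assms(5))
  have 3: "(\<Sum>b\<in>Basis. (V x \<bullet> b) *\<^sub>R D b u + (V' u \<bullet> b) *\<^sub>R H x b) = D (V x) u + H x (V' u)" for u
    using linear_basis_expansion[OF assms(3)[OF assms(2)], of "V' u"] 1[of "V x"]
    by (simp add: sum.distrib)
  show ?thesis
    by (rule has_derivative_transform_within_open[OF 2[unfolded 3] assms(1,2)])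
      (rule linear_basis_expansion[OF assms(3), symmetric])
qed

text \<open>The chain rule derivative \<open>dv g (f x) (dv f x v)\<close> is again the evaluation
  of a linear map. Its coefficients are directional derivatives of \<open>g\<close> composed with
  \<open>f\<close>, hence the induction over arbitrary \<open>g\<close>.\<close>

lemma Ck_on_compose:
  fixes f :: "'a::euclidean_space \<Rightarrow> 'b::euclidean_space" and g :: "'b \<Rightarrow> 'c::real_normed_vector"
  assumes "open U" "open W" "f ` U \<subseteq> W" "Ck_on k U f" "Ck_on k W g"
  shows "Ck_on k U (\<lambda>x. g (f x))"
  using assms(4,5)
proof (induction k arbitrary: g)
  case 0
  then show ?case using assms(3) by (auto intro: continuous_on_compose2)
next
  case (Suc k)
  have f: "Ck_on k U f" using Suc.prems(1) by (rule Ck_on_SucD)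
  show ?case
  proof (rule Ck_on_SucI[where D = "\<lambda>x v. dv g (f x) (dv f x v)"])
    show "((\<lambda>x. g (f x)) has_derivative (\<lambda>v. dv g (f x) (dv f x v))) (at x)" if "x \<in> U" for x
      using that assms(3) Suc.prems
      by (auto intro!: has_derivative_compose[where f = f and g = g] simp: frechet_derivative_works image_subset_iff)
    show "Ck_on k U (\<lambda>x. dv g (f x) (dv f x v))" for v
    proof (rule Ck_on_linear_apply[OF assms(1)])
      show "linear (dv g (f x))" if "x \<in> U" for x
        using that assms(3) Suc.prems by (auto intro!: linear_frechet_derivative)
      show "Ck_on k U (\<lambda>x. dv g (f x) v)" for v
        using Suc.IH[OF f, of "\<lambda>y. dv g y v"] Suc.prems(2) by simp
      show "Ck_on k U (\<lambda>x. dv f x v)" using Suc.prems(1) by simp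
    qed
  qed (rule assms(1))
qed

lemma smooth_on_cong:
  "open U \<Longrightarrow> (\<And>y. y \<in> U \<Longrightarrow> f y = g y) \<Longrightarrow> smooth_on U f \<longleftrightarrow> smooth_on U g"
  unfolding smooth_on_def by (metis Ck_on_cong)

lemma smooth_on_subset: "smooth_on U f \<Longrightarrow> V \<subseteq> U \<Longrightarrow> smooth_on V f"
  unfolding smooth_on_def by (metis Ck_on_subset)

lemma smooth_on_local:
  "(\<And>x. x \<in> U \<Longrightarrow> \<exists>V. open V \<and> x \<in> V \<and> smooth_on V f) \<Longrightarrow> smooth_on U f"
  unfolding smooth_on_def by (metis Ck_on_local)

lemma smooth_on_has_derivative:
  "smooth_on U f \<Longrightarrow> x \<in> U \<Longrightarrow> (f has_derivative dv f x) (at x)"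
  unfolding smooth_on_def by (meson Ck_on_has_derivative)

lemma smooth_on_linear_dv: "smooth_on U f \<Longrightarrow> x \<in> U \<Longrightarrow> linear (dv f x)"
  using smooth_on_has_derivative has_derivative_linear by metis

lemma smooth_on_dv: "smooth_on U f \<Longrightarrow> smooth_on U (\<lambda>x. dv f x v)"
  unfolding smooth_on_def by (metis Ck_on.simps(2))

lemma smooth_on_continuous: "smooth_on U f \<Longrightarrow> continuous_on U f"
  unfolding smooth_on_def by (metis Ck_on.simps(1))

lemma smooth_on_const [simp]: "smooth_on U (\<lambda>x. c)"
  by (simp add: smooth_on_def)

lemma smooth_on_add:
  "open U \<Longrightarrow> smooth_on U f \<Longrightarrow> smooth_on U g \<Longrightarrow> smooth_on U (\<lambda>x. f x + g x)"
  by (simp add: smooth_on_def Ck_on_add)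

lemma smooth_on_scaleR:
  fixes f :: "'a::euclidean_space \<Rightarrow> real"
  shows "open U \<Longrightarrow> smooth_on U f \<Longrightarrow> smooth_on U g \<Longrightarrow> smooth_on U (\<lambda>x. f x *\<^sub>R g x)"
  by (simp add: smooth_on_def Ck_on_scaleR)

lemma smooth_on_mult:
  fixes f g :: "'a::euclidean_space \<Rightarrow> real"
  shows "open U \<Longrightarrow> smooth_on U f \<Longrightarrow> smooth_on U g \<Longrightarrow> smooth_on U (\<lambda>x. f x * g x)"
  by (simp add: smooth_on_def Ck_on_mult)

lemma smooth_on_minus:
  assumes "open U" "smooth_on U f" shows "smooth_on U (\<lambda>x. - f x)"
  using smooth_on_scaleR[OF assms(1) smooth_on_const[of _ "-1"] assms(2)] by simp

lemma smooth_on_diff: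
  "open U \<Longrightarrow> smooth_on U f \<Longrightarrow> smooth_on U g \<Longrightarrow> smooth_on U (\<lambda>x. f x - g x)"
  using smooth_on_add[OF _ _ smooth_on_minus] by fastforce

lemma smooth_on_divide:
  fixes f g :: "'a::euclidean_space \<Rightarrow> real"
  assumes "open U" "\<And>x. x \<in> U \<Longrightarrow> g x \<noteq> 0" "smooth_on U f" "smooth_on U g"
  shows "smooth_on U (\<lambda>x. f x / g x)"
  unfolding divide_inverse using assms by (simp add: smooth_on_def Ck_on_mult Ck_on_inverse)

lemma smooth_on_sqrt:
  fixes f :: "'a::euclidean_space \<Rightarrow> real"
  shows "open U \<Longrightarrow> (\<And>x. x \<in> U \<Longrightarrow> f x > 0) \<Longrightarrow> smooth_on U f \<Longrightarrow> smooth_on U (\<lambda>x. sqrt (f x))"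
  by (simp add: smooth_on_def Ck_on_sqrt)

lemma smooth_on_linear_apply:
  fixes H :: "'a::euclidean_space \<Rightarrow> 'b::euclidean_space \<Rightarrow> 'c::real_normed_vector"
  assumes "open U" "\<And>x. x \<in> U \<Longrightarrow> linear (H x)" "\<And>v. smooth_on U (\<lambda>x. H x v)" "smooth_on U V"
  shows "smooth_on U (\<lambda>x. H x (V x))"
  using assms unfolding smooth_on_def by (blast intro: Ck_on_linear_apply)

lemma smooth_on_bilinear_apply:
  fixes H :: "'a::euclidean_space \<Rightarrow> 'b::euclidean_space \<Rightarrow> 'd::euclidean_space \<Rightarrow> 'c::real_normed_vector"
  assumes "open U" "\<And>x. x \<in> U \<Longrightarrow> bilinear (H x)" "\<And>v w. smooth_on U (\<lambda>x. H x v w)"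
    "smooth_on U V" "smooth_on U W"
  shows "smooth_on U (\<lambda>x. H x (V x) (W x))"
  using assms unfolding smooth_on_def by (blast intro: Ck_on_bilinear_apply)

lemma smooth_on_compose:
  fixes f :: "'a::euclidean_space \<Rightarrow> 'b::euclidean_space" and g :: "'b \<Rightarrow> 'c::real_normed_vector"
  assumes "open U" "open W" "f ` U \<subseteq> W" "smooth_on U f" "smooth_on W g"
  shows "smooth_on U (\<lambda>x. g (f x))"
  using assms unfolding smooth_on_def by (blast intro: Ck_on_compose)

lemma dv_compose:
  fixes f :: "'a::euclidean_space \<Rightarrow> 'b::euclidean_space"
  assumes "smooth_on U f" "x \<in> U" "smooth_on W g" "f x \<in> W"
  shows "dv (\<lambda>y. g (f y)) x = (\<lambda>v. dv g (f x) (dv f x v))"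
  using has_derivative_compose[OF smooth_on_has_derivative[OF assms(1,2)] smooth_on_has_derivative[OF assms(3,4)]]
  by (rule dv_eqI)

lemma dv_linear_apply:
  fixes H :: "'a::real_normed_vector \<Rightarrow> 'b::euclidean_space \<Rightarrow> 'c::real_normed_vector"
  assumes "open U" "x \<in> U" "\<And>y. y \<in> U \<Longrightarrow> linear (H y)"
    and "\<And>v. (\<lambda>y. H y v) differentiable (at x)" and "V differentiable (at x)"
  shows "dv (\<lambda>y. H y (V y)) x u = dv (\<lambda>y. H y (V x)) x u + H x (dv V x u)"
  using dv_eqI[OF has_derivative_linear_apply[OF assms(1-3), where D = "\<lambda>v. dv (\<lambda>y. H y v) x"]] assms(4,5)
  by (auto simp: frechet_derivative_works)

section \<open>Symmetry of second derivatives\<close>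

lemma smooth_on_line_derivative:
  fixes g :: "'a::euclidean_space \<Rightarrow> real"
  assumes "smooth_on U g" "y + a *\<^sub>R u \<in> U"
  shows "((\<lambda>a. g (y + a *\<^sub>R u)) has_real_derivative dv g (y + a *\<^sub>R u) u) (at a)"
proof -
  have "((\<lambda>a. y + a *\<^sub>R u) has_derivative (\<lambda>h. h *\<^sub>R u)) (at a)"
    by (auto intro!: derivative_eq_intros)
  from has_derivative_compose[OF this smooth_on_has_derivative[OF assms]]
  have "((\<lambda>a. g (y + a *\<^sub>R u)) has_derivative (\<lambda>h. dv g (y + a *\<^sub>R u) (h *\<^sub>R u))) (at a)" .
  moreover have "(\<lambda>h. dv g (y + a *\<^sub>R u) (h *\<^sub>R u)) = (*) (dv g (y + a *\<^sub>R u) u)"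
    by (simp add: linear_scale[OF smooth_on_linear_dv[OF assms]] fun_eq_iff mult.commute)
  ultimately show ?thesis by (simp add: has_field_derivative_def)
qed

text \<open>Both mixed derivatives are the limit of the second difference quotient
  \<open>(f (x + s u + s v) - f (x + s u) - f (x + s v) + f x) / s\<^sup>2\<close>.\<close>

lemma second_difference_mvt:
  fixes f :: "'a::euclidean_space \<Rightarrow> real"
  assumes "smooth_on U f" "s > 0" "\<And>a b. 0 \<le> a \<Longrightarrow> a \<le> s \<Longrightarrow> 0 \<le> b \<Longrightarrow> b \<le> s \<Longrightarrow> x + a *\<^sub>R u + b *\<^sub>R v \<in> U"
  shows "\<exists>a b. 0 < a \<and> a < s \<and> 0 < b \<and> b < s \<and>
    f (x + s *\<^sub>R u + s *\<^sub>R v) - f (x + s *\<^sub>R u) - f (x + s *\<^sub>R v) + f x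
      = s\<^sup>2 * dv (\<lambda>y. dv f y u) (x + a *\<^sub>R u + b *\<^sub>R v) v"
proof -
  \<comment> \<open>The mean value theorem is applied along \<open>u\<close> to this increment in
    the direction \<open>v\<close>, and then along \<open>v\<close> to the derivative of
    \<open>f\<close> along \<open>u\<close>.\<close>
  define \<phi> where "\<phi> a = f (x + s *\<^sub>R v + a *\<^sub>R u) - f (x + a *\<^sub>R u)" for a
  define g where "g y = dv f y u" for y
  have g: "smooth_on U g" unfolding g_def using assms(1) by (rule smooth_on_dv)
  have "(\<phi> has_real_derivative (g (x + s *\<^sub>R v + a *\<^sub>R u) - g (x + a *\<^sub>R u))) (at a)"
    if "0 \<le> a" "a \<le> s" for a
    unfolding \<phi>_def g_def
  proof (intro DERIV_diff smooth_on_line_derivative[OF assms(1)])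
    show "x + s *\<^sub>R v + a *\<^sub>R u \<in> U"
      using assms(3)[OF that, of s] assms(2) by (simp add: add.assoc add.commute[of "s *\<^sub>R v"])
    show "x + a *\<^sub>R u \<in> U" using assms(3)[OF that, of 0] assms(2) by simp
  qed
  from MVT2[OF assms(2) this] obtain a where a: "0 < a" "a < s"
    "\<phi> s - \<phi> 0 = (s - 0) * (g (x + s *\<^sub>R v + a *\<^sub>R u) - g (x + a *\<^sub>R u))"
    by blast
  have "((\<lambda>b. g (x + a *\<^sub>R u + b *\<^sub>R v)) has_real_derivative dv g (x + a *\<^sub>R u + b *\<^sub>R v) v) (at b)"
    if "0 \<le> b" "b \<le> s" for b
    by (rule smooth_on_line_derivative[OF g assms(3)]) (use that a in auto)
  from MVT2[OF assms(2) this] obtain b where b: "0 < b" "b < s"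
    "g (x + a *\<^sub>R u + s *\<^sub>R v) - g (x + a *\<^sub>R u + 0 *\<^sub>R v) = (s - 0) * dv g (x + a *\<^sub>R u + b *\<^sub>R v) v"
    by blast
  have "g (x + s *\<^sub>R v + a *\<^sub>R u) - g (x + a *\<^sub>R u) = s * dv g (x + a *\<^sub>R u + b *\<^sub>R v) v"
    using b(3) by (simp add: add.assoc add.commute[of "s *\<^sub>R v"])
  then have "\<phi> s - \<phi> 0 = s\<^sup>2 * dv g (x + a *\<^sub>R u + b *\<^sub>R v) v"
    using a(3) by (simp add: power2_eq_square)
  moreover have "\<phi> s - \<phi> 0 = f (x + s *\<^sub>R u + s *\<^sub>R v) - f (x + s *\<^sub>R u) - f (x + s *\<^sub>R v) + f x"
    by (simp add: \<phi>_def add.assoc add.commute[of "s *\<^sub>R v"])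
  ultimately show ?thesis
    using a(1,2) b(1,2) unfolding g_def by (intro exI[of _ a] exI[of _ b]) simp
qed

lemma second_difference_tendsto:
  fixes f :: "'a::euclidean_space \<Rightarrow> real"
  assumes "open U" "smooth_on U f" "x \<in> U"
  shows "((\<lambda>s. (f (x + s *\<^sub>R u + s *\<^sub>R v) - f (x + s *\<^sub>R u) - f (x + s *\<^sub>R v) + f x) / s\<^sup>2)
    \<longlongrightarrow> dv (\<lambda>y. dv f y u) x v) (at_right 0)"
proof (rule tendstoI)
  fix e :: real assume "e > 0"
  define h where "h y = dv (\<lambda>y. dv f y u) y v" for y
  have "continuous_on U h"
    unfolding h_def by (intro smooth_on_continuous smooth_on_dv assms)
  then have "isCont h x" using assms(1,3) continuous_on_eq_continuous_at by blast
  then obtain d1 where d1: "d1 > 0" "\<And>y. dist y x < d1 \<Longrightarrow> dist (h y) (h x) < e"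
    using \<open>e > 0\<close> unfolding continuous_at_eps_delta by metis
  obtain d2 where d2: "d2 > 0" "ball x d2 \<subseteq> U" using assms(1,3) openE by blast
  \<comment> \<open>With both parameters below \<open>d\<close> the parallelogram stays within
    distance \<open>min d1 d2\<close> of \<open>x\<close>; the summand 1 keeps the denominator
    positive when \<open>u\<close> and \<open>v\<close> vanish.\<close>
  define d where "d = min d1 d2 / (norm u + norm v + 1)"
  have "d > 0" using d1 d2 by (simp add: d_def add_nonneg_pos)
  have close: "dist (x + a *\<^sub>R u + b *\<^sub>R v) x < min d1 d2"
    if "0 \<le> a" "a < d" "0 \<le> b" "b < d" for a b
  proof -
    have "norm (a *\<^sub>R u + b *\<^sub>R v) \<le> a * norm u + b * norm v"
      using that by (metis abs_of_nonneg norm_scaleR norm_triangle_ineq)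
    also have "\<dots> \<le> d * norm u + d * norm v"
      using that by (intro add_mono mult_right_mono) auto
    also have "\<dots> < d * (norm u + norm v + 1)" using \<open>d > 0\<close> by (simp add: algebra_simps)
    also have "\<dots> = min d1 d2"
      by (simp add: d_def add_nonneg_eq_0_iff)
    finally show ?thesis by (simp add: dist_norm add.assoc)
  qed
  show "\<forall>\<^sub>F s in at_right 0. dist ((f (x + s *\<^sub>R u + s *\<^sub>R v) - f (x + s *\<^sub>R u) - f (x + s *\<^sub>R v) + f x) / s\<^sup>2)
      (dv (\<lambda>y. dv f y u) x v) < e"
    unfolding eventually_at_right_field
  proof (intro exI[of _ d] conjI allI impI \<open>d > 0\<close>)
    fix s :: real assume s: "0 < s" "s < d"
    have "\<exists>a b. 0 < a \<and> a < s \<and> 0 < b \<and> b < s \<and>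
        f (x + s *\<^sub>R u + s *\<^sub>R v) - f (x + s *\<^sub>R u) - f (x + s *\<^sub>R v) + f x
        = s\<^sup>2 * dv (\<lambda>y. dv f y u) (x + a *\<^sub>R u + b *\<^sub>R v) v"
    proof (rule second_difference_mvt[OF assms(2) s(1)])
      fix a b assume "0 \<le> a" "a \<le> s" "0 \<le> b" "b \<le> s"
      then have "dist (x + a *\<^sub>R u + b *\<^sub>R v) x < d2" using close[of a b] s by simp
      then show "x + a *\<^sub>R u + b *\<^sub>R v \<in> U" using d2(2) by (auto simp: dist_commute)
    qed
    then obtain a b where ab: "0 < a" "a < s" "0 < b" "b < s"
      "f (x + s *\<^sub>R u + s *\<^sub>R v) - f (x + s *\<^sub>R u) - f (x + s *\<^sub>R v) + f x = s\<^sup>2 * h (x + a *\<^sub>R u + b *\<^sub>R v)"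
      unfolding h_def by blast
    have "dist (h (x + a *\<^sub>R u + b *\<^sub>R v)) (h x) < e"
      using close[of a b] ab s by (intro d1(2)) simp
    then show "dist ((f (x + s *\<^sub>R u + s *\<^sub>R v) - f (x + s *\<^sub>R u) - f (x + s *\<^sub>R v) + f x) / s\<^sup>2)
      (dv (\<lambda>y. dv f y u) x v) < e"
      using ab(5) s(1) by (simp add: h_def)
  qed
qed

lemma dv_dv_commute_real:
  fixes f :: "'a::euclidean_space \<Rightarrow> real"
  assumes "open U" "smooth_on U f" "x \<in> U"
  shows "dv (\<lambda>y. dv f y u) x v = dv (\<lambda>y. dv f y v) x u"
proof (rule tendsto_unique[OF _ second_difference_tendsto[OF assms]])
  show "((\<lambda>s. (f (x + s *\<^sub>R u + s *\<^sub>R v) - f (x + s *\<^sub>R u) - f (x + s *\<^sub>R v) + f x) / s\<^sup>2)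
    \<longlongrightarrow> dv (\<lambda>y. dv f y v) x u) (at_right 0)"
    using second_difference_tendsto[OF assms, of v u] by (simp add: algebra_simps)
qed simp

lemma dv_inner:
  assumes "f differentiable (at x)"
  shows "dv (\<lambda>y. f y \<bullet> b) x u = dv f x u \<bullet> b"
  using dv_eqI[OF has_derivative_inner_left[OF assms[unfolded frechet_derivative_works]]] by simp

lemma smooth_on_inner: "open U \<Longrightarrow> smooth_on U f \<Longrightarrow> smooth_on U (\<lambda>y. f y \<bullet> b)"
  unfolding smooth_on_def by (simp add: Ck_on_bounded_linear[OF _ bounded_linear_inner_left])

lemma dv_dv_commute:
  fixes f :: "'a::euclidean_space \<Rightarrow> 'b::euclidean_space"
  assumes "open U" "smooth_on U f" "x \<in> U"
  shows "dv (\<lambda>y. dv f y u) x v = dv (\<lambda>y. dv f y v) x u"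
proof (rule euclidean_eqI)
  fix b :: 'b
  have diff: "g differentiable (at y)" if "smooth_on U g" "y \<in> U" for g :: "'a \<Rightarrow> 'b" and y
    using smooth_on_has_derivative[OF that] differentiable_def by blast
  have "dv (\<lambda>y. dv f y u) x v \<bullet> b = dv (\<lambda>y. dv (\<lambda>z. f z \<bullet> b) y u) x v" for u v
  proof -
    have "dv (\<lambda>y. dv (\<lambda>z. f z \<bullet> b) y u) x v = dv (\<lambda>y. dv f y u \<bullet> b) x v"
      by (intro dv_cong[OF assms(1,3), THEN fun_cong] dv_inner diff assms)
    then show ?thesis using diff[OF smooth_on_dv[OF assms(2)] assms(3)] by (simp add: dv_inner)
  qed
  then show "dv (\<lambda>y. dv f y u) x v \<bullet> b = dv (\<lambda>y. dv f y v) x u \<bullet> b"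
    using dv_dv_commute_real[OF assms(1) smooth_on_inner[OF assms(1,2)] assms(3)] by metis
qed


section \<open>Algebra of a Lorentzian vector space\<close>

lemma linear_injective_imp_surjective_dim:
  fixes L :: "'a::euclidean_space \<Rightarrow> 'b::euclidean_space"
  assumes "linear L" "\<And>x. L x = 0 \<Longrightarrow> x = 0" "DIM('a) = DIM('b)"
  shows "surj L"
  using linear_injective_imp_surjective[OF assms(1)] linear_injective_0[OF assms(1)] assms(2,3) by auto

lemma linear_eq_on_Basis:
  assumes "linear f" "linear g" "\<And>b. b \<in> Basis \<Longrightarrow> f b = g b"
  shows "f x = g (x::'a::euclidean_space)"
  using linear_eq_stdbasis[OF assms(1,2)] assms(3) by metis

text \<open>Riesz representation without positivity: \<open>L\<close> records the products of
  \<open>z\<close> with the standard basis, is injective by nondegeneracy, and so onto by equality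
  of dimensions. Christoffel symbols, tangential projections and shape operators get their existence
  and uniqueness from it.\<close>

lemma nondegenerate_represents:
  fixes G :: "'a::euclidean_space \<Rightarrow> 'a \<Rightarrow> real"
  assumes G: "bilinear G" and nd: "\<And>z. (\<And>w. G z w = 0) \<Longrightarrow> z = 0" and \<phi>: "linear \<phi>"
  shows "\<exists>!z. \<forall>w. G z w = \<phi> w"
proof -
  define L where "L z = (\<Sum>b\<in>Basis. G z b *\<^sub>R b)" for z
  have Lb: "L z \<bullet> b = G z b" if "b \<in> Basis" for z b
    using that unfolding L_def by simp
  have lin: "linear (G z)" "linear (\<lambda>z. G z w)" for z w
    using G by (auto simp: bilinear_def)
  have "linear L"
    unfolding L_def
    by (rule linearI) (simp_all add: bilinear_ladd[OF G] bilinear_lmul[OF G] scaleR_add_left sum.distrib scaleR_sum_right)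
  moreover have "z = 0" if "L z = 0" for z
  proof (rule nd)
    have "G z b = 0" if "b \<in> Basis" for b
      using Lb[OF that, of z] \<open>L z = 0\<close> by simp
    then show "G z w = 0" for w
      using linear_eq_on_Basis[OF lin(1) linear_zero] by metis
  qed
  ultimately have "surj L" by (intro linear_injective_imp_surjective_dim) auto
  then obtain z where z: "L z = (\<Sum>b\<in>Basis. \<phi> b *\<^sub>R b)" by (metis surjD)
  have "G z b = \<phi> b" if "b \<in> Basis" for b
    using Lb[OF that, of z] that by (simp add: z)
  then have "\<forall>w. G z w = \<phi> w"
    using linear_eq_on_Basis[OF lin(1) \<phi>] by blast
  moreover have "y = z" if "\<forall>w. G y w = \<phi> w" for y
  proof -
    have "y - z = 0"
      by (rule nd) (simp add: bilinear_lsub[OF G] that calculation)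
    then show ?thesis by simp
  qed
  ultimately show ?thesis by blast
qed

lemma posdef_nondegenerate:
  fixes h :: "'a::real_vector \<Rightarrow> 'a \<Rightarrow> real"
  assumes "\<And>X. X \<noteq> 0 \<Longrightarrow> h X X > 0" "\<And>w. h z w = 0"
  shows "z = 0"
  using assms by (metis less_irrefl)

lemma orthonormal_independent:
  fixes h :: "'a::euclidean_space \<Rightarrow> 'a \<Rightarrow> real"
  assumes h: "bilinear h" and B: "\<forall>b\<in>B. \<forall>c\<in>B. h b c = (if b = c then 1 else 0)"
  shows "independent B"
proof
  assume "dependent B"
  then obtain t u where t: "finite t" "t \<subseteq> B" "(\<Sum>v\<in>t. u v *\<^sub>R v) = 0" and "\<exists>v\<in>t. u v \<noteq> 0"
    unfolding dependent_explicit by blast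
  then obtain c where c: "c \<in> t" "u c \<noteq> 0" by blast
  have lin: "linear (\<lambda>v. h v c)" using h by (simp add: bilinear_def)
  have "0 = h (\<Sum>v\<in>t. u v *\<^sub>R v) c" by (simp add: t(3) bilinear_lzero[OF h])
  also have "\<dots> = (\<Sum>v\<in>t. u v * h v c)"
    by (simp add: linear_sum[OF lin] linear_scale[OF lin])
  also have "\<dots> = (\<Sum>v\<in>t. if v = c then u v else 0)"
  proof (rule sum.cong[OF refl])
    fix v assume "v \<in> t"
    then have "h v c = (if v = c then 1 else 0)" using B t(2) c(1) by blast
    then show "u v * h v c = (if v = c then u v else 0)" by simp
  qed
  also have "\<dots> = u c" using t(1) c(1) by simp
  finally show False using c(2) by simp
qed

text \<open>An orthonormal set of largest cardinality must span: otherwise an outside vector, freed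
  of its components along the set and normalised, would enlarge it. Independence of orthonormal sets
  bounds the cardinality.\<close>

lemma orthonormal_basis_exists:
  fixes h :: "'a::euclidean_space \<Rightarrow> 'a \<Rightarrow> real"
  assumes h: "bilinear h" and sym: "\<And>X Y. h X Y = h Y X" and pos: "\<And>X. X \<noteq> 0 \<Longrightarrow> h X X > 0"
  shows "\<exists>B. orthonormal_basis h B"
proof -
  define on where "on B \<longleftrightarrow> (\<forall>b\<in>B. \<forall>c\<in>B. h b c = (if b = c then 1 else 0))" for B
  have ind: "independent B" if "on B" for B
    using that orthonormal_independent[OF h] by (simp add: on_def)
  have fin: "finite B" "card B \<le> DIM('a)" if "on B" for B
    using independent_bound[OF ind[OF that]] by auto
  have "on {}" by (simp add: on_def)
  moreover have "\<forall>C. on C \<longrightarrow> card C < DIM('a) + 1" using fin(2) by (simp add: less_Suc_eq_le)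
  ultimately have "\<exists>B. on B \<and> (\<forall>C. on C \<longrightarrow> card C \<le> card B)"
    by (rule ex_has_greatest_nat[of on "{}" card "DIM('a) + 1"])
  then obtain B where maximal: "on B \<and> (\<forall>C. on C \<longrightarrow> card C \<le> card B)" ..
  then have B: "on B" "\<forall>C. on C \<longrightarrow> card C \<le> card B" by auto
  have "v \<in> span B" for v
  proof (rule ccontr)
    assume v: "v \<notin> span B"
    define w where "w = v - (\<Sum>b\<in>B. h v b *\<^sub>R b)"
    have "(\<Sum>b\<in>B. h v b *\<^sub>R b) \<in> span B" by (intro span_sum span_scale span_base)
    with v have "w \<noteq> 0" by (auto simp: w_def)
    have wb: "h w c = 0" if "c \<in> B" for c
    proof -
      have lin: "linear (\<lambda>v. h v c)" using h by (simp add: bilinear_def)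
      have "h (\<Sum>b\<in>B. h v b *\<^sub>R b) c = (\<Sum>b\<in>B. h v b * h b c)"
        by (simp add: linear_sum[OF lin] linear_scale[OF lin])
      also have "\<dots> = (\<Sum>b\<in>B. if b = c then h v b else 0)"
        using B(1) that by (intro sum.cong) (auto simp: on_def)
      also have "\<dots> = h v c" using fin(1)[OF B(1)] that by simp
      finally show ?thesis by (simp add: w_def bilinear_lsub[OF h])
    qed
    define e where "e = (1 / sqrt (h w w)) *\<^sub>R w"
    have "h e e = 1"
      using pos[OF \<open>w \<noteq> 0\<close>]
      by (simp add: e_def bilinear_lmul[OF h] bilinear_rmul[OF h])
    moreover have eb: "h e c = 0" if "c \<in> B" for c
      using wb[OF that] by (simp add: e_def bilinear_lmul[OF h])
    moreover have "h c e = 0" if "c \<in> B" for c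
      using eb[OF that] by (subst sym)
    ultimately have "on (insert e B)"
      using B(1) by (auto simp: on_def)
    moreover have "e \<notin> B" using eb \<open>h e e = 1\<close> by fastforce
    ultimately show False
      using spec[OF B(2), of "insert e B"] fin(1)[OF B(1)] by simp
  qed
  then have "orthonormal_basis h B"
    using B(1) ind[OF B(1)] by (auto simp: orthonormal_basis_def on_def)
  then show ?thesis by blast
qed

lemma orthonormal_basis_card:
  fixes B :: "'a::euclidean_space set"
  assumes "orthonormal_basis h B"
  shows "finite B" "card B = DIM('a)"
  using assms independent_bound[of B] dim_eq_card[of B UNIV] by (auto simp: orthonormal_basis_def dim_UNIV)

text \<open>A vanishing trace excludes that all diagonal values have the same strict sign. If none
  is zero, some \<open>b\<close> and \<open>c\<close> have values of opposite sign, and the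
  intermediate value theorem applies on the quarter circle of unit vectors from \<open>b\<close> to
  \<open>c\<close>.\<close>

lemma quadratic_vanishes_somewhere:
  fixes q h :: "'a::euclidean_space \<Rightarrow> 'a \<Rightarrow> real"
  assumes h: "bilinear h" and pos: "\<And>X. X \<noteq> 0 \<Longrightarrow> h X X > 0"
    and q: "bilinear q" and B: "orthonormal_basis h B" and tr: "(\<Sum>b\<in>B. q b b) = 0"
  shows "\<exists>X. h X X = 1 \<and> q X X = 0"
proof (cases "\<exists>b\<in>B. q b b = 0")
  case True
  then show ?thesis using B unfolding orthonormal_basis_def by metis
next
  case False
  have fin: "finite B" "B \<noteq> {}" using orthonormal_basis_card[OF B] by auto
  have "\<exists>b\<in>B. q b b > 0"
  proof (rule ccontr)
    assume "\<not> ?thesis"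
    with False have "- q b b > 0" if "b \<in> B" for b using that by force
    then have "(\<Sum>b\<in>B. - q b b) > 0" by (rule sum_pos[OF fin])
    then show False using tr by (simp add: sum_negf)
  qed
  moreover have "\<exists>b\<in>B. q b b < 0"
  proof (rule ccontr)
    assume "\<not> ?thesis"
    with False have "q b b > 0" if "b \<in> B" for b using that by force
    then have "(\<Sum>b\<in>B. q b b) > 0" by (rule sum_pos[OF fin])
    then show False using tr by simp
  qed
  ultimately obtain b c where bc: "b \<in> B" "c \<in> B" "q b b > 0" "q c c < 0" by blast
  then have "b \<noteq> c" by auto
  define X where "X t = cos t *\<^sub>R b + sin t *\<^sub>R c" for t
  have on: "h b b = 1" "h c c = 1" "h b c = 0" "h c b = 0"
    using B bc(1,2) \<open>b \<noteq> c\<close> by (auto simp: orthonormal_basis_def)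
  have exp: "g (X t) (X t) = (cos t)\<^sup>2 * g b b + cos t * sin t * (g b c + g c b) + (sin t)\<^sup>2 * g c c"
    if "bilinear g" for g :: "'a \<Rightarrow> 'a \<Rightarrow> real" and t
    unfolding X_def
    by (simp add: bilinear_ladd[OF that] bilinear_radd[OF that] bilinear_lmul[OF that] bilinear_rmul[OF that]
        power2_eq_square algebra_simps)
  have "\<exists>t\<ge>0. t \<le> pi/2 \<and> q (X t) (X t) = 0"
    unfolding exp[OF q] using bc
    by (intro IVT2) (auto intro!: continuous_intros)
  then show ?thesis using exp[OF h] on by auto
qed

text \<open>If neither form vanishes identically, the product fails to vanish at some point of a line
  joining a point where the first is nonzero to a point where the second is nonzero.\<close>

lemma quadratic_product_zero:
  fixes a b :: "'a::real_vector \<Rightarrow> 'a \<Rightarrow> real"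
  assumes a: "bilinear a" "\<And>X Y. a X Y = a Y X" and b: "bilinear b" "\<And>X Y. b X Y = b Y X"
    and prod: "\<And>X. a X X * b X X = 0"
  shows "(\<forall>X Y. a X Y = 0) \<or> (\<forall>X Y. b X Y = 0)"
proof -
  have pol: "g X Y = 0" if "bilinear g" "\<And>X Y. g X Y = g Y X" "\<And>X. g X X = 0"
    for g :: "'a \<Rightarrow> 'a \<Rightarrow> real" and X Y
    using that(3)[of "X + Y"] that(3)[of X] that(3)[of Y] that(2)[of X Y]
    by (simp add: bilinear_ladd[OF that(1)] bilinear_radd[OF that(1)])
  have "(\<forall>X. a X X = 0) \<or> (\<forall>X. b X X = 0)"
  proof (rule ccontr)
    assume "\<not> ((\<forall>X. a X X = 0) \<or> (\<forall>X. b X X = 0))"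
    then obtain X Y where X: "a X X \<noteq> 0" and Y: "b Y Y \<noteq> 0" by blast
    have z: "b X X = 0" "a Y Y = 0" using prod[of X] prod[of Y] X Y by auto
    have expand: "g (X + t *\<^sub>R Y) (X + t *\<^sub>R Y) = g X X + 2 * t * g X Y + t\<^sup>2 * g Y Y"
      if "bilinear g" "\<And>X Y. g X Y = g Y X" for g :: "'a \<Rightarrow> 'a \<Rightarrow> real" and t
      using that(2)[of Y X]
      by (simp add: bilinear_ladd[OF that(1)] bilinear_radd[OF that(1)] bilinear_lmul[OF that(1)]
          bilinear_rmul[OF that(1)] power2_eq_square algebra_simps)
    have *: "a X X + 2 * t * a X Y = 0 \<or> 2 * b X Y + t * b Y Y = 0" if "t \<noteq> 0" for t
    proof -
      have "(a X X + 2 * t * a X Y) * (2 * t * b X Y + t\<^sup>2 * b Y Y) = 0"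
        using prod[of "X + t *\<^sub>R Y"] expand[OF a, of t] expand[OF b, of t] z by simp
      moreover have "2 * t * b X Y + t\<^sup>2 * b Y Y = t * (2 * b X Y + t * b Y Y)"
        by (simp add: power2_eq_square algebra_simps)
      ultimately show ?thesis using that by simp
    qed
    \<comment> \<open>The first factor is affine in \<open>t\<close> and nonzero at 0, the second is
      affine with nonzero slope \<open>b Y Y\<close>, so each has at most one root; three values of
      \<open>t\<close> are too many.\<close>
    show False
      using *[of 1] *[of 2] *[of 3] X Y by auto
  qed
  then show ?thesis using pol[OF a] pol[OF b] by blast
qed

text \<open>In a Lorentzian basis with components \<open>r\<close> of \<open>u\<close> and
  \<open>s\<close> of \<open>v\<close>, orthogonality equates \<open>r e0 * s e0\<close> with the
  spatial product, and timelikeness makes the spatial part of \<open>u\<close> shorter than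
  \<open>r e0\<close>. Cauchy-Schwarz on the spatial parts then bounds \<open>s e0\<close>.\<close>

lemma lorentzian_timelike_complement:
  assumes "lorentzian_form G" "G u u < 0" "G u v = 0" "v \<noteq> 0"
  shows "G v v > 0"
proof -
  obtain B e0 where G: "bilinear G" and sym: "\<And>u v. G u v = G v u"
    and B: "independent B" "span B = UNIV" "e0 \<in> B"
      "\<And>b c. b \<in> B \<Longrightarrow> c \<in> B \<Longrightarrow> G b c = (if b \<noteq> c then 0 else if b = e0 then - 1 else 1)"
    using assms(1) unfolding lorentzian_form_def by metis
  have fin: "finite B" using independent_bound[OF B(1)] by simp
  define C where "C = B - {e0}"
  have C: "finite C" "B = insert e0 C" "e0 \<notin> C" using fin B(3) by (auto simp: C_def)
  have rep: "\<exists>r. w = (\<Sum>b\<in>B. r b *\<^sub>R b)" for w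
    using B(2) span_finite[OF fin] by blast
  obtain r where r: "u = (\<Sum>b\<in>B. r b *\<^sub>R b)" using rep by blast
  obtain s where s: "v = (\<Sum>b\<in>B. s b *\<^sub>R b)" using rep by blast
  have GG: "G (\<Sum>b\<in>B. r b *\<^sub>R b) (\<Sum>b\<in>B. s b *\<^sub>R b) = - r e0 * s e0 + (\<Sum>b\<in>C. r b * s b)" for r s
  proof -
    have "G (\<Sum>b\<in>B. r b *\<^sub>R b) (\<Sum>b\<in>B. s b *\<^sub>R b) = (\<Sum>b\<in>B. \<Sum>c\<in>B. r b * (s c * G b c))"
      by (simp add: bilinear_sum[OF G] sum.cartesian_product bilinear_lmul[OF G] bilinear_rmul[OF G] mult.left_commute)
    also have "\<dots> = (\<Sum>b\<in>B. \<Sum>c\<in>B. if c = b then r b * s b * G b b else 0)"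
      by (intro sum.cong) (auto simp: B(4))
    also have "\<dots> = (\<Sum>b\<in>B. r b * s b * G b b)" using fin by simp
    also have "\<dots> = (\<Sum>b\<in>insert e0 C. r b * s b * (if b = e0 then -1 else 1))"
      by (intro sum.cong) (auto simp: B(4) C(2))
    also have "\<dots> = - r e0 * s e0 + (\<Sum>b\<in>C. r b * s b)"
      using C by (auto intro!: sum.cong)
    finally show ?thesis .
  qed
  have u: "(\<Sum>b\<in>C. (r b)\<^sup>2) < (r e0)\<^sup>2"
    using assms(2) by (simp add: r GG power2_eq_square)
  have uv: "(\<Sum>b\<in>C. r b * s b) = r e0 * s e0"
    using assms(3) by (simp add: r s GG)
  have cs: "(r e0 * s e0)\<^sup>2 \<le> (\<Sum>b\<in>C. (r b)\<^sup>2) * (\<Sum>b\<in>C. (s b)\<^sup>2)"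
    unfolding uv[symmetric] by (rule Cauchy_Schwarz_ineq_sum)
  have r0: "(r e0)\<^sup>2 > 0" by (rule le_less_trans[OF sum_nonneg u]) simp
  \<comment> \<open>A vanishing spatial part would force \<open>s e0 = 0\<close> by
    \<open>cs\<close>, hence \<open>v = 0\<close>; this positivity makes the final estimate
    strict.\<close>
  have "(\<Sum>b\<in>C. (s b)\<^sup>2) > 0"
  proof (rule ccontr)
    assume "\<not> ?thesis"
    then have 0: "(\<Sum>b\<in>C. (s b)\<^sup>2) = 0" using sum_nonneg[of C "\<lambda>b. (s b)\<^sup>2"] by simp
    then have "\<forall>b\<in>C. s b = 0" using sum_nonneg_eq_0_iff[OF C(1), of "\<lambda>b. (s b)\<^sup>2"] by simp
    moreover have "s e0 = 0" using cs 0 r0 by simp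
    ultimately have "v = 0" using C by (auto simp: s)
    then show False using assms(4) by simp
  qed
  then have "(r e0)\<^sup>2 * (s e0)\<^sup>2 < (r e0)\<^sup>2 * (\<Sum>b\<in>C. (s b)\<^sup>2)"
    using le_less_trans[OF cs mult_strict_right_mono[OF u]] by (simp add: power_mult_distrib)
  then have "(s e0)\<^sup>2 < (\<Sum>b\<in>C. (s b)\<^sup>2)" using r0 by simp
  then show ?thesis by (simp add: s GG power2_eq_square)
qed

text \<open>The linear algebra at one point: \<open>G\<close> is the spacetime metric,
  \<open>P\<close> the differential of the immersion, \<open>T\<close> the time direction. The
  Lorentzian signature is kept in the form \<open>complement\<close>, which passes through linear
  isomorphisms at once, as the change to chart components requires.\<close>

locale spacelike_plane =
  fixes G :: "'e::euclidean_space \<Rightarrow> 'e \<Rightarrow> real" and P :: "'f::euclidean_space \<Rightarrow> 'e" and T :: 'e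
  assumes bil: "bilinear G" and sym: "G u v = G v u"
    and T: "G T T < 0"
    and complement: "G u u < 0 \<Longrightarrow> G u v = 0 \<Longrightarrow> v \<noteq> 0 \<Longrightarrow> G v v > 0"
    and lin: "linear P" and pos: "X \<noteq> 0 \<Longrightarrow> G (P X) (P X) > 0"
    and dim: "DIM('e) = DIM('f) + 2"
begin

definition normal :: "'e \<Rightarrow> bool" where
  "normal v \<longleftrightarrow> (\<forall>X. G v (P X) = 0)"

lemmas G_simps = bilinear_ladd[OF bil] bilinear_radd[OF bil] bilinear_lmul[OF bil] bilinear_rmul[OF bil]
  bilinear_lsub[OF bil] bilinear_rsub[OF bil] bilinear_lneg[OF bil] bilinear_rneg[OF bil]
  bilinear_lzero[OF bil] bilinear_rzero[OF bil]

lemma linear_G: "linear (G z)" "linear (\<lambda>z. G z w)"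
  using bil by (auto simp: bilinear_def)

lemma G_sum: "G (\<Sum>i\<in>I. v i) w = (\<Sum>i\<in>I. G (v i) w)"
  using linear_sum[OF linear_G(2)] .

lemma nondegenerate: "(\<And>w. G z w = 0) \<Longrightarrow> z = 0"
  using complement[OF T, of z] sym by (metis less_irrefl)

lemma bilinear_induced: "bilinear (\<lambda>X Y. G (P X) (P Y))"
  unfolding bilinear_def
  by (auto intro!: linearI simp: linear_add[OF lin] linear_scale[OF lin] G_simps)

lemma normal_add: "normal v \<Longrightarrow> normal w \<Longrightarrow> normal (v + w)"
  and normal_diff: "normal v \<Longrightarrow> normal w \<Longrightarrow> normal (v - w)"
  and normal_scale: "normal v \<Longrightarrow> normal (c *\<^sub>R v)"
  and normal_0: "normal 0"
  by (simp_all add: normal_def G_simps)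

lemma normal_sum: "(\<And>i. i \<in> I \<Longrightarrow> normal (v i)) \<Longrightarrow> normal (\<Sum>i\<in>I. v i)"
  by (induction I rule: infinite_finite_induct) (auto simp: normal_0 normal_add)

lemma normal_push: "normal (P X) \<Longrightarrow> X = 0"
  using pos unfolding normal_def by (metis less_irrefl)

lemma projection_exists: "\<exists>X. normal (v - P X)"
proof -
  have "\<exists>!X. \<forall>Y. G (P X) (P Y) = G v (P Y)"
  proof (rule nondegenerate_represents[OF bilinear_induced])
    show "z = 0" if "\<And>w. G (P z) (P w) = 0" for z
      using that normal_push by (simp add: normal_def)
    show "linear (\<lambda>Y. G v (P Y))"
      by (auto intro!: linearI simp: linear_add[OF lin] linear_scale[OF lin] G_simps)
  qed
  then obtain X where "\<forall>Y. G (P X) (P Y) = G v (P Y)" by blast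
  then have "normal (v - P X)" by (simp add: normal_def G_simps)
  then show ?thesis by blast
qed

lemma projection_unique:
  assumes "normal (v - P X)" "normal (v - P Y)" shows "X = Y"
proof -
  have "normal (P (X - Y))"
    using normal_diff[OF assms(2,1)] by (simp add: linear_diff[OF lin])
  then show ?thesis using normal_push by fastforce
qed

lemma normal_nondegenerate:
  assumes "normal w" "\<And>v. normal v \<Longrightarrow> G w v = 0" shows "w = 0"
proof (rule nondegenerate)
  fix z
  obtain X where "normal (z - P X)" using projection_exists by blast
  then have "G w (z - P X) = 0" by (rule assms(2))
  then show "G w z = 0" using assms(1) by (simp add: G_simps normal_def)
qed

text \<open>The tangential part of \<open>T\<close> has nonnegative square, so removing it can only
  lower the negative square of \<open>T\<close>.\<close>

lemma timelike_normal_part: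
  assumes "normal (T - P X)" shows "G (T - P X) (T - P X) < 0"
proof -
  have "G (T - P X) (P X) = 0" "G (P X) (T - P X) = 0"
    using assms sym[of "P X"] by (auto simp: normal_def)
  then have "G T T = G (T - P X) (T - P X) + G (P X) (P X)"
    by (simp add: G_simps)
  moreover have "G (P X) (P X) \<ge> 0"
    using pos[of X] linear_0[OF lin] by (cases "X = 0") (auto simp: G_simps)
  ultimately show ?thesis using T by linarith
qed

text \<open>The tangent space and \<open>N\<close> together have dimension at most
  \<open>DIM('f) + 1\<close>, one less than the ambient space. A vector outside, freed of its
  tangential part and of its component along \<open>N\<close>, stays nonzero.\<close>

lemma second_normal_exists:
  assumes "normal N" "G N N < 0"
  shows "\<exists>w. normal w \<and> G N w = 0 \<and> w \<noteq> 0"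
proof -
  define L where "L = (\<lambda>(X, a). P X + a *\<^sub>R N)"
  have "linear L"
    unfolding L_def by (auto intro!: linearI simp: linear_add[OF lin] linear_scale[OF lin] algebra_simps)
  then have "dim (range L) \<le> DIM('f \<times> real)"
    using dim_image_le[of L UNIV] by (simp add: dim_UNIV)
  then have "range L \<noteq> UNIV" using dim by (auto simp: dim_UNIV)
  then obtain v where v: "v \<notin> range L" by blast
  obtain X where X: "normal (v - P X)" using projection_exists by blast
  define w where "w = v - P X - (G N (v - P X) / G N N) *\<^sub>R N"
  have "w \<noteq> 0"
  proof
    assume "w = 0"
    then have "v = L (X, G N (v - P X) / G N N)" by (simp add: w_def L_def algebra_simps)
    with v show False by blast
  qed
  moreover have "normal w" unfolding w_def by (intro normal_diff normal_scale X assms(1))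
  moreover have "G N w = 0"
  proof -
    have "G N w = G N (v - P X) - (G N (v - P X) / G N N) * G N N"
      by (simp only: w_def bilinear_rsub[OF bil] bilinear_rmul[OF bil] real_scaleR_def)
    then show ?thesis using assms(2) by simp
  qed
  ultimately show ?thesis by blast
qed

text \<open>The map \<open>L\<close> between spaces of equal dimension is injective, hence onto; in
  the resulting expansion of a normal vector the tangential part has to vanish.\<close>

lemma normal_spanned:
  assumes N: "normal N" "G N N < 0" and w: "normal w" "G N w = 0" "w \<noteq> 0" and v: "normal v"
  shows "\<exists>a b. v = a *\<^sub>R N + b *\<^sub>R w"
proof -
  define L where "L = (\<lambda>(X, a, b). P X + a *\<^sub>R N + b *\<^sub>R w)"
  have "linear L"
    unfolding L_def by (auto intro!: linearI simp: linear_add[OF lin] linear_scale[OF lin] algebra_simps)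
  have key: "X = 0" if "normal (P X + a *\<^sub>R N + b *\<^sub>R w)" for X a b
  proof -
    have "normal ((P X + a *\<^sub>R N + b *\<^sub>R w) - (a *\<^sub>R N + b *\<^sub>R w))"
      by (intro normal_diff normal_add normal_scale that N w)
    then show ?thesis using normal_push by simp
  qed
  have "z = 0" if "L z = 0" for z
  proof -
    obtain X a b where z: "z = (X, a, b)" by (metis prod_cases3)
    with that have 0: "P X + a *\<^sub>R N + b *\<^sub>R w = 0" by (simp add: L_def)
    then have "X = 0" using key[of X a b] normal_0 by simp
    then have ab: "a *\<^sub>R N + b *\<^sub>R w = 0" using 0 linear_0[OF lin] by simp
    then have "G N (a *\<^sub>R N + b *\<^sub>R w) = 0" by (simp add: G_simps)
    then have "a = 0" using N(2) w(2) by (simp add: G_simps)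
    then show ?thesis using ab w(3) \<open>X = 0\<close> z by (simp add: zero_prod_def)
  qed
  then have "surj L" using linear_injective_imp_surjective_dim[OF \<open>linear L\<close>] dim by simp
  then obtain z where "v = L z" by (metis surjD)
  moreover obtain X a b where "z = (X, a, b)" by (metis prod_cases3)
  ultimately have "v = P X + a *\<^sub>R N + b *\<^sub>R w" by (simp add: L_def)
  then show ?thesis using key[of X a b] v linear_0[OF lin] by auto
qed

section \<open>Null lines of the normal plane\<close>

definition null_frame :: "'e \<Rightarrow> 'e \<Rightarrow> bool" where
  "null_frame A B \<longleftrightarrow> normal A \<and> normal B \<and> G A A = 0 \<and> G B B = 0 \<and> G A B \<noteq> 0 \<and>
     (\<forall>v. normal v \<longrightarrow> (\<exists>a b. v = a *\<^sub>R A + b *\<^sub>R B))"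

lemma null_frame_swap: "null_frame A B \<Longrightarrow> null_frame B A"
  unfolding null_frame_def using sym by (metis add.commute)

text \<open>The product of the two null vectors is \<open>2 * G N N\<close>, hence nonzero.\<close>

lemma null_frameI:
  assumes N: "normal N" "G N N < 0" and w: "normal w" "G N w = 0" "G w w = - G N N"
  shows "null_frame (N + w) (N - w)"
proof -
  have "G w N = 0" using w(2) sym by metis
  have "w \<noteq> 0" using w(3) N(2) by (auto simp: G_simps)
  have "\<exists>a b. v = a *\<^sub>R (N + w) + b *\<^sub>R (N - w)" if v: "normal v" for v
  proof -
    obtain a b where "v = a *\<^sub>R N + b *\<^sub>R w"
      using normal_spanned[OF N w(1,2) \<open>w \<noteq> 0\<close> v] by blast
    then have "v = ((a + b) / 2) *\<^sub>R (N + w) + ((a - b) / 2) *\<^sub>R (N - w)"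
      by (simp add: algebra_simps flip: scaleR_add_left scaleR_add_right)
        (simp add: algebra_simps add_divide_distrib diff_divide_distrib flip: scaleR_add_left scaleR_diff_left)
    then show ?thesis by blast
  qed
  then show ?thesis
    using N w \<open>G w N = 0\<close> by (auto simp: null_frame_def normal_add normal_diff G_simps)
qed

lemma null_frame_exists: "\<exists>A B. null_frame A B"
proof -
  obtain X where X: "normal (T - P X)" using projection_exists by blast
  define N where "N = T - P X"
  have N: "normal N" "G N N < 0" using X timelike_normal_part[OF X] by (auto simp: N_def)
  obtain w where w: "normal w" "G N w = 0" "w \<noteq> 0" using second_normal_exists[OF N] by blast
  have "G w w > 0" using complement[OF N(2) w(2,3)] .
  define v where "v = sqrt (- G N N / G w w) *\<^sub>R w"
  have "G v v = - G N N"
    using \<open>G w w > 0\<close> N(2) by (simp add: v_def G_simps flip: mult.assoc)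
  then have "null_frame (N + v) (N - v)"
    using N w by (intro null_frameI) (auto simp: v_def normal_scale G_simps)
  then show ?thesis by blast
qed

text \<open>A combination of \<open>A\<close> and \<open>B\<close> with coefficients
  \<open>a\<close>, \<open>b\<close> has square \<open>2 * a * b * G A B\<close>, so the two lines
  of the frame are the only null lines.\<close>

lemma null_in_frame:
  assumes "null_frame A B" "normal v" "G v v = 0"
  shows "(\<exists>a. v = a *\<^sub>R A) \<or> (\<exists>b. v = b *\<^sub>R B)"
proof -
  obtain a b where v: "v = a *\<^sub>R A + b *\<^sub>R B" using assms(1,2) unfolding null_frame_def by blast
  have "G v v = 2 * a * b * G A B"
    using assms(1) sym[of B A] by (simp add: v G_simps null_frame_def)
  then have "a = 0 \<or> b = 0" using assms(1,3) by (simp add: null_frame_def)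
  then show ?thesis using v by auto
qed

text \<open>Completing \<open>v\<close> to a null frame up to a factor, the product of
  \<open>w\<close> with \<open>v\<close> is a nonzero multiple of the other coefficient of
  \<open>w\<close>. A null line is thus its own orthogonal complement in the plane.\<close>

lemma orthogonal_to_null:
  assumes v: "normal v" "v \<noteq> 0" "G v v = 0" and w: "normal w" "G w v = 0"
  shows "\<exists>a. w = a *\<^sub>R v"
proof -
  have main: "\<exists>a. w = a *\<^sub>R v" if AB: "null_frame A B" and vA: "v = c *\<^sub>R A" for A B c
  proof -
    obtain a b where wab: "w = a *\<^sub>R A + b *\<^sub>R B" using AB w unfolding null_frame_def by blast
    have "c \<noteq> 0" using vA v(2) by auto
    moreover have "G w v = c * b * G A B"
      using AB sym[of B A] by (simp add: wab vA G_simps null_frame_def)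
    ultimately have "b = 0" using w(2) AB by (simp add: null_frame_def)
    then have "w = (a / c) *\<^sub>R v" using wab vA \<open>c \<noteq> 0\<close> by simp
    then show ?thesis by blast
  qed
  obtain A B where AB: "null_frame A B" using null_frame_exists by blast
  then show ?thesis
    using null_in_frame[OF AB v(1,3)] main[OF AB] main[OF null_frame_swap[OF AB]] by blast
qed

text \<open>Permits scaling a null vector to product \<open>-1\<close> with the time field.\<close>

lemma null_not_orthogonal_timelike: "v \<noteq> 0 \<Longrightarrow> G v v = 0 \<Longrightarrow> G v T \<noteq> 0"
  using complement[OF T, of v] sym by (metis less_irrefl)

end

text \<open>Traces are computed in the fixed orthonormal basis \<open>B\<close>, later instantiated
  by the very basis that \<open>metric_trace\<close> selects, so traces in different bases never
  have to be compared.\<close>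

locale shape_tensor = spacelike_plane G P T
  for G :: "'e::euclidean_space \<Rightarrow> 'e \<Rightarrow> real" and P :: "'f::euclidean_space \<Rightarrow> 'e" and T +
  fixes II :: "'f \<Rightarrow> 'f \<Rightarrow> 'e" and B :: "'f set"
  assumes II_bilinear: "bilinear II" and II_sym: "II X Y = II Y X" and II_normal: "normal (II X Y)"
    and B: "orthonormal_basis (\<lambda>X Y. G (P X) (P Y)) B"
begin

abbreviation g :: "'f \<Rightarrow> 'f \<Rightarrow> real" where "g X Y \<equiv> G (P X) (P Y)"

definition mean :: 'e where "mean = (1 / real DIM('f)) *\<^sub>R (\<Sum>b\<in>B. II b b)"

definition shear :: "'f \<Rightarrow> 'f \<Rightarrow> 'e" where "shear X Y = II X Y - g X Y *\<^sub>R mean"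

lemma trace_g: "(\<Sum>b\<in>B. g b b) = DIM('f)"
  using B orthonormal_basis_card[OF B] by (simp add: orthonormal_basis_def)

lemma G_mean: "G mean v = (\<Sum>b\<in>B. G (II b b) v) / DIM('f)"
  by (simp add: mean_def bilinear_lmul[OF bil] G_sum)

lemma mean_normal: "normal mean"
  unfolding mean_def by (intro normal_scale normal_sum II_normal)

text \<open>Taking traces, with \<open>DIM('f)\<close> the trace of \<open>g\<close>, identifies
  every umbilicity factor.\<close>

lemma umbilical_mean:
  assumes "\<And>X Y. G (II X Y) v = \<rho> * g X Y" shows "G mean v = \<rho>"
proof -
  have "G mean v = \<rho> * (\<Sum>b\<in>B. g b b) / DIM('f)"
    by (simp add: G_mean assms sum_distrib_left)
  then show ?thesis by (simp add: trace_g)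
qed

lemma shear_bilinear: "bilinear shear"
  unfolding bilinear_def shear_def
  by (auto intro!: linearI simp: bilinear_ladd[OF II_bilinear] bilinear_radd[OF II_bilinear]
      bilinear_lmul[OF II_bilinear] bilinear_rmul[OF II_bilinear] bilinear_ladd[OF bilinear_induced]
      bilinear_radd[OF bilinear_induced] bilinear_lmul[OF bilinear_induced] bilinear_rmul[OF bilinear_induced]
      algebra_simps)

lemma shear_sym: "shear X Y = shear Y X"
  unfolding shear_def by (subst II_sym, subst sym) (rule refl)

lemma shear_normal: "normal (shear X Y)"
  unfolding shear_def by (intro normal_diff normal_scale II_normal mean_normal)

lemma shear_component_bilinear: "bilinear (\<lambda>X Y. G (shear X Y) v)"
  unfolding bilinear_def
  by (auto intro!: linearI simp: bilinear_ladd[OF shear_bilinear] bilinear_radd[OF shear_bilinear]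
      bilinear_lmul[OF shear_bilinear] bilinear_rmul[OF shear_bilinear] G_simps)

lemma shear_trace: "(\<Sum>b\<in>B. G (shear b b) v) = 0"
proof -
  have "(\<Sum>b\<in>B. G (shear b b) v) = (\<Sum>b\<in>B. G (II b b) v) - (\<Sum>b\<in>B. g b b) * G mean v"
    by (simp only: shear_def bilinear_lsub[OF bil] bilinear_lmul[OF bil] sum_subtractf real_scaleR_def
        sum_distrib_right)
  then show ?thesis unfolding trace_g by (simp add: G_mean)
qed

text \<open>In a null frame \<open>A, C\<close> the function \<open>G (shear X X) (shear X X)\<close> is a multiple of the product
  of two trace-free quadratic forms.  A trace-free form vanishes on some unit vector, so isotropy
  forces the product to vanish identically, hence one of the factors.\<close>

lemma isotropic_null_direction:
  assumes iso: "\<And>X Y. g X X = 1 \<Longrightarrow> g Y Y = 1 \<Longrightarrow> G (shear X X) (shear X X) = G (shear Y Y) (shear Y Y)"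
  shows "\<exists>A. normal A \<and> A \<noteq> 0 \<and> G A A = 0 \<and> (\<forall>X Y. G (shear X Y) A = 0)"
proof -
  obtain A C where AC: "null_frame A C" using null_frame_exists by blast
  define a c where "a = (\<lambda>X Y. G (shear X Y) A)" and "c = (\<lambda>X Y. G (shear X Y) C)"
  have bl: "bilinear a" "bilinear c" unfolding a_def c_def by (rule shear_component_bilinear)+
  have sy: "a X Y = a Y X" "c X Y = c Y X" for X Y
    unfolding a_def c_def using shear_sym by metis+
  have GAC: "G A C \<noteq> 0" "G C A = G A C" "G A A = 0" "G C C = 0"
    using AC sym by (auto simp: null_frame_def)
  \<comment> \<open>If \<open>shear X X\<close> has components \<open>r\<close>, \<open>s\<close>
    along \<open>A\<close>, \<open>C\<close>, then \<open>a X X = s * G A C\<close>,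
    \<open>c X X = r * G A C\<close>, and the square of \<open>shear X X\<close> is
    \<open>2 * r * s * G A C\<close>.\<close>
  have sq: "G A C * G (shear X X) (shear X X) = 2 * a X X * c X X" for X
  proof -
    obtain r s where rs: "shear X X = r *\<^sub>R A + s *\<^sub>R C"
      using AC shear_normal unfolding null_frame_def by blast
    show ?thesis unfolding a_def c_def rs by (simp add: G_simps GAC)
  qed
  have tr: "(\<Sum>b\<in>B. a b b) = 0" unfolding a_def by (rule shear_trace)
  obtain X0 where X0: "g X0 X0 = 1" "a X0 X0 = 0"
    using quadratic_vanishes_somewhere[OF bilinear_induced pos bl(1) B tr] by blast
  have unit: "a X X * c X X = 0" if "g X X = 1" for X
  proof -
    have "G (shear X0 X0) (shear X0 X0) = 0" using sq[of X0] X0(2) GAC(1) by simp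
    then have "G (shear X X) (shear X X) = 0" using iso[OF that X0(1)] by simp
    then show ?thesis using sq[of X] by simp
  qed
  \<comment> \<open>The product is homogeneous of degree four, so rescaling carries the result from
    unit vectors to all vectors.\<close>
  have "a X X * c X X = 0" for X
  proof (cases "X = 0")
    case True
    then show ?thesis by (simp add: bilinear_lzero[OF bl(1)])
  next
    case False
    define r where "r = 1 / sqrt (g X X)"
    have "r \<noteq> 0" using pos[OF False] by (simp add: r_def)
    have "g (r *\<^sub>R X) (r *\<^sub>R X) = 1"
      using pos[OF False] by (simp add: r_def linear_scale[OF lin] G_simps)
    from unit[OF this] show ?thesis
      using \<open>r \<noteq> 0\<close> by (simp add: bilinear_lmul[OF bl(1)] bilinear_rmul[OF bl(1)]
          bilinear_lmul[OF bl(2)] bilinear_rmul[OF bl(2)])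
  qed
  then have "(\<forall>X Y. a X Y = 0) \<or> (\<forall>X Y. c X Y = 0)"
    by (rule quadratic_product_zero[OF bl(1) sy(1) bl(2) sy(2)])
  moreover have "A \<noteq> 0" "C \<noteq> 0" using GAC(1) by (auto simp: G_simps)
  ultimately show ?thesis
    using AC GAC unfolding a_def c_def null_frame_def by blast
qed

theorem isotropic_pseudo_umbilical_null:
  assumes iso: "\<And>X Y. g X X = 1 \<Longrightarrow> g Y Y = 1 \<Longrightarrow> G (shear X X) (shear X X) = G (shear Y Y) (shear Y Y)"
    and umb: "\<And>X Y. G (II X Y) mean = \<rho> * g X Y"
    and non: "shear X0 Y0 \<noteq> 0"
  shows "\<exists>A. normal A \<and> A \<noteq> 0 \<and> G A A = 0 \<and> (\<forall>X Y. G (II X Y) A = 0)"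
proof -
  obtain A where A: "normal A" "A \<noteq> 0" "G A A = 0" "\<And>X Y. G (shear X Y) A = 0"
    using isotropic_null_direction[OF iso] by blast
  obtain r where r: "shear X0 Y0 = r *\<^sub>R A"
    using orthogonal_to_null[OF A(1-3) shear_normal A(4)] by blast
  then have "r \<noteq> 0" using non by auto
  \<comment> \<open>The umbilicity factor is \<open>G mean mean\<close>, exactly what the subtracted
    term \<open>g X Y *\<^sub>R mean\<close> contributes, so every shear value is orthogonal to
    \<open>mean\<close>.\<close>
  have "G mean mean = \<rho>" by (rule umbilical_mean[OF umb])
  then have "G (shear X0 Y0) mean = 0"
    by (simp add: shear_def bilinear_lsub[OF bil] bilinear_lmul[OF bil] umb)
  then have "G A mean = 0" using \<open>r \<noteq> 0\<close> by (simp add: r bilinear_lmul[OF bil])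
  then have mA: "G mean A = 0" by (subst sym)
  have "G (II X Y) A = 0" for X Y
  proof -
    have "II X Y = shear X Y + g X Y *\<^sub>R mean" by (simp add: shear_def)
    then show ?thesis by (simp add: bilinear_ladd[OF bil] bilinear_lmul[OF bil] A(4) mA)
  qed
  then show ?thesis using A by blast
qed

text \<open>All values of \<open>II\<close>, and with them \<open>mean\<close> and the shear, lie on
  the null line of \<open>A\<close>, where every product vanishes.\<close>

lemma null_imp_isotropic_pseudo_umbilical:
  assumes A: "normal A" "A \<noteq> 0" "G A A = 0" "\<And>X Y. G (II X Y) A = 0"
  shows "G (shear X Y) (shear X Y) = 0" "G (II X Y) mean = 0"
proof -
  have mA: "G mean A = 0" by (rule umbilical_mean[of A 0, simplified]) (rule A(4))
  obtain s where s: "mean = s *\<^sub>R A" using orthogonal_to_null[OF A(1-3) mean_normal mA] by blast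
  obtain r where r: "II X Y = r *\<^sub>R A" using orthogonal_to_null[OF A(1-3) II_normal A(4)] by blast
  show "G (shear X Y) (shear X Y) = 0" "G (II X Y) mean = 0"
    by (simp_all add: shear_def r s G_simps A(3))
qed

end


section \<open>The Koszul form of a map into a space with variable metric\<close>

text \<open>\<open>koszul G F x X Y w\<close> is the product with \<open>w\<close> of the covariant derivative, in the direction
  \<open>X\<close>, of the vector field \<open>dv F \<cdot> Y\<close> along \<open>F\<close>.\<close>

definition koszul ::
  "('e::euclidean_space \<Rightarrow> 'e \<Rightarrow> 'e \<Rightarrow> real) \<Rightarrow> ('f::euclidean_space \<Rightarrow> 'e) \<Rightarrow> 'f \<Rightarrow> 'f \<Rightarrow> 'f \<Rightarrow> 'e \<Rightarrow> real" where
  "koszul G F x X Y w =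
     G (F x) (dv (\<lambda>y. dv F y Y) x X) w
     + (dv (\<lambda>z. G z (dv F x Y) w) (F x) (dv F x X) + dv (\<lambda>z. G z (dv F x X) w) (F x) (dv F x Y)
        - dv (\<lambda>z. G z (dv F x X) (dv F x Y)) (F x) w) / 2"

text \<open>A metric in coordinates over an open set. Nondegeneracy and signature are left to the
  places that use them.\<close>

locale metric_family =
  fixes W :: "'e::euclidean_space set" and G :: "'e \<Rightarrow> 'e \<Rightarrow> 'e \<Rightarrow> real"
  assumes open_W: "open W" and bil: "y \<in> W \<Longrightarrow> bilinear (G y)" and sym: "y \<in> W \<Longrightarrow> G y u v = G y v u"
    and smooth: "smooth_on W (\<lambda>y. G y u v)"
begin

lemma linear_G: "y \<in> W \<Longrightarrow> linear (G y u)" "y \<in> W \<Longrightarrow> linear (\<lambda>u. G y u v)"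
  using bil by (auto simp: bilinear_def)

lemma smooth_on_differentiable:
  "smooth_on U f \<Longrightarrow> x \<in> U \<Longrightarrow> f differentiable (at x)"
  using smooth_on_has_derivative differentiableI by blast

lemma smooth_apply:
  assumes "open U" "smooth_on U h" "h ` U \<subseteq> W" "smooth_on U A" "smooth_on U B"
  shows "smooth_on U (\<lambda>z. G (h z) (A z) (B z))"
proof (rule smooth_on_bilinear_apply[OF assms(1) _ _ assms(4,5)])
  show "bilinear (G (h z))" if "z \<in> U" for z using that assms(3) bil by blast
  show "smooth_on U (\<lambda>z. G (h z) u v)" for u v
    by (rule smooth_on_compose[OF assms(1) open_W assms(3,2) smooth])
qed

text \<open>Three sources of variation are separated in turn: the first argument, the second
  argument, and the base point, the last by the chain rule.\<close>

lemma dv_apply: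
  assumes "open U" "smooth_on U h" "h ` U \<subseteq> W" "smooth_on U A" "smooth_on U B" "x \<in> U"
  shows "dv (\<lambda>z. G (h z) (A z) (B z)) x a =
    dv (\<lambda>z. G z (A x) (B x)) (h x) (dv h x a) + G (h x) (dv A x a) (B x) + G (h x) (A x) (dv B x a)"
proof -
  have hW: "h z \<in> W" if "z \<in> U" for z using assms(3) that by blast
  have "dv (\<lambda>z. G (h z) (A z) (B z)) x a
      = dv (\<lambda>z. G (h z) (A x) (B z)) x a + G (h x) (dv A x a) (B x)"
  proof (rule dv_linear_apply[where H = "\<lambda>z u. G (h z) u (B z)", OF assms(1,6)])
    show "linear (\<lambda>u. G (h y) u (B y))" if "y \<in> U" for y using linear_G(2)[OF hW[OF that]] .
    show "(\<lambda>y. G (h y) v (B y)) differentiable at x" for v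
      by (rule smooth_on_differentiable[OF smooth_apply[OF assms(1-3) smooth_on_const assms(5)] assms(6)])
    show "A differentiable at x" by (rule smooth_on_differentiable[OF assms(4,6)])
  qed
  also have "dv (\<lambda>z. G (h z) (A x) (B z)) x a
      = dv (\<lambda>z. G (h z) (A x) (B x)) x a + G (h x) (A x) (dv B x a)"
  proof (rule dv_linear_apply[where H = "\<lambda>z v. G (h z) (A x) v", OF assms(1,6)])
    show "linear (G (h y) (A x))" if "y \<in> U" for y using linear_G(1)[OF hW[OF that]] .
    show "(\<lambda>y. G (h y) (A x) v) differentiable at x" for v
      by (rule smooth_on_differentiable[OF smooth_apply[OF assms(1-3) smooth_on_const smooth_on_const] assms(6)])
    show "B differentiable at x" by (rule smooth_on_differentiable[OF assms(5,6)])
  qed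
  also have "dv (\<lambda>z. G (h z) (A x) (B x)) x a = dv (\<lambda>z. G z (A x) (B x)) (h x) (dv h x a)"
    by (rule dv_compose[OF assms(2,6) smooth hW[OF assms(6)], THEN fun_cong])
  finally show ?thesis by simp
qed

lemma linear_dv_G: "y \<in> W \<Longrightarrow> linear (dv (\<lambda>z. G z u v) y)"
  by (rule smooth_on_linear_dv[OF smooth])

lemma bilinear_dv_G:
  assumes y: "y \<in> W" shows "bilinear (\<lambda>u v. dv (\<lambda>z. G z u v) y a)"
proof -
  have d: "((\<lambda>z. G z u v) has_derivative dv (\<lambda>z. G z u v) y) (at y)" for u v
    by (rule smooth_on_has_derivative[OF smooth y])
  note cong = dv_cong[OF open_W y, THEN fun_cong]
  have "dv (\<lambda>z. G z u (v + v')) y a = dv (\<lambda>z. G z u v) y a + dv (\<lambda>z. G z u v') y a" for u v v'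
  proof -
    have "dv (\<lambda>z. G z u (v + v')) y a = dv (\<lambda>z. G z u v + G z u v') y a"
      by (rule cong) (simp add: bilinear_radd[OF bil])
    then show ?thesis by (simp add: dv_eqI[OF has_derivative_add[OF d d]])
  qed
  moreover have "dv (\<lambda>z. G z (u + u') v) y a = dv (\<lambda>z. G z u v) y a + dv (\<lambda>z. G z u' v) y a" for u u' v
  proof -
    have "dv (\<lambda>z. G z (u + u') v) y a = dv (\<lambda>z. G z u v + G z u' v) y a"
      by (rule cong) (simp add: bilinear_ladd[OF bil])
    then show ?thesis by (simp add: dv_eqI[OF has_derivative_add[OF d d]])
  qed
  moreover have "dv (\<lambda>z. G z u (c *\<^sub>R v)) y a = c *\<^sub>R dv (\<lambda>z. G z u v) y a" for u v c
  proof -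
    have "dv (\<lambda>z. G z u (c *\<^sub>R v)) y a = dv (\<lambda>z. c *\<^sub>R G z u v) y a"
      by (rule cong) (simp add: bilinear_rmul[OF bil])
    then show ?thesis by (simp add: dv_eqI[OF has_derivative_scaleR_right[OF d]] del: real_scaleR_def)
  qed
  moreover have "dv (\<lambda>z. G z (c *\<^sub>R u) v) y a = c *\<^sub>R dv (\<lambda>z. G z u v) y a" for u v c
  proof -
    have "dv (\<lambda>z. G z (c *\<^sub>R u) v) y a = dv (\<lambda>z. c *\<^sub>R G z u v) y a"
      by (rule cong) (simp add: bilinear_lmul[OF bil])
    then show ?thesis by (simp add: dv_eqI[OF has_derivative_scaleR_right[OF d]] del: real_scaleR_def)
  qed
  ultimately show ?thesis unfolding bilinear_def by (auto intro!: linearI)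
qed

lemma dv_G_sym: "y \<in> W \<Longrightarrow> dv (\<lambda>z. G z u v) y a = dv (\<lambda>z. G z v u) y a"
  by (rule dv_cong[OF open_W, THEN fun_cong]) (auto intro: sym)

text \<open>The form combines \<open>G\<close>, its first derivatives and derivatives of
  \<open>F\<close>, with no inverse metric. The resulting continuity later separates the two null
  lines.\<close>

lemma koszul_smooth:
  assumes U: "open U" and F: "smooth_on U F" "F ` U \<subseteq> W" and w: "smooth_on U w"
  shows "smooth_on U (\<lambda>x. koszul G F x X Y (w x))"
proof -
  have FW: "F x \<in> W" if "x \<in> U" for x using F(2) that by blast
  have FX: "smooth_on U (\<lambda>x. dv F x X)" for X by (rule smooth_on_dv[OF F(1)])
  have 1: "smooth_on U (\<lambda>x. dv (\<lambda>z. G z u v) (F x) (a x))" if "smooth_on U a" for a u v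
  proof (rule smooth_on_linear_apply[OF U _ _ that])
    show "linear (dv (\<lambda>z. G z u v) (F x))" if "x \<in> U" for x by (rule linear_dv_G[OF FW[OF that]])
    show "smooth_on U (\<lambda>x. dv (\<lambda>z. G z u v) (F x) b)" for b
      by (rule smooth_on_compose[OF U open_W F(2,1) smooth_on_dv[OF smooth]])
  qed
  have 2: "smooth_on U (\<lambda>x. dv (\<lambda>z. G z (u x) (v x)) (F x) (a x))"
    if "smooth_on U a" "smooth_on U u" "smooth_on U v" for a u v
  proof (rule smooth_on_bilinear_apply[where H = "\<lambda>x u v. dv (\<lambda>z. G z u v) (F x) (a x)", OF U _ _ that(2,3)])
    show "bilinear (\<lambda>u v. dv (\<lambda>z. G z u v) (F x) (a x))" if "x \<in> U" for x
      by (rule bilinear_dv_G[OF FW[OF that]])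
    show "smooth_on U (\<lambda>x. dv (\<lambda>z. G z u v) (F x) (a x))" for u v by (rule 1[OF that(1)])
  qed
  have 3: "smooth_on U (\<lambda>x. G (F x) (dv (\<lambda>y. dv F y Y) x X) (w x))"
    by (rule smooth_apply[OF U F smooth_on_dv[OF FX] w])
  have "smooth_on U (\<lambda>x. koszul G F x X Y (w x)) =
    smooth_on U (\<lambda>x. G (F x) (dv (\<lambda>y. dv F y Y) x X) (w x)
     + (1/2) * (dv (\<lambda>z. G z (dv F x Y) (w x)) (F x) (dv F x X) + dv (\<lambda>z. G z (dv F x X) (w x)) (F x) (dv F x Y)
        - dv (\<lambda>z. G z (dv F x X) (dv F x Y)) (F x) (w x)))"
    by (simp add: koszul_def)
  also have "\<dots>"
    by (rule smooth_on_add[OF U 3 smooth_on_mult[OF U smooth_on_const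
        smooth_on_diff[OF U smooth_on_add[OF U 2[OF FX FX w] 2[OF FX FX w]] 2[OF w FX FX]]]])
  finally show ?thesis .
qed

text \<open>The term needing care is the second derivative of \<open>F\<close> as a function of
  \<open>Y\<close>; exchanging the order of differentiation makes its linearity visible.\<close>

lemma koszul_bilinear:
  assumes U: "open U" and F: "smooth_on U F" "F ` U \<subseteq> W" and x: "x \<in> U"
  shows "bilinear (\<lambda>X Y. koszul G F x X Y w)"
proof -
  have FW: "F x \<in> W" using F(2) x by blast
  note lin = smooth_on_linear_dv[OF F(1)] and lin2 = smooth_on_linear_dv[OF smooth_on_dv[OF F(1)] x]
  have second: "dv (\<lambda>y. dv F y (Y + Y')) x X = dv (\<lambda>y. dv F y Y) x X + dv (\<lambda>y. dv F y Y') x X"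
    "dv (\<lambda>y. dv F y (c *\<^sub>R Y)) x X = c *\<^sub>R dv (\<lambda>y. dv F y Y) x X" for X Y Y' c
    by (simp_all add: dv_dv_commute[OF U F(1) x, of _ X] linear_add[OF lin2] linear_scale[OF lin2])
  show ?thesis
    unfolding bilinear_def koszul_def
    by (auto intro!: linearI simp: second linear_add[OF lin[OF x]] linear_scale[OF lin[OF x]]
        linear_add[OF lin2] linear_scale[OF lin2] linear_add[OF linear_dv_G[OF FW]] linear_scale[OF linear_dv_G[OF FW]]
        bilinear_ladd[OF bil[OF FW]] bilinear_lmul[OF bil[OF FW]]
        bilinear_ladd[OF bilinear_dv_G[OF FW]] bilinear_lmul[OF bilinear_dv_G[OF FW]]
        bilinear_radd[OF bilinear_dv_G[OF FW]] bilinear_rmul[OF bilinear_dv_G[OF FW]] algebra_simps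
        add_divide_distrib diff_divide_distrib)
qed

text \<open>The second derivative of \<open>F\<close> is symmetric, and exchanging \<open>X\<close>
  with \<open>Y\<close> swaps the first two metric derivatives. The symmetry of the second
  fundamental form comes from here.\<close>

lemma koszul_sym:
  assumes U: "open U" and F: "smooth_on U F" "F ` U \<subseteq> W" and x: "x \<in> U"
  shows "koszul G F x X Y w = koszul G F x Y X w"
proof -
  have "F x \<in> W" using F(2) x by blast
  from dv_G_sym[OF this, of "dv F x X" "dv F x Y" w] dv_dv_commute[OF U F(1) x, of X Y]
  show ?thesis by (simp add: koszul_def)
qed

text \<open>Differentiating \<open>dv F (\<psi> y) (dv \<psi> y Y)\<close> yields, besides the
  expected term, the image under \<open>dv F\<close> of the second derivative of
  \<open>\<psi>\<close>. That vector is tangential, and the orthogonality of \<open>w\<close> to the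
  tangent space removes it.\<close>

lemma koszul_source_change:
  assumes U: "open U" and F: "smooth_on U F" "F ` U \<subseteq> W"
    and V: "open V" and \<psi>: "smooth_on V \<psi>" "\<psi> ` V \<subseteq> U" and x: "x \<in> V"
    and w: "\<And>Z. G (F (\<psi> x)) (dv F (\<psi> x) Z) w = 0"
  shows "koszul G (\<lambda>y. F (\<psi> y)) x X Y w = koszul G F (\<psi> x) (dv \<psi> x X) (dv \<psi> x Y) w"
proof -
  have \<psi>U: "\<psi> y \<in> U" if "y \<in> V" for y using \<psi>(2) that by blast
  have FW: "F (\<psi> x) \<in> W" using F(2) \<psi>U[OF x] by blast
  have 1: "dv (\<lambda>y. F (\<psi> y)) y = (\<lambda>Y. dv F (\<psi> y) (dv \<psi> y Y))" if "y \<in> V" for y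
    by (rule dv_compose[OF \<psi>(1) that F(1) \<psi>U[OF that]])
  have "dv (\<lambda>y. dv (\<lambda>y. F (\<psi> y)) y Y) x X = dv (\<lambda>y. dv F (\<psi> y) (dv \<psi> y Y)) x X"
    by (rule dv_cong[OF V x, THEN fun_cong]) (simp add: 1)
  also have "\<dots> = dv (\<lambda>y. dv F (\<psi> y) (dv \<psi> x Y)) x X + dv F (\<psi> x) (dv (\<lambda>y. dv \<psi> y Y) x X)"
  proof (rule dv_linear_apply[where H = "\<lambda>y. dv F (\<psi> y)", OF V x])
    show "linear (dv F (\<psi> y))" if "y \<in> V" for y by (rule smooth_on_linear_dv[OF F(1) \<psi>U[OF that]])
    show "(\<lambda>y. dv F (\<psi> y) v) differentiable at x" for v
      by (rule smooth_on_differentiable[OF smooth_on_compose[OF V U \<psi>(2,1) smooth_on_dv[OF F(1)]] x])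
    show "(\<lambda>y. dv \<psi> y Y) differentiable at x"
      by (rule smooth_on_differentiable[OF smooth_on_dv[OF \<psi>(1)] x])
  qed
  also have "dv (\<lambda>y. dv F (\<psi> y) (dv \<psi> x Y)) x X = dv (\<lambda>z. dv F z (dv \<psi> x Y)) (\<psi> x) (dv \<psi> x X)"
    by (rule dv_compose[OF \<psi>(1) x smooth_on_dv[OF F(1)] \<psi>U[OF x], THEN fun_cong])
  finally have "G (F (\<psi> x)) (dv (\<lambda>y. dv (\<lambda>y. F (\<psi> y)) y Y) x X) w
      = G (F (\<psi> x)) (dv (\<lambda>z. dv F z (dv \<psi> x Y)) (\<psi> x) (dv \<psi> x X)) w"
    by (simp add: bilinear_ladd[OF bil[OF FW]] w)
  then show ?thesis by (simp add: koszul_def 1[OF x])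
qed

text \<open>The second derivative of \<open>\<phi>\<close> enters the derivatives of the pulled back metric and the
  second derivative of \<open>\<phi> \<circ> F\<close>; by its symmetry all these contributions cancel.\<close>

lemma koszul_target_change:
  assumes G': "metric_family W' G'" and \<phi>: "smooth_on W \<phi>" "\<phi> ` W \<subseteq> W'"
    and pull: "\<And>y u v. y \<in> W \<Longrightarrow> G y u v = G' (\<phi> y) (dv \<phi> y u) (dv \<phi> y v)"
    and U: "open U" and F: "smooth_on U F" "F ` U \<subseteq> W" and x: "x \<in> U"
  shows "koszul G' (\<lambda>y. \<phi> (F y)) x X Y (dv \<phi> (F x) w) = koszul G F x X Y w"
proof -
  interpret G': metric_family W' G' by (rule G')
  have FU: "F y \<in> W" if "y \<in> U" for y using F(2) that by blast
  have \<phi>W: "\<phi> (F x) \<in> W'" using \<phi>(2) FU[OF x] by blast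
  \<comment> \<open>\<open>Q\<close> is the second derivative of \<open>\<phi>\<close> at
    \<open>F x\<close> and \<open>D\<close> the derivative of the target metric; everything below is
    expressed through them.\<close>
  define Q where "Q a u = dv (\<lambda>z. dv \<phi> z u) (F x) a" for a u
  define D where "D a u v = dv (\<lambda>z. G' z u v) (\<phi> (F x)) a" for a u v
  define A where "A = dv F x X"
  define B where "B = dv F x Y"
  have Q: "Q a u = Q u a" for a u
    unfolding Q_def by (rule dv_dv_commute[OF open_W \<phi>(1) FU[OF x]])
  have 1: "dv (\<lambda>y. \<phi> (F y)) y = (\<lambda>Y. dv \<phi> (F y) (dv F y Y))" if "y \<in> U" for y
    by (rule dv_compose[OF F(1) that \<phi>(1) FU[OF that]])
  have "dv (\<lambda>y. dv (\<lambda>y. \<phi> (F y)) y Y) x X = dv (\<lambda>y. dv \<phi> (F y) (dv F y Y)) x X"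
    by (rule dv_cong[OF U x, THEN fun_cong]) (simp add: 1)
  also have "\<dots> = dv (\<lambda>y. dv \<phi> (F y) (dv F x Y)) x X + dv \<phi> (F x) (dv (\<lambda>y. dv F y Y) x X)"
  proof (rule dv_linear_apply[where H = "\<lambda>y. dv \<phi> (F y)", OF U x])
    show "linear (dv \<phi> (F y))" if "y \<in> U" for y by (rule smooth_on_linear_dv[OF \<phi>(1) FU[OF that]])
    show "(\<lambda>y. dv \<phi> (F y) v) differentiable at x" for v
      by (rule smooth_on_differentiable[OF smooth_on_compose[OF U open_W F(2,1) smooth_on_dv[OF \<phi>(1)]] x])
    show "(\<lambda>y. dv F y Y) differentiable at x"
      by (rule smooth_on_differentiable[OF smooth_on_dv[OF F(1)] x])
  qed
  also have "dv (\<lambda>y. dv \<phi> (F y) (dv F x Y)) x X = Q A B"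
    unfolding Q_def A_def B_def
    by (rule dv_compose[OF F(1) x smooth_on_dv[OF \<phi>(1)] FU[OF x], THEN fun_cong])
  finally have second: "dv (\<lambda>y. dv (\<lambda>y. \<phi> (F y)) y Y) x X = Q A B + dv \<phi> (F x) (dv (\<lambda>y. dv F y Y) x X)" .
  have DG: "dv (\<lambda>z. G z u v) (F x) a = D (dv \<phi> (F x) a) (dv \<phi> (F x) u) (dv \<phi> (F x) v)
      + G' (\<phi> (F x)) (Q a u) (dv \<phi> (F x) v) + G' (\<phi> (F x)) (Q a v) (dv \<phi> (F x) u)" for a u v
  proof -
    have "dv (\<lambda>z. G z u v) (F x) a = dv (\<lambda>z. G' (\<phi> z) (dv \<phi> z u) (dv \<phi> z v)) (F x) a"
      by (rule dv_cong[OF open_W FU[OF x], THEN fun_cong]) (simp add: pull)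
    also have "\<dots> = D (dv \<phi> (F x) a) (dv \<phi> (F x) u) (dv \<phi> (F x) v)
        + G' (\<phi> (F x)) (Q a u) (dv \<phi> (F x) v) + G' (\<phi> (F x)) (dv \<phi> (F x) u) (Q a v)"
      unfolding D_def Q_def
      by (rule G'.dv_apply[OF open_W \<phi> smooth_on_dv[OF \<phi>(1)] smooth_on_dv[OF \<phi>(1)] FU[OF x]])
    finally show ?thesis by (simp add: G'.sym[OF \<phi>W])
  qed
  \<comment> \<open>In the Koszul combination the terms with \<open>Q A w\<close> and
    \<open>Q B w\<close> cancel in pairs, while the two terms with \<open>Q A B\<close> add up; half
    of their sum is precisely the extra term in \<open>second\<close>.\<close>
  show ?thesis
    unfolding koszul_def second unfolding 1[OF x] A_def[symmetric] B_def[symmetric] DG D_def[symmetric]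
    by (simp add: pull[OF FU[OF x]] bilinear_ladd[OF G'.bil[OF \<phi>W]] Q[of B A] Q[of w A] Q[of w B])
qed

lemma koszul_linear:
  assumes F: "smooth_on U F" "F ` U \<subseteq> W" and x: "x \<in> U"
  shows "linear (koszul G F x X Y)"
proof -
  have FW: "F x \<in> W" using F(2) x by blast
  show ?thesis
    unfolding koszul_def
    by (auto intro!: linearI simp: linear_add[OF linear_dv_G[OF FW]] linear_scale[OF linear_dv_G[OF FW]]
        bilinear_radd[OF bil[OF FW]] bilinear_rmul[OF bil[OF FW]]
        bilinear_radd[OF bilinear_dv_G[OF FW]] bilinear_rmul[OF bilinear_dv_G[OF FW]] algebra_simps
        add_divide_distrib diff_divide_distrib)
qed

text \<open>Gram-Schmidt, one coordinate direction at a time: the only divisions are by the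
  nonvanishing square of \<open>E\<close>, so smoothness is kept without inverting a Gram matrix.
  The induction ranges over all \<open>V\<close> because it is applied to the given field and to the
  new direction \<open>dv F x b\<close> alike.\<close>

lemma smooth_partial_projection:
  assumes U: "open U" and F: "smooth_on U F" "F ` U \<subseteq> W"
    and pos: "\<And>x X. x \<in> U \<Longrightarrow> X \<noteq> 0 \<Longrightarrow> G (F x) (dv F x X) (dv F x X) > 0"
    and C: "finite C" "C \<subseteq> Basis" and V: "smooth_on U V"
  shows "\<exists>V'. smooth_on U V' \<and>
    (\<forall>x\<in>U. (\<forall>b\<in>C. G (F x) (V' x) (dv F x b) = 0) \<and> (\<exists>X\<in>span C. V x - V' x = dv F x X))"
  using C V
proof (induction C arbitrary: V rule: finite_induct)
  case empty
  have "V x - V x = dv F x 0" if "x \<in> U" for x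
    by (simp add: linear_0[OF smooth_on_linear_dv[OF F(1) that]])
  with empty show ?case by (intro exI[of _ V]) auto
next
  case (insert b C)
  obtain V1 where V1: "smooth_on U V1" "\<And>x c. x \<in> U \<Longrightarrow> c \<in> C \<Longrightarrow> G (F x) (V1 x) (dv F x c) = 0"
    "\<And>x. x \<in> U \<Longrightarrow> \<exists>X\<in>span C. V x - V1 x = dv F x X"
    using insert.IH[OF _ insert.prems(2)] insert.prems(1) by auto
  obtain E where E: "smooth_on U E" "\<And>x c. x \<in> U \<Longrightarrow> c \<in> C \<Longrightarrow> G (F x) (E x) (dv F x c) = 0"
    "\<And>x. x \<in> U \<Longrightarrow> \<exists>X\<in>span C. dv F x b - E x = dv F x X"
    using insert.IH[OF _ smooth_on_dv[OF F(1), of b]] insert.prems(1) by auto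
  have lin: "linear (dv F x)" if "x \<in> U" for x by (rule smooth_on_linear_dv[OF F(1) that])
  have FW: "F x \<in> W" if "x \<in> U" for x using F(2) that by blast
  have "independent (insert b C)" using independent_mono[OF independent_Basis] insert.prems(1) by blast
  then have b: "b \<notin> span C" using insert.hyps(2) by (simp add: independent_insert)
  define r where "r x = G (F x) (V1 x) (E x) / G (F x) (E x) (E x)" for x
  \<comment> \<open>\<open>E x\<close> is the image of \<open>b - Z\<close> with \<open>Z\<close> in
    the span of \<open>C\<close>, and \<open>b\<close> lies outside that span.\<close>
  have Epos: "G (F x) (E x) (E x) > 0" if x: "x \<in> U" for x
  proof -
    obtain Z where Z: "Z \<in> span C" "dv F x b - E x = dv F x Z" using E(3)[OF x] by blast
    then have "E x = dv F x (b - Z)" by (simp add: linear_diff[OF lin[OF x]] algebra_simps)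
    moreover have "b - Z \<noteq> 0" using b Z(1) by auto
    ultimately show ?thesis using pos[OF x] by metis
  qed
  define V' where "V' x = V1 x - r x *\<^sub>R E x" for x
  have "smooth_on U V'"
    unfolding V'_def r_def
    by (intro smooth_on_diff[OF U V1(1)] smooth_on_scaleR[OF U _ E(1)] smooth_on_divide[OF U]
        smooth_apply[OF U F] V1(1) E(1)) (use Epos in force)
  moreover have "(\<forall>c\<in>insert b C. G (F x) (V' x) (dv F x c) = 0) \<and>
      (\<exists>X\<in>span (insert b C). V x - V' x = dv F x X)" if x: "x \<in> U" for x
  proof
    note bl = bil[OF FW[OF x]]
    obtain Z where Z: "Z \<in> span C" "dv F x b - E x = dv F x Z" using E(3)[OF x] by blast
    obtain Z1 where Z1: "Z1 \<in> span C" "V x - V1 x = dv F x Z1" using V1(3)[OF x] by blast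
    have c: "G (F x) (V' x) (dv F x c) = 0" if "c \<in> C" for c
      using V1(2)[OF x that] E(2)[OF x that] by (simp add: V'_def bilinear_lsub[OF bl] bilinear_lmul[OF bl])
    have "linear (\<lambda>c. G (F x) (V' x) (dv F x c))"
      using linear_compose[OF lin[OF x] linear_G(1)[OF FW[OF x]]] by (simp add: o_def)
    then have "G (F x) (V' x) (dv F x Z) = 0"
      by (rule linear_eq_0_on_span[OF _ c Z(1)])
    moreover have "G (F x) (V' x) (E x) = 0"
      using Epos[OF x] by (simp add: V'_def r_def bilinear_lsub[OF bl] bilinear_lmul[OF bl])
    moreover have "dv F x b = E x + dv F x Z" using Z(2) by (simp add: algebra_simps)
    ultimately have "G (F x) (V' x) (dv F x b) = 0" by (simp add: bilinear_radd[OF bl])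
    then show "\<forall>c\<in>insert b C. G (F x) (V' x) (dv F x c) = 0" using c by simp
    have "E x = dv F x (b - Z)"
      using Z(2) by (simp add: linear_diff[OF lin[OF x]] algebra_simps)
    moreover have "V x - V' x = (V x - V1 x) + r x *\<^sub>R E x" by (simp add: V'_def)
    ultimately have "V x - V' x = dv F x (Z1 + r x *\<^sub>R (b - Z))"
      by (simp only: Z1(2) linear_add[OF lin[OF x]] linear_scale[OF lin[OF x]])
    moreover have "span C \<subseteq> span (insert b C)" by (rule span_mono) blast
    then have "Z1 + r x *\<^sub>R (b - Z) \<in> span (insert b C)"
      using Z1(1) Z(1) by (intro span_add span_scale span_diff) (auto intro: span_base)
    ultimately show "\<exists>X\<in>span (insert b C). V x - V' x = dv F x X" by blast
  qed
  ultimately show ?case by blast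
qed

lemma smooth_projection:
  assumes U: "open U" and F: "smooth_on U F" "F ` U \<subseteq> W"
    and pos: "\<And>x X. x \<in> U \<Longrightarrow> X \<noteq> 0 \<Longrightarrow> G (F x) (dv F x X) (dv F x X) > 0"
    and V: "smooth_on U V"
  shows "\<exists>V'. smooth_on U V' \<and>
    (\<forall>x\<in>U. (\<forall>X. G (F x) (V' x) (dv F x X) = 0) \<and> (\<exists>X. V' x = V x - dv F x X))"
proof -
  obtain V' where V': "smooth_on U V'" "\<forall>x\<in>U. (\<forall>b\<in>Basis. G (F x) (V' x) (dv F x b) = 0) \<and>
      (\<exists>X\<in>span Basis. V x - V' x = dv F x X)"
    using smooth_partial_projection[OF U F pos finite_Basis subset_refl V] by blast
  have "G (F x) (V' x) (dv F x X) = 0" if "x \<in> U" for x X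
  proof -
    have "F x \<in> W" using F(2) that by blast
    then have lin: "linear (\<lambda>c. G (F x) (V' x) (dv F x c))"
      using linear_compose[OF smooth_on_linear_dv[OF F(1) that] linear_G(1)] by (simp add: o_def)
    show ?thesis
      by (rule linear_eq_on_Basis[OF lin linear_zero]) (use V'(2) that in blast)
  qed
  moreover have "\<exists>X. V' x = V x - dv F x X" if "x \<in> U" for x
  proof -
    obtain X where "V x - V' x = dv F x X" using V'(2) \<open>x \<in> U\<close> by blast
    then have "V' x = V x - dv F x X" by (simp add: algebra_simps)
    then show ?thesis by blast
  qed
  ultimately show ?thesis using V'(1) by blast
qed

end

locale spacelike_family = metric_family W G
  for W :: "'e::euclidean_space set" and G +
  fixes U :: "'f::euclidean_space set" and F :: "'f \<Rightarrow> 'e" and T :: "'f \<Rightarrow> 'e"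
  assumes U: "open U" and F: "smooth_on U F" "F ` U \<subseteq> W" and T: "smooth_on U T"
    and plane: "x \<in> U \<Longrightarrow> spacelike_plane (G (F x)) (dv F x) (T x)"
begin

abbreviation normal :: "'f \<Rightarrow> 'e \<Rightarrow> bool" where
  "normal x \<equiv> spacelike_plane.normal (G (F x)) (dv F x)"

abbreviation null_frame :: "'f \<Rightarrow> 'e \<Rightarrow> 'e \<Rightarrow> bool" where
  "null_frame x \<equiv> spacelike_plane.null_frame (G (F x)) (dv F x)"

text \<open>The normal part of \<open>T\<close> is a smooth timelike normal field \<open>N\<close>.
  A normal vector at \<open>x0\<close> orthogonal to \<open>N\<close> is extended as a constant,
  projected to the normal planes and then off \<open>N\<close>. Near \<open>x0\<close> the result
  has positive square and can be scaled to the square opposite to that of \<open>N\<close>.\<close>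

lemma smooth_null_frame:
  assumes x0: "x0 \<in> U"
  shows "\<exists>V A B. open V \<and> x0 \<in> V \<and> V \<subseteq> U \<and> smooth_on V A \<and> smooth_on V B \<and>
    (\<forall>x\<in>V. null_frame x (A x) (B x))"
proof -
  have pos: "G (F x) (dv F x X) (dv F x X) > 0" if "x \<in> U" "X \<noteq> 0" for x X
    using spacelike_plane.pos[OF plane[OF that(1)] that(2)] .
  have normal_def: "normal x v \<longleftrightarrow> (\<forall>X. G (F x) v (dv F x X) = 0)" if "x \<in> U" for x v
    by (rule spacelike_plane.normal_def[OF plane[OF that]])
  obtain N where "smooth_on U N"
    and "\<forall>x\<in>U. (\<forall>X. G (F x) (N x) (dv F x X) = 0) \<and> (\<exists>X. N x = T x - dv F x X)"
    using smooth_projection[OF U F pos T] by blast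
  then have N: "smooth_on U N" "\<And>x X. x \<in> U \<Longrightarrow> G (F x) (N x) (dv F x X) = 0"
    "\<And>x. x \<in> U \<Longrightarrow> \<exists>X. N x = T x - dv F x X" by simp_all
  have N_normal: "normal x (N x)" if "x \<in> U" for x using N(2) normal_def that by blast
  have N_neg: "G (F x) (N x) (N x) < 0" if x: "x \<in> U" for x
  proof -
    obtain X where X: "N x = T x - dv F x X" using N(3)[OF x] by blast
    show ?thesis
      using spacelike_plane.timelike_normal_part[OF plane[OF x], of X] N_normal[OF x] unfolding X by blast
  qed
  obtain v where v: "normal x0 v" "G (F x0) (N x0) v = 0" "v \<noteq> 0"
    using spacelike_plane.second_normal_exists[OF plane[OF x0] N_normal[OF x0] N_neg[OF x0]] by blast
  obtain E where "smooth_on U E"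
    and "\<forall>x\<in>U. (\<forall>X. G (F x) (E x) (dv F x X) = 0) \<and> (\<exists>X. E x = v - dv F x X)"
    using smooth_projection[OF U F pos smooth_on_const[of U v]] by blast
  then have E: "smooth_on U E" "\<And>x X. x \<in> U \<Longrightarrow> G (F x) (E x) (dv F x X) = 0"
    "\<And>x. x \<in> U \<Longrightarrow> \<exists>X. E x = v - dv F x X" by simp_all
  have E_normal: "normal x (E x)" if "x \<in> U" for x using E(2) normal_def that by blast
  \<comment> \<open>Projection fixes a vector that is already normal, so the extension really passes
    through \<open>v\<close>.\<close>
  have E0: "E x0 = v"
  proof -
    obtain X where X: "E x0 = v - dv F x0 X" using E(3)[OF x0] by blast
    have lin0: "dv F x0 0 = 0" by (rule linear_0[OF smooth_on_linear_dv[OF F(1) x0]])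
    have "X = 0"
      by (rule spacelike_plane.projection_unique[OF plane[OF x0], of v])
        (use v(1) E_normal[OF x0] in \<open>simp_all add: X lin0\<close>)
    then show ?thesis using X lin0 by simp
  qed
  define r where "r x = G (F x) (N x) (E x) / G (F x) (N x) (N x)" for x
  define w where "w x = E x - r x *\<^sub>R N x" for x
  define q where "q x = G (F x) (w x) (w x)" for x
  have r: "smooth_on U r"
    unfolding r_def
    by (rule smooth_on_divide[OF U _ smooth_apply[OF U F N(1) E(1)] smooth_apply[OF U F N(1) N(1)]])
      (use N_neg in force)
  have w: "smooth_on U w"
    unfolding w_def by (intro smooth_on_diff[OF U E(1)] smooth_on_scaleR[OF U r N(1)])
  have q: "smooth_on U q" unfolding q_def by (rule smooth_apply[OF U F w w])
  have w_normal: "normal x (w x)" if "x \<in> U" for x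
    unfolding w_def
    by (intro spacelike_plane.normal_diff[OF plane[OF that]] spacelike_plane.normal_scale[OF plane[OF that]]
        E_normal N_normal that)
  have Nw: "G (F x) (N x) (w x) = 0" if "x \<in> U" for x
  proof -
    have "bilinear (G (F x))" using F(2) that bil by blast
    then show ?thesis
      using N_neg[OF that] by (simp add: w_def r_def bilinear_rsub bilinear_rmul)
  qed
  have "w x0 = v" using v(2) by (simp add: w_def r_def E0)
  then have "q x0 > 0"
    using spacelike_plane.complement[OF plane[OF x0] N_neg[OF x0] v(2,3)] by (simp add: q_def)
  \<comment> \<open>The square \<open>q\<close> is known to be positive only at \<open>x0\<close>,
    hence nearby; this is why the frame is local.\<close>
  define V where "V = U \<inter> q -` {0<..}"
  have V: "open V" "x0 \<in> V" "V \<subseteq> U"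
    using continuous_on_open_vimage[OF U, of q] smooth_on_continuous[OF q] x0 \<open>q x0 > 0\<close>
    by (auto simp: V_def Int_commute)
  define z where "z x = sqrt (- G (F x) (N x) (N x) / q x) *\<^sub>R w x" for x
  have qpos: "q x > 0" if "x \<in> V" for x using that by (simp add: V_def)
  have FV: "F ` V \<subseteq> W" using F(2) V(3) by blast
  note sub = smooth_on_subset[OF _ V(3)]
  have "smooth_on V (\<lambda>x. - G (F x) (N x) (N x))"
    by (rule smooth_on_minus[OF V(1) sub[OF smooth_apply[OF U F N(1) N(1)]]])
  then have "smooth_on V (\<lambda>x. - G (F x) (N x) (N x) / q x)"
    by (rule smooth_on_divide[OF V(1) _ _ sub[OF q], rotated]) (use qpos in force)
  then have "smooth_on V (\<lambda>x. sqrt (- G (F x) (N x) (N x) / q x))"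
    by (rule smooth_on_sqrt[OF V(1), rotated])
      (use qpos N_neg V(3) in \<open>simp add: divide_neg_pos subset_iff\<close>)
  then have z: "smooth_on V z"
    unfolding z_def by (rule smooth_on_scaleR[OF V(1) _ sub[OF w]])
  have frame: "null_frame x (N x + z x) (N x - z x)" if x: "x \<in> V" for x
  proof -
    have xU: "x \<in> U" using V(3) x by blast
    have bl: "bilinear (G (F x))" using F(2) xU bil by blast
    show ?thesis
    proof (rule spacelike_plane.null_frameI[OF plane[OF xU] N_normal[OF xU] N_neg[OF xU]])
      show "normal x (z x)"
        unfolding z_def by (rule spacelike_plane.normal_scale[OF plane[OF xU] w_normal[OF xU]])
      show "G (F x) (N x) (z x) = 0" by (simp add: z_def bilinear_rmul[OF bl] Nw[OF xU])
      have "G (F x) (z x) (z x) = (sqrt (- G (F x) (N x) (N x) / q x))\<^sup>2 * q x"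
        unfolding z_def q_def bilinear_rmul[OF bl] bilinear_lmul[OF bl]
        by (simp only: power2_eq_square real_scaleR_def mult.assoc)
      also have "\<dots> = - G (F x) (N x) (N x) / q x * q x"
        using qpos[OF x] N_neg[OF xU] by (subst real_sqrt_pow2) (simp_all add: divide_nonpos_pos less_imp_le)
      also have "\<dots> = - G (F x) (N x) (N x)"
        using qpos[OF x] by simp
      finally show "G (F x) (z x) (z x) = - G (F x) (N x) (N x)" .
    qed
  qed
  show ?thesis
    using V smooth_on_add[OF V(1) sub[OF N(1)] z] smooth_on_diff[OF V(1) sub[OF N(1)] z] frame
    by (intro exI[of _ V] exI[of _ "\<lambda>x. N x + z x"] exI[of _ "\<lambda>x. N x - z x"]) simp
qed

text \<open>A null normal field is everywhere proportional to one member of a smooth null frame; the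
  form \<open>koszul G F x X Y\<close>, which annihilates the field but not the whole normal plane, tells by
  continuity which one.\<close>

lemma null_section_smooth:
  assumes x0: "x0 \<in> U"
    and \<eta>: "\<And>x. x \<in> U \<Longrightarrow> normal x (\<eta> x)" "\<And>x. x \<in> U \<Longrightarrow> G (F x) (\<eta> x) (\<eta> x) = 0"
      "\<And>x. x \<in> U \<Longrightarrow> G (F x) (\<eta> x) (T x) = - 1"
    and ann: "\<And>x. x \<in> U \<Longrightarrow> koszul G F x X Y (\<eta> x) = 0"
    and v: "normal x0 v" "koszul G F x0 X Y v \<noteq> 0"
  shows "\<exists>V. open V \<and> x0 \<in> V \<and> V \<subseteq> U \<and> smooth_on V \<eta>"
proof -
  obtain V A B where V: "open V" "x0 \<in> V" "V \<subseteq> U" "smooth_on V A" "smooth_on V B"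
    "\<forall>x\<in>V. null_frame x (A x) (B x)"
    using smooth_null_frame[OF x0] by blast
  then have AB: "smooth_on V A" "smooth_on V B" "\<And>x. x \<in> V \<Longrightarrow> null_frame x (A x) (B x)" by simp_all
  have FV: "F ` V \<subseteq> W" "smooth_on V F" "smooth_on V T"
    using F T V(3) smooth_on_subset by blast+
  have lin: "linear (koszul G F x X Y)" if "x \<in> U" for x by (rule koszul_linear[OF F that])
  \<comment> \<open>Exchanging the frame vectors reduces everything to a field that lies on the line
    of \<open>B\<close> at \<open>x0\<close>.\<close>
  have main: ?thesis if AB: "smooth_on V A" "smooth_on V B" "\<And>x. x \<in> V \<Longrightarrow> null_frame x (A x) (B x)"
    and B0: "\<eta> x0 = b *\<^sub>R B x0" for A B b
  proof -
    define k where "k x = koszul G F x X Y (A x)" for x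
    have "\<eta> x0 \<noteq> 0" using \<eta>(3)[OF x0] bilinear_lzero[OF bil] F(2) x0 by fastforce
    then have "koszul G F x0 X Y (B x0) = 0"
      using ann[OF x0] linear_scale[OF lin[OF x0]] by (simp add: B0)
    \<comment> \<open>The form annihilates \<open>B x0\<close>, so its nonzero value at
      \<open>v\<close> comes from the component along \<open>A x0\<close>.\<close>
    moreover obtain r s where "v = r *\<^sub>R A x0 + s *\<^sub>R B x0"
      using AB(3)[OF V(2)] v(1) spacelike_plane.null_frame_def[OF plane[OF x0]] by blast
    ultimately have "k x0 \<noteq> 0"
      using v(2) by (auto simp: k_def linear_add[OF lin[OF x0]] linear_scale[OF lin[OF x0]])
    have k: "continuous_on V k"
      unfolding k_def by (rule smooth_on_continuous[OF koszul_smooth[OF V(1) FV(2,1) AB(1)]])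
    \<comment> \<open>On \<open>V'\<close> the form does not annihilate \<open>A\<close>, so the
      field, which it does annihilate, cannot jump to the line of \<open>A\<close>.\<close>
    define V' where "V' = V \<inter> k -` (- {0})"
    have V': "open V'" "x0 \<in> V'" "V' \<subseteq> V"
      using continuous_on_open_vimage[OF V(1), of k] k V(2) \<open>k x0 \<noteq> 0\<close>
      by (auto simp: V'_def Int_commute)
    have eq: "\<eta> x = (- 1 / G (F x) (B x) (T x)) *\<^sub>R B x" "G (F x) (B x) (T x) \<noteq> 0" if "x \<in> V'" for x
    proof -
      have x: "x \<in> V" "x \<in> U" using that V'(3) V(3) by auto
      have bl: "bilinear (G (F x))" using F(2) x(2) bil by blast
      have "\<eta> x \<noteq> 0" using \<eta>(3)[OF x(2)] bilinear_lzero[OF bl] by fastforce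
      have "\<nexists>a. \<eta> x = a *\<^sub>R A x"
      proof
        assume "\<exists>a. \<eta> x = a *\<^sub>R A x"
        then obtain a where a: "\<eta> x = a *\<^sub>R A x" by blast
        then have "k x = 0"
          using ann[OF x(2)] \<open>\<eta> x \<noteq> 0\<close> by (simp add: k_def linear_scale[OF lin[OF x(2)]])
        then show False using that by (simp add: V'_def)
      qed
      then obtain c where c: "\<eta> x = c *\<^sub>R B x"
        using spacelike_plane.null_in_frame[OF plane[OF x(2)] AB(3)[OF x(1)] \<eta>(1,2)[OF x(2)]] by blast
      then have "c * G (F x) (B x) (T x) = - 1"
        using \<eta>(3)[OF x(2)] by (simp add: bilinear_lmul[OF bl])
      then show nz: "G (F x) (B x) (T x) \<noteq> 0" by auto
      have "c = - 1 / G (F x) (B x) (T x)"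
        by (rule iffD2[OF nonzero_eq_divide_eq[OF nz]]) fact
      then show "\<eta> x = (- 1 / G (F x) (B x) (T x)) *\<^sub>R B x" using c by simp
    qed
    note sub = smooth_on_subset[OF _ V'(3)]
    have FV': "F ` V' \<subseteq> W" using FV(1) V'(3) by blast
    have "smooth_on V' (\<lambda>x. (- 1 / G (F x) (B x) (T x)) *\<^sub>R B x)"
      by (rule smooth_on_scaleR[OF V'(1) smooth_on_divide[OF V'(1) eq(2) smooth_on_const
          smooth_apply[OF V'(1) sub[OF FV(2)] FV' sub[OF AB(2)] sub[OF FV(3)]]] sub[OF AB(2)]])
    moreover have "smooth_on V' \<eta> \<longleftrightarrow> smooth_on V' (\<lambda>x. (- 1 / G (F x) (B x) (T x)) *\<^sub>R B x)"
      by (rule smooth_on_cong[OF V'(1)]) (rule eq(1))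
    ultimately have "smooth_on V' \<eta>" by simp
    moreover have "V' \<subseteq> U" using V'(3) V(3) by (rule subset_trans)
    ultimately show ?thesis using V'(1,2) by (intro exI[of _ V'] conjI)
  qed
  have swap: "null_frame x (B x) (A x)" if "x \<in> V" for x
    using spacelike_plane.null_frame_swap[OF plane AB(3)[OF that]] V(3) that by blast
  consider a where "\<eta> x0 = a *\<^sub>R A x0" | b where "\<eta> x0 = b *\<^sub>R B x0"
    using spacelike_plane.null_in_frame[OF plane[OF x0] AB(3)[OF V(2)] \<eta>(1,2)[OF x0]] by blast
  then show ?thesis
  proof cases
    case 1
    show ?thesis by (rule main[of B A a]) (fact AB swap 1)+
  next
    case 2
    show ?thesis by (rule main[of A B b]) (fact AB 2)+
  qed
qed

end


section \<open>Charts\<close>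

definition transition :: "('a, 'e::euclidean_space) chart \<Rightarrow> ('a, 'e) chart \<Rightarrow> 'e \<Rightarrow> 'e" where
  "transition c d y = chart_map d (chart_inv c y)"

text \<open>\<open>coord\<close> and \<open>from_coord\<close> are the cases in which the preferred
  chart stands at one end, so the cocycle rule \<open>jac_compose\<close> governs all conversions of
  components.\<close>

definition jac :: "('a, 'e::euclidean_space) chart \<Rightarrow> ('a, 'e) chart \<Rightarrow> 'a \<Rightarrow> 'e \<Rightarrow> 'e" where
  "jac c d q = dv (transition c d) (chart_map c q)"

locale smooth_manifold =
  fixes A :: "('a::{t2_space, second_countable_topology}, 'e::euclidean_space) chart set"
  assumes atlas: "smooth_atlas A"
begin

lemma chart: "c \<in> A \<Longrightarrow> is_chart c"
  using atlas by (simp add: smooth_atlas_def)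

lemma chart_inv_map: "c \<in> A \<Longrightarrow> q \<in> chart_dom c \<Longrightarrow> chart_inv c (chart_map c q) = q"
  using chart[of c] unfolding is_chart_def homeomorphism_def by blast

lemma chart_dom_open: "c \<in> A \<Longrightarrow> open (chart_dom c)"
  using chart[of c] by (simp add: is_chart_def)

lemma chart_image_open:
  assumes "c \<in> A" "open T" "T \<subseteq> chart_dom c"
  shows "open (chart_map c ` T)"
proof -
  have hom: "homeomorphism (chart_dom c) (chart_map c ` chart_dom c) (chart_map c) (chart_inv c)"
    and op: "open (chart_map c ` chart_dom c)"
    using chart[OF assms(1)] by (auto simp: is_chart_def)
  have "openin (top_of_set (chart_dom c)) T"
    using assms(2,3) by (simp add: openin_open_eq[OF chart_dom_open[OF assms(1)]])
  from homeomorphism_imp_open_map[OF hom this]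
  show ?thesis using op openin_open_trans by blast
qed

lemma chart_at: "chart_at A q \<in> A" "q \<in> chart_dom (chart_at A q)"
proof -
  have "\<exists>c. c \<in> A \<and> q \<in> chart_dom c" using atlas unfolding smooth_atlas_def by blast
  then show "chart_at A q \<in> A" "q \<in> chart_dom (chart_at A q)"
    unfolding chart_at_def by (metis (mono_tags, lifting) someI_ex)+
qed

lemma transition_map: "c \<in> A \<Longrightarrow> q \<in> chart_dom c \<Longrightarrow> transition c d (chart_map c q) = chart_map d q"
  by (simp add: transition_def chart_inv_map)

lemma transition_smooth:
  "c \<in> A \<Longrightarrow> d \<in> A \<Longrightarrow> smooth_on (chart_map c ` (chart_dom c \<inter> chart_dom d)) (transition c d)"
  using atlas by (simp add: smooth_atlas_def transition_def[abs_def] o_def)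

lemma overlap_open: "c \<in> A \<Longrightarrow> d \<in> A \<Longrightarrow> open (chart_map c ` (chart_dom c \<inter> chart_dom d))"
  by (rule chart_image_open) (auto intro: chart_dom_open)

lemma linear_jac:
  assumes "c \<in> A" "d \<in> A" "q \<in> chart_dom c" "q \<in> chart_dom d"
  shows "linear (jac c d q)"
  unfolding jac_def by (rule smooth_on_linear_dv[OF transition_smooth[OF assms(1,2)]]) (use assms in blast)

lemma jac_self:
  assumes "c \<in> A" "q \<in> chart_dom c"
  shows "jac c c q v = v"
proof -
  have "dv (transition c c) (chart_map c q) = dv (\<lambda>y. y) (chart_map c q)"
  proof (rule dv_cong)
    show "open (chart_map c ` chart_dom c)" by (rule chart_image_open[OF assms(1) chart_dom_open[OF assms(1)]]) simp
    show "chart_map c q \<in> chart_map c ` chart_dom c" using assms(2) by blast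
    show "transition c c y = y" if "y \<in> chart_map c ` chart_dom c" for y
      using that transition_map[OF assms(1), of _ c] by (metis imageE)
  qed
  then show ?thesis by (simp add: jac_def)
qed

lemma jac_compose:
  assumes A: "c \<in> A" "d \<in> A" "e \<in> A" and q: "q \<in> chart_dom c" "q \<in> chart_dom d" "q \<in> chart_dom e"
  shows "jac d e q (jac c d q v) = jac c e q v"
proof -
  define U where "U = chart_map c ` (chart_dom c \<inter> (chart_dom d \<inter> chart_dom e))"
  have U: "open U" "chart_map c q \<in> U"
    unfolding U_def using A q by (auto intro!: chart_image_open open_Int chart_dom_open)
  have "dv (transition c e) (chart_map c q) = dv (\<lambda>y. transition d e (transition c d y)) (chart_map c q)"
    by (rule dv_cong[OF U]) (use A in \<open>auto simp: U_def transition_map\<close>)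
  also have "\<dots> = (\<lambda>v. dv (transition d e) (transition c d (chart_map c q)) (dv (transition c d) (chart_map c q) v))"
    by (rule dv_compose[OF transition_smooth[OF A(1,2)] _ transition_smooth[OF A(2,3)]])
      (use A q in \<open>auto simp: transition_map\<close>)
  finally show ?thesis by (simp add: jac_def transition_map[OF A(1) q(1)])
qed

lemma jac_inverse:
  assumes "c \<in> A" "d \<in> A" "q \<in> chart_dom c" "q \<in> chart_dom d"
  shows "jac d c q (jac c d q v) = v"
  using jac_compose[OF assms(1,2,1,3,4,3)] jac_self[OF assms(1,3)] by simp

lemma coord_jac: "coord A d q = jac (chart_at A q) d q"
  by (simp add: fun_eq_iff coord_def jac_def transition_def[abs_def] o_def)

lemma from_coord_jac: "from_coord A d q = jac d (chart_at A q) q"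
  by (simp add: fun_eq_iff from_coord_def jac_def transition_def[abs_def] o_def)

lemma linear_coord: "d \<in> A \<Longrightarrow> q \<in> chart_dom d \<Longrightarrow> linear (coord A d q)"
  and linear_from_coord: "d \<in> A \<Longrightarrow> q \<in> chart_dom d \<Longrightarrow> linear (from_coord A d q)"
  unfolding coord_jac from_coord_jac using chart_at by (auto intro: linear_jac)

lemma coord_from_coord: "d \<in> A \<Longrightarrow> q \<in> chart_dom d \<Longrightarrow> coord A d q (from_coord A d q v) = v"
  and from_coord_coord: "d \<in> A \<Longrightarrow> q \<in> chart_dom d \<Longrightarrow> from_coord A d q (coord A d q v) = v"
  unfolding coord_jac from_coord_jac using chart_at by (auto intro: jac_inverse)

lemma coord_chart_at: "coord A (chart_at A q) q v = v"
  and from_coord_chart_at: "from_coord A (chart_at A q) q v = v"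
  unfolding coord_jac from_coord_jac using chart_at by (auto intro: jac_self)

lemma jac_coord:
  "c \<in> A \<Longrightarrow> d \<in> A \<Longrightarrow> q \<in> chart_dom c \<Longrightarrow> q \<in> chart_dom d \<Longrightarrow> jac c d q (coord A c q v) = coord A d q v"
  unfolding coord_jac using chart_at by (auto intro: jac_compose)

lemma from_coord_jac_eq:
  "c \<in> A \<Longrightarrow> d \<in> A \<Longrightarrow> q \<in> chart_dom c \<Longrightarrow> q \<in> chart_dom d \<Longrightarrow> from_coord A d q (jac c d q v) = from_coord A c q v"
  unfolding from_coord_jac using chart_at by (auto intro: jac_compose)

end

lemma koszul_cong:
  assumes "open U" "x \<in> U" "\<And>y. y \<in> U \<Longrightarrow> F y = F' y"
  shows "koszul G F x X Y w = koszul G F' x X Y w"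
proof -
  have "dv F y = dv F' y" if "y \<in> U" for y by (rule dv_cong[OF assms(1) that assms(3)])
  moreover from this have "dv (\<lambda>y. dv F y Y) x = dv (\<lambda>y. dv F' y Y) x"
    by (intro dv_cong[OF assms(1,2)]) simp
  ultimately show ?thesis using assms(2,3) by (simp add: koszul_def)
qed

lemma metric_family_subset:
  "metric_family W G \<Longrightarrow> open V \<Longrightarrow> V \<subseteq> W \<Longrightarrow> metric_family V G"
  unfolding metric_family_def using smooth_on_subset by blast

text \<open>\<open>L\<close>, \<open>K\<close> and \<open>I\<close>, \<open>J\<close> are inverse
  pairs of component changes in the ambient space and on the submanifold; they carry the pointwise
  structure into fixed charts.\<close>

lemma spacelike_plane_transport:
  fixes L K :: "'e::euclidean_space \<Rightarrow> 'e" and I J :: "'f::euclidean_space \<Rightarrow> 'f"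
  assumes "spacelike_plane G P T" and L: "linear L" and K: "linear K" "\<And>u. K (L u) = u" "\<And>u. L (K u) = u"
    and J: "linear J" "\<And>X. I (J X) = X" "\<And>X. J (I X) = X"
  shows "spacelike_plane (\<lambda>u v. G (K u) (K v)) (\<lambda>X. L (P (J X))) (L T)"
    and "spacelike_plane.normal (\<lambda>u v. G (K u) (K v)) (\<lambda>X. L (P (J X))) v \<longleftrightarrow>
      spacelike_plane.normal G P (K v)"
proof -
  interpret spacelike_plane G P T by fact
  have K0: "K v = 0 \<longleftrightarrow> v = 0" for v using K(2,3) linear_0[OF L] linear_0[OF K(1)] by metis
  have J0: "J X = 0 \<longleftrightarrow> X = 0" for X using J(2,3) linear_0[OF J(1)] by metis
  have bl: "bilinear (\<lambda>u v. G (K u) (K v))"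
    unfolding bilinear_def by (auto intro!: linearI simp: linear_add[OF K(1)] linear_scale[OF K(1)] G_simps)
  have li: "linear (\<lambda>X. L (P (J X)))"
    using linear_compose[OF linear_compose[OF J(1) lin] L] by (simp add: o_def)
  show 1: "spacelike_plane (\<lambda>u v. G (K u) (K v)) (\<lambda>X. L (P (J X))) (L T)"
    by (rule spacelike_plane.intro[OF bl _ _ _ li]) (use T pos dim complement sym in \<open>auto simp: K J0 K0\<close>)
  show "spacelike_plane.normal (\<lambda>u v. G (K u) (K v)) (\<lambda>X. L (P (J X))) v \<longleftrightarrow>
      spacelike_plane.normal G P (K v)"
    unfolding spacelike_plane.normal_def[OF 1] normal_def K(2)
    by (metis J(3))
qed

section \<open>Immersed submanifolds\<close>

locale spacelike_immersion =
  fixes M :: "('m::{t2_space, second_countable_topology}, 'e::euclidean_space) spacetime_data"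
    and S :: "('s::{t2_space, second_countable_topology}, 'f::euclidean_space, 'm) immersed_data"
  assumes M: "spacetime M" and S: "codim_two_spacelike_submanifold M S"
begin

sublocale M: smooth_manifold "atlas M"
  using M by unfold_locales (simp add: spacetime_def)

sublocale S: smooth_manifold "dom_atlas S"
  using S by unfold_locales (simp add: codim_two_spacelike_submanifold_def)

abbreviation f :: "'s \<Rightarrow> 'm" where "f \<equiv> immersion S"

abbreviation mic where "mic \<equiv> metric_in_chart M"

definition loc :: "('s, 'f) chart \<Rightarrow> ('m, 'e) chart \<Rightarrow> 'f \<Rightarrow> 'e" where
  "loc c d x = chart_map d (f (chart_inv c x))"

definition loc_dom :: "('s, 'f) chart \<Rightarrow> ('m, 'e) chart \<Rightarrow> 'f set" where
  "loc_dom c d = chart_map c ` {p \<in> chart_dom c. f p \<in> chart_dom d}"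

lemma f_vimage_open:
  assumes "c \<in> dom_atlas S" "open D" shows "open {p \<in> chart_dom c. f p \<in> D}"
proof -
  have "continuous_on UNIV f" using S by (simp add: codim_two_spacelike_submanifold_def smooth_map_def)
  then have "open (chart_dom c \<inter> f -` D)"
    using S.chart_dom_open[OF assms(1)] assms(2) by (intro open_Int open_vimage)
  then show ?thesis by (simp add: Int_def vimage_def)
qed

lemma image_open:
  assumes "c \<in> dom_atlas S" "open D" shows "open (chart_map c ` {p \<in> chart_dom c. f p \<in> D})"
  by (rule S.chart_image_open[OF assms(1) f_vimage_open[OF assms]]) blast

lemma loc_dom_open: "c \<in> dom_atlas S \<Longrightarrow> d \<in> atlas M \<Longrightarrow> open (loc_dom c d)"
  unfolding loc_dom_def by (intro image_open M.chart_dom_open)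

lemma loc_smooth: "c \<in> dom_atlas S \<Longrightarrow> d \<in> atlas M \<Longrightarrow> smooth_on (loc_dom c d) (loc c d)"
  using S by (simp add: codim_two_spacelike_submanifold_def smooth_map_def loc_dom_def loc_def[abs_def])

lemma loc_map: "c \<in> dom_atlas S \<Longrightarrow> p \<in> chart_dom c \<Longrightarrow> loc c d (chart_map c p) = chart_map d (f p)"
  by (simp add: loc_def S.chart_inv_map)

lemma loc_image: "c \<in> dom_atlas S \<Longrightarrow> loc c d ` loc_dom c d \<subseteq> chart_map d ` chart_dom d"
  by (auto simp: loc_dom_def loc_map)

lemma metric_bilinear: "bilinear (metric M q)" and metric_sym: "metric M q u v = metric M q v u"
  and metric_lorentzian: "lorentzian_form (metric M q)"
  using M by (auto simp: spacetime_def lorentzian_form_def)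

lemma mic_map:
  "d \<in> atlas M \<Longrightarrow> q \<in> chart_dom d \<Longrightarrow>
    mic d (chart_map d q) u v = metric M q (from_coord (atlas M) d q u) (from_coord (atlas M) d q v)"
  by (simp add: metric_in_chart_def M.chart_inv_map)

lemma mic_coord:
  "d \<in> atlas M \<Longrightarrow> q \<in> chart_dom d \<Longrightarrow>
    mic d (chart_map d q) (coord (atlas M) d q u) (coord (atlas M) d q v) = metric M q u v"
  by (simp add: mic_map M.from_coord_coord)

lemma metric_family_mic:
  assumes d: "d \<in> atlas M"
  shows "metric_family (chart_map d ` chart_dom d) (mic d)"
proof
  show "open (chart_map d ` chart_dom d)"
    by (rule M.chart_image_open[OF d M.chart_dom_open[OF d]]) simp
  show "smooth_on (chart_map d ` chart_dom d) (\<lambda>y. mic d y u v)" for u v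
    using M d by (simp add: spacetime_def)
  fix y assume "y \<in> chart_map d ` chart_dom d"
  then obtain q where q: "q \<in> chart_dom d" "y = chart_map d q" by blast
  note bl = metric_bilinear[of q] and lin = M.linear_from_coord[OF d q(1)]
  show "bilinear (mic d y)"
    unfolding bilinear_def q(2) mic_map[OF d q(1)]
    by (auto intro!: linearI simp: linear_add[OF lin] linear_scale[OF lin]
        bilinear_ladd[OF bl] bilinear_radd[OF bl] bilinear_lmul[OF bl] bilinear_rmul[OF bl])
  show "mic d y u v = mic d y v u" for u v
    unfolding q(2) mic_map[OF d q(1)] by (rule metric_sym)
qed

section \<open>Changes of charts for the immersion\<close>

lemma dv_loc_change:
  assumes c: "c \<in> dom_atlas S" "c' \<in> dom_atlas S" and d: "d \<in> atlas M" "d' \<in> atlas M"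
    and p: "p \<in> chart_dom c" "p \<in> chart_dom c'" "f p \<in> chart_dom d" "f p \<in> chart_dom d'"
  shows "dv (loc c' d') (chart_map c' p) X = jac d d' (f p) (dv (loc c d) (chart_map c p) (jac c' c p X))"
proof -
  define U where "U = chart_map c' ` {p \<in> chart_dom c'. f p \<in> chart_dom d \<inter> chart_dom d'} \<inter>
      chart_map c' ` (chart_dom c' \<inter> chart_dom c)"
  have open_dd: "open (chart_dom d \<inter> chart_dom d')" using M.chart_dom_open d by blast
  have U: "open U" "chart_map c' p \<in> U"
    using image_open[OF c(2) open_dd] S.overlap_open[OF c(2,1)] p unfolding U_def by (auto intro: open_Int)
  have UE: "\<exists>r. y = chart_map c' r \<and> r \<in> chart_dom c' \<and> r \<in> chart_dom c \<and> f r \<in> chart_dom d \<and> f r \<in> chart_dom d'"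
    if "y \<in> U" for y
  proof -
    obtain r s where rs: "r \<in> chart_dom c'" "f r \<in> chart_dom d \<inter> chart_dom d'" "y = chart_map c' r"
      "s \<in> chart_dom c' \<inter> chart_dom c" "y = chart_map c' s"
      using \<open>y \<in> U\<close> unfolding U_def by blast
    then have "r = s" using S.chart_inv_map[OF c(2)] by (metis IntE)
    then show ?thesis using rs by blast
  qed
  have inner: "smooth_on U (transition c' c)"
    using S.transition_smooth[OF c(2,1)] by (rule smooth_on_subset) (auto simp: U_def)
  have sub1: "transition c' c ` U \<subseteq> loc_dom c d"
  proof
    fix z assume "z \<in> transition c' c ` U"
    then obtain r where "z = transition c' c (chart_map c' r)" "r \<in> chart_dom c'" "r \<in> chart_dom c" "f r \<in> chart_dom d"
      using UE by blast
    then show "z \<in> loc_dom c d" by (auto simp: loc_dom_def S.transition_map[OF c(2)])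
  qed
  have mid: "smooth_on U (\<lambda>y. loc c d (transition c' c y))"
    by (rule smooth_on_compose[OF U(1) loc_dom_open[OF c(1) d(1)] sub1 inner loc_smooth[OF c(1) d(1)]])
  have "dv (loc c' d') (chart_map c' p) = dv (\<lambda>y. transition d d' (loc c d (transition c' c y))) (chart_map c' p)"
  proof (rule dv_cong[OF U])
    fix y assume "y \<in> U"
    then obtain r where "y = chart_map c' r" "r \<in> chart_dom c'" "r \<in> chart_dom c" "f r \<in> chart_dom d"
      using UE by blast
    then show "loc c' d' y = transition d d' (loc c d (transition c' c y))"
      by (simp add: c d S.transition_map M.transition_map loc_map)
  qed
  also have "\<dots> = (\<lambda>v. dv (transition d d') (loc c d (transition c' c (chart_map c' p)))
      (dv (\<lambda>y. loc c d (transition c' c y)) (chart_map c' p) v))"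
    by (rule dv_compose[OF mid U(2) M.transition_smooth[OF d]])
      (use p c in \<open>simp add: S.transition_map loc_map\<close>)
  also have "dv (\<lambda>y. loc c d (transition c' c y)) (chart_map c' p) =
      (\<lambda>v. dv (loc c d) (transition c' c (chart_map c' p)) (dv (transition c' c) (chart_map c' p) v))"
    by (rule dv_compose[OF inner U(2) loc_smooth[OF c(1) d(1)]]) (use sub1 U(2) in blast)
  finally show ?thesis by (simp add: jac_def S.transition_map[OF c(2) p(2)] loc_map[OF c(1) p(1)])
qed

abbreviation c0 where "c0 \<equiv> chart_at (dom_atlas S)"
abbreviation d0 where "d0 p \<equiv> chart_at (atlas M) (f p)"

lemma push_loc: "push M S p = dv (loc (c0 p) (d0 p)) (chart_map (c0 p) p)"
  by (simp add: fun_eq_iff push_def differential_def loc_def[abs_def])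

text \<open>\<open>push\<close> refers to preferred charts, which jump from point to point; in fixed
  charts it becomes the differential of the single smooth function \<open>loc c d\<close>.\<close>

lemma coord_push:
  assumes "c \<in> dom_atlas S" "d \<in> atlas M" "p \<in> chart_dom c" "f p \<in> chart_dom d"
  shows "coord (atlas M) d (f p) (push M S p X) = dv (loc c d) (chart_map c p) (coord (dom_atlas S) c p X)"
  using dv_loc_change[OF S.chart_at(1) assms(1) M.chart_at(1) assms(2) S.chart_at(2) assms(3) M.chart_at(2) assms(4),
      of "coord (dom_atlas S) c p X"]
  by (simp add: push_loc M.coord_jac S.coord_jac S.jac_inverse[OF S.chart_at(1) assms(1) S.chart_at(2) assms(3)])

lemma linear_push: "linear (push M S p)"
  unfolding push_loc
  by (rule smooth_on_linear_dv[OF loc_smooth[OF S.chart_at(1) M.chart_at(1)]])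
    (use S.chart_at(2) M.chart_at(2) in \<open>auto simp: loc_dom_def\<close>)

lemma plane: "spacelike_plane (metric M (f p)) (push M S p) (time_field M (f p))"
proof (rule spacelike_plane.intro)
  show "metric M (f p) (time_field M (f p)) (time_field M (f p)) < 0"
    using M by (simp add: spacetime_def)
  show "0 < metric M (f p) (push M S p X) (push M S p X)" if "X \<noteq> 0" for X
    using S that by (simp add: codim_two_spacelike_submanifold_def induced_metric_def metric_at_def)
  show "DIM('e) = DIM('f) + 2" using S by (simp add: codim_two_spacelike_submanifold_def)
  show "metric M (f p) u v = metric M (f p) v u" for u v by (rule metric_sym)
  show "0 < metric M (f p) v v" if "metric M (f p) u u < 0" "metric M (f p) u v = 0" "v \<noteq> 0" for u v
    by (rule lorentzian_timelike_complement[OF metric_lorentzian that])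
qed (rule metric_bilinear linear_push)+

lemma normal_vec_iff: "normal_vec M S p v \<longleftrightarrow> spacelike_plane.normal (metric M (f p)) (push M S p) v"
  by (simp add: normal_vec_def metric_at_def spacelike_plane.normal_def[OF plane])

lemma chart_plane:
  assumes "c \<in> dom_atlas S" "d \<in> atlas M" "p \<in> chart_dom c" "f p \<in> chart_dom d"
  shows "spacelike_plane (mic d (loc c d (chart_map c p))) (dv (loc c d) (chart_map c p))
      (coord (atlas M) d (f p) (time_field M (f p)))"
    and "spacelike_plane.normal (mic d (loc c d (chart_map c p))) (dv (loc c d) (chart_map c p))
      (coord (atlas M) d (f p) v) \<longleftrightarrow> normal_vec M S p v"
proof -
  let ?L = "coord (atlas M) d (f p)" and ?K = "from_coord (atlas M) d (f p)"
    and ?I = "coord (dom_atlas S) c p" and ?J = "from_coord (dom_atlas S) c p"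
  have G: "mic d (loc c d (chart_map c p)) = (\<lambda>u v. metric M (f p) (?K u) (?K v))"
    by (simp add: fun_eq_iff loc_map[OF assms(1,3)] mic_map[OF assms(2,4)])
  have P: "dv (loc c d) (chart_map c p) = (\<lambda>X. ?L (push M S p (?J X)))"
    by (simp add: fun_eq_iff coord_push[OF assms] S.coord_from_coord[OF assms(1,3)])
  note tr = spacelike_plane_transport[OF plane[of p] M.linear_coord[OF assms(2,4)] M.linear_from_coord[OF assms(2,4)]
    M.from_coord_coord[OF assms(2,4)] M.coord_from_coord[OF assms(2,4)] S.linear_from_coord[OF assms(1,3)]
    S.coord_from_coord[OF assms(1,3)] S.from_coord_coord[OF assms(1,3)]]
  show "spacelike_plane (mic d (loc c d (chart_map c p))) (dv (loc c d) (chart_map c p))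
      (coord (atlas M) d (f p) (time_field M (f p)))"
    unfolding G P by (rule tr(1))
  show "spacelike_plane.normal (mic d (loc c d (chart_map c p))) (dv (loc c d) (chart_map c p))
      (coord (atlas M) d (f p) v) \<longleftrightarrow> normal_vec M S p v"
    unfolding G P tr(2) normal_vec_iff by (simp add: M.from_coord_coord[OF assms(2,4)])
qed

text \<open>The change passes through the intermediate pair \<open>c\<close>, \<open>d'\<close>: the
  target chart is replaced before the source chart. The compositions with transitions agree with the
  local expressions only near \<open>p\<close>, whence the auxiliary open sets.\<close>

lemma koszul_chart_change:
  assumes c: "c \<in> dom_atlas S" "c' \<in> dom_atlas S" and d: "d \<in> atlas M" "d' \<in> atlas M"
    and p: "p \<in> chart_dom c" "p \<in> chart_dom c'" "f p \<in> chart_dom d" "f p \<in> chart_dom d'"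
    and v: "normal_vec M S p v"
  shows "koszul (mic d') (loc c' d') (chart_map c' p) (coord (dom_atlas S) c' p X) (coord (dom_atlas S) c' p Y)
      (coord (atlas M) d' (f p) v)
    = koszul (mic d) (loc c d) (chart_map c p) (coord (dom_atlas S) c p X) (coord (dom_atlas S) c p Y)
      (coord (atlas M) d (f p) v)"
proof -
  let ?X = "coord (dom_atlas S) c p X" and ?Y = "coord (dom_atlas S) c p Y"
    and ?X' = "coord (dom_atlas S) c' p X" and ?Y' = "coord (dom_atlas S) c' p Y"
  let ?v = "coord (atlas M) d (f p) v" and ?v' = "coord (atlas M) d' (f p) v"
  have open_dd: "open (chart_dom d \<inter> chart_dom d')" using M.chart_dom_open d by blast
  define U where "U = chart_map c ` {p \<in> chart_dom c. f p \<in> chart_dom d \<inter> chart_dom d'}"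
  have U: "open U" "chart_map c p \<in> U"
    using image_open[OF c(1) open_dd] p unfolding U_def by auto
  define W where "W = chart_map d ` (chart_dom d \<inter> chart_dom d')"
  have W: "metric_family W (mic d)"
    unfolding W_def
    by (rule metric_family_subset[OF metric_family_mic[OF d(1)] M.overlap_open[OF d]]) blast
  have target: "koszul (mic d') (\<lambda>y. transition d d' (loc c d y)) (chart_map c p) ?X ?Y
      (dv (transition d d') (loc c d (chart_map c p)) ?v)
    = koszul (mic d) (loc c d) (chart_map c p) ?X ?Y ?v"
  proof (rule metric_family.koszul_target_change[OF W metric_family_mic[OF d(2)], where U = U])
    show "smooth_on W (transition d d')" unfolding W_def by (rule M.transition_smooth[OF d])
    show "transition d d' ` W \<subseteq> chart_map d' ` chart_dom d'"
      by (auto simp: W_def M.transition_map[OF d(1)])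
    show "mic d y u v = mic d' (transition d d' y) (dv (transition d d') y u) (dv (transition d d') y v)"
      if "y \<in> W" for y u v
    proof -
      obtain q where q: "q \<in> chart_dom d" "q \<in> chart_dom d'" "y = chart_map d q"
        using \<open>y \<in> W\<close> unfolding W_def by blast
      have "dv (transition d d') y = jac d d' q" by (simp add: jac_def q(3))
      then show ?thesis
        by (simp add: q(3) M.transition_map[OF d(1) q(1)] mic_map[OF d(1) q(1)] mic_map[OF d(2) q(2)]
            M.from_coord_jac_eq[OF d q(1,2)])
    qed
    show "smooth_on U (loc c d)"
      by (rule smooth_on_subset[OF loc_smooth[OF c(1) d(1)]]) (auto simp: U_def loc_dom_def)
    show "loc c d ` U \<subseteq> W" by (auto simp: U_def W_def loc_map[OF c(1)])
  qed (rule U)+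
  also have "koszul (mic d') (\<lambda>y. transition d d' (loc c d y)) (chart_map c p) ?X ?Y
      (dv (transition d d') (loc c d (chart_map c p)) ?v) = koszul (mic d') (loc c d') (chart_map c p) ?X ?Y ?v'"
  proof -
    have "dv (transition d d') (loc c d (chart_map c p)) ?v = ?v'"
      using M.jac_coord[OF d p(3,4)] by (simp add: jac_def loc_map[OF c(1) p(1)])
    moreover have "koszul (mic d') (\<lambda>y. transition d d' (loc c d y)) (chart_map c p) ?X ?Y ?v'
        = koszul (mic d') (loc c d') (chart_map c p) ?X ?Y ?v'"
      by (rule koszul_cong[OF U]) (auto simp: U_def loc_map[OF c(1)] M.transition_map[OF d(1)])
    ultimately show ?thesis by simp
  qed
  finally have 1: "koszul (mic d') (loc c d') (chart_map c p) ?X ?Y ?v' = koszul (mic d) (loc c d) (chart_map c p) ?X ?Y ?v" .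
  define V where "V = chart_map c' ` (chart_dom c' \<inter> {p \<in> chart_dom c. f p \<in> chart_dom d'})"
  have V: "open V" "chart_map c' p \<in> V"
    unfolding V_def using c p d
    by (auto intro!: S.chart_image_open open_Int S.chart_dom_open f_vimage_open M.chart_dom_open)
  have dv_tr: "dv (transition c' c) (chart_map c' p) (coord (dom_atlas S) c' p Z) = coord (dom_atlas S) c p Z" for Z
    using S.jac_coord[OF c(2,1) p(2,1)] by (simp add: jac_def)
  have "koszul (mic d') (\<lambda>y. loc c d' (transition c' c y)) (chart_map c' p) ?X' ?Y' ?v'
      = koszul (mic d') (loc c d') (transition c' c (chart_map c' p))
          (dv (transition c' c) (chart_map c' p) ?X') (dv (transition c' c) (chart_map c' p) ?Y') ?v'"
  proof (rule metric_family.koszul_source_change[OF metric_family_mic[OF d(2)] loc_dom_open[OF c(1) d(2)]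
        loc_smooth[OF c(1) d(2)] loc_image[OF c(1)] V(1) _ _ V(2)])
    show "smooth_on V (transition c' c)"
      by (rule smooth_on_subset[OF S.transition_smooth[OF c(2,1)]]) (auto simp: V_def)
    show "transition c' c ` V \<subseteq> loc_dom c d'"
      by (auto simp: V_def loc_dom_def S.transition_map[OF c(2)])
    \<comment> \<open>Normality of \<open>v\<close> eliminates the second derivative of the
      transition between source charts.\<close>
    show "mic d' (loc c d' (transition c' c (chart_map c' p))) (dv (loc c d') (transition c' c (chart_map c' p)) Z) ?v' = 0" for Z
    proof -
      interpret spacelike_plane "mic d' (loc c d' (chart_map c p))" "dv (loc c d') (chart_map c p)"
        "coord (atlas M) d' (f p) (time_field M (f p))"
        by (rule chart_plane(1)[OF c(1) d(2) p(1,4)])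
      have "normal ?v'" using chart_plane(2)[OF c(1) d(2) p(1,4)] v by blast
      then have "mic d' (loc c d' (chart_map c p)) ?v' (dv (loc c d') (chart_map c p) Z) = 0"
        by (simp add: normal_def)
      then show ?thesis unfolding S.transition_map[OF c(2) p(2)] by (subst sym)
    qed
  qed
  moreover have "koszul (mic d') (\<lambda>y. loc c d' (transition c' c y)) (chart_map c' p) ?X' ?Y' ?v'
      = koszul (mic d') (loc c' d') (chart_map c' p) ?X' ?Y' ?v'"
    by (rule koszul_cong[OF V]) (auto simp: V_def loc_map c S.transition_map)
  ultimately show ?thesis using 1 by (simp add: dv_tr S.transition_map[OF c(2) p(2)])
qed

end


section \<open>The second fundamental form\<close>

context spacelike_immersion
begin

lemma base_charts: "c0 p \<in> dom_atlas S" "d0 p \<in> atlas M" "p \<in> chart_dom (c0 p)" "f p \<in> chart_dom (d0 p)"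
  by (rule S.chart_at M.chart_at)+

lemma mic_base: "mic (d0 p) (chart_map (d0 p) (f p)) = metric M (f p)"
  by (simp add: fun_eq_iff mic_map[OF base_charts(2,4)] M.from_coord_chart_at)

text \<open>Nondegeneracy of the metric makes the Koszul condition in \<open>christoffel\<close>
  uniquely solvable, so the definite description returns its solution.\<close>

lemma christoffel_metric:
  "metric M (f p) (christoffel M (d0 p) (chart_map (d0 p) (f p)) u v) w =
    (dv (\<lambda>y. mic (d0 p) y v w) (chart_map (d0 p) (f p)) u + dv (\<lambda>y. mic (d0 p) y u w) (chart_map (d0 p) (f p)) v
     - dv (\<lambda>y. mic (d0 p) y u v) (chart_map (d0 p) (f p)) w) / 2"
proof -
  let ?d = "d0 p" and ?y = "chart_map (d0 p) (f p)"
  interpret metric_family "chart_map ?d ` chart_dom ?d" "mic ?d"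
    by (rule metric_family_mic[OF base_charts(2)])
  have y: "?y \<in> chart_map ?d ` chart_dom ?d" using base_charts(4) by blast
  define \<phi> where "\<phi> w = (dv (\<lambda>y. mic ?d y v w) ?y u + dv (\<lambda>y. mic ?d y u w) ?y v
     - dv (\<lambda>y. mic ?d y u v) ?y w) / 2" for w
  have "linear \<phi>"
    unfolding \<phi>_def
    by (auto intro!: linearI simp: bilinear_radd[OF bilinear_dv_G[OF y]] bilinear_rmul[OF bilinear_dv_G[OF y]]
        linear_add[OF linear_dv_G[OF y]] linear_scale[OF linear_dv_G[OF y]] algebra_simps
        add_divide_distrib diff_divide_distrib)
  then have ex1: "\<exists>!z. \<forall>w. metric M (f p) z w = \<phi> w"
    by (rule nondegenerate_represents[OF metric_bilinear, rotated])
      (rule spacelike_plane.nondegenerate[OF plane])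
  have "christoffel M ?d ?y u v = (THE z. \<forall>w. metric M (f p) z w = \<phi> w)"
    unfolding christoffel_def mic_base by (rule arg_cong[where f = The]) (simp add: fun_eq_iff \<phi>_def field_simps)
  then show ?thesis using theI'[OF ex1] by (simp add: \<phi>_def)
qed

text \<open>The extension of \<open>Y\<close> has constant components in the preferred chart, so the
  components of its image are \<open>dv (loc (c0 p) (d0 p)) x Y\<close>. Their derivative is the
  second derivative in \<open>koszul\<close>, and the Christoffel term supplies the rest.\<close>

lemma cov_deriv_koszul:
  "metric M (f p) (cov_deriv M S p X (\<lambda>q. push M S q (extend_vec S p Y q))) w =
    koszul (mic (d0 p)) (loc (c0 p) (d0 p)) (chart_map (c0 p) p) X Y w"
proof -
  let ?c = "c0 p" and ?d = "d0 p" and ?x = "chart_map (c0 p) p"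
  let ?V = "\<lambda>q. push M S q (extend_vec S p Y q)"
  have x: "?x \<in> loc_dom ?c ?d" using base_charts by (auto simp: loc_dom_def)
  have "dv (\<lambda>x. coord (atlas M) ?d (f (chart_inv ?c x)) (?V (chart_inv ?c x))) ?x = dv (\<lambda>x. dv (loc ?c ?d) x Y) ?x"
  proof (rule dv_cong[OF loc_dom_open[OF base_charts(1,2)] x])
    fix y assume "y \<in> loc_dom ?c ?d"
    then obtain q where q: "y = chart_map ?c q" "q \<in> chart_dom ?c" "f q \<in> chart_dom ?d"
      by (auto simp: loc_dom_def)
    show "coord (atlas M) ?d (f (chart_inv ?c y)) (?V (chart_inv ?c y)) = dv (loc ?c ?d) y Y"
      unfolding q(1) S.chart_inv_map[OF base_charts(1) q(2)] extend_vec_def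
      by (simp add: coord_push[OF base_charts(1,2) q(2,3)] S.coord_from_coord[OF base_charts(1) q(2)])
  qed
  moreover have "?V p = push M S p Y"
    by (simp add: extend_vec_def S.from_coord_chart_at)
  ultimately have "cov_deriv M S p X ?V = dv (\<lambda>x. dv (loc ?c ?d) x Y) ?x X
      + christoffel M ?d (chart_map ?d (f p)) (push M S p X) (push M S p Y)"
    unfolding cov_deriv_def Let_def by simp
  then show ?thesis
    by (simp add: bilinear_ladd[OF metric_bilinear] christoffel_metric koszul_def loc_map[OF base_charts(1,3)]
        mic_base push_loc)
qed

lemma normal_part:
  "normal_vec M S p (normal_part M S p v)" "\<exists>X. v = push M S p X + normal_part M S p v"
proof -
  interpret spacelike_plane "metric M (f p)" "push M S p" "time_field M (f p)" by (rule plane)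
  obtain X where X: "normal (v - push M S p X)" using projection_exists by blast
  have "\<exists>!w. normal_vec M S p w \<and> (\<exists>X. v = push M S p X + w)"
  proof (rule ex1I)
    show "normal_vec M S p (v - push M S p X) \<and> (\<exists>Z. v = push M S p Z + (v - push M S p X))"
      using X by (auto simp: normal_vec_iff intro: exI[of _ X])
    fix w assume "normal_vec M S p w \<and> (\<exists>X. v = push M S p X + w)"
    then obtain Z where Z: "normal w" "v = push M S p Z + w" by (auto simp: normal_vec_iff)
    then have "normal (v - push M S p Z)" by simp
    from projection_unique[OF X this] Z(2) show "w = v - push M S p X" by simp
  qed
  from theI'[OF this] show "normal_vec M S p (normal_part M S p v)" "\<exists>X. v = push M S p X + normal_part M S p v"
    unfolding normal_part_def by blast+
qed

lemma normal_part_metric: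
  assumes "normal_vec M S p w" shows "metric M (f p) (normal_part M S p v) w = metric M (f p) v w"
proof -
  interpret spacelike_plane "metric M (f p)" "push M S p" "time_field M (f p)" by (rule plane)
  obtain X where "v = push M S p X + normal_part M S p v" using normal_part(2) by blast
  then have "metric M (f p) v w = metric M (f p) (push M S p X) w + metric M (f p) (normal_part M S p v) w"
    by (metis bilinear_ladd[OF metric_bilinear])
  moreover have "metric M (f p) (push M S p X) w = 0"
    using assms by (subst metric_sym) (simp add: normal_vec_iff normal_def)
  ultimately show ?thesis by simp
qed

lemma second_ff_normal: "normal_vec M S p (second_ff M S p X Y)"
  unfolding second_ff_def by (rule normal_part)

lemma second_ff_base:
  "normal_vec M S p w \<Longrightarrow> metric M (f p) (second_ff M S p X Y) w =
    koszul (mic (d0 p)) (loc (c0 p) (d0 p)) (chart_map (c0 p) p) X Y w"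
  unfolding second_ff_def by (simp add: normal_part_metric cov_deriv_koszul)

text \<open>Chart independence pays off here: with \<open>c\<close> and \<open>d\<close> fixed over
  a whole neighbourhood, the dependence on \<open>p\<close> is that of one \<open>koszul\<close>
  form.\<close>

lemma second_ff_koszul:
  assumes "c \<in> dom_atlas S" "d \<in> atlas M" "p \<in> chart_dom c" "f p \<in> chart_dom d" "normal_vec M S p w"
  shows "metric M (f p) (second_ff M S p X Y) w = koszul (mic d) (loc c d) (chart_map c p)
    (coord (dom_atlas S) c p X) (coord (dom_atlas S) c p Y) (coord (atlas M) d (f p) w)"
  using koszul_chart_change[OF assms(1) base_charts(1) assms(2) base_charts(2) assms(3) base_charts(3)
      assms(4) base_charts(4) assms(5), of X Y]
  by (simp add: second_ff_base[OF assms(5)] S.coord_chart_at M.coord_chart_at)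

text \<open>The metric is nondegenerate on the normal plane. Symmetry and bilinearity of the second
  fundamental form can therefore be read off from \<open>koszul\<close>.\<close>

lemma normal_eqI:
  assumes "normal_vec M S p v" "normal_vec M S p v'"
    and "\<And>w. normal_vec M S p w \<Longrightarrow> metric M (f p) v w = metric M (f p) v' w"
  shows "v = v'"
proof -
  interpret spacelike_plane "metric M (f p)" "push M S p" "time_field M (f p)" by (rule plane)
  have "v - v' = 0"
    by (rule normal_nondegenerate) (use assms in \<open>simp_all add: normal_vec_iff normal_diff G_simps\<close>)
  then show ?thesis by simp
qed

lemma base_koszul:
  "bilinear (\<lambda>X Y. koszul (mic (d0 p)) (loc (c0 p) (d0 p)) (chart_map (c0 p) p) X Y w)"
  "koszul (mic (d0 p)) (loc (c0 p) (d0 p)) (chart_map (c0 p) p) X Y w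
    = koszul (mic (d0 p)) (loc (c0 p) (d0 p)) (chart_map (c0 p) p) Y X w"
proof -
  interpret metric_family "chart_map (d0 p) ` chart_dom (d0 p)" "mic (d0 p)"
    by (rule metric_family_mic[OF base_charts(2)])
  have x: "chart_map (c0 p) p \<in> loc_dom (c0 p) (d0 p)" using base_charts by (auto simp: loc_dom_def)
  note F = loc_dom_open[OF base_charts(1,2)] loc_smooth[OF base_charts(1,2)] loc_image[OF base_charts(1)] x
  show "bilinear (\<lambda>X Y. koszul (mic (d0 p)) (loc (c0 p) (d0 p)) (chart_map (c0 p) p) X Y w)"
    by (rule koszul_bilinear[OF F])
  show "koszul (mic (d0 p)) (loc (c0 p) (d0 p)) (chart_map (c0 p) p) X Y w
    = koszul (mic (d0 p)) (loc (c0 p) (d0 p)) (chart_map (c0 p) p) Y X w"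
    by (rule koszul_sym[OF F])
qed

lemma normal_vec_add: "normal_vec M S p v \<Longrightarrow> normal_vec M S p w \<Longrightarrow> normal_vec M S p (v + w)"
  and normal_vec_scale: "normal_vec M S p v \<Longrightarrow> normal_vec M S p (r *\<^sub>R v)"
  unfolding normal_vec_iff
  by (rule spacelike_plane.normal_add[OF plane] spacelike_plane.normal_scale[OF plane]; assumption)+

lemma second_ff_sym: "second_ff M S p X Y = second_ff M S p Y X"
  by (rule normal_eqI[OF second_ff_normal second_ff_normal]) (simp add: second_ff_base base_koszul(2)[of p X Y])

lemma second_ff_bilinear: "bilinear (second_ff M S p)"
proof -
  note ba = base_koszul(1)[of p]
  have "second_ff M S p (X + X') Y = second_ff M S p X Y + second_ff M S p X' Y" for X X' Y
    by (rule normal_eqI[OF second_ff_normal normal_vec_add[OF second_ff_normal second_ff_normal]])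
      (simp add: bilinear_ladd[OF metric_bilinear] second_ff_base bilinear_ladd[OF ba])
  moreover have "second_ff M S p (r *\<^sub>R X) Y = r *\<^sub>R second_ff M S p X Y" for r X Y
    by (rule normal_eqI[OF second_ff_normal normal_vec_scale[OF second_ff_normal]])
      (simp add: bilinear_lmul[OF metric_bilinear] second_ff_base bilinear_lmul[OF ba])
  ultimately have "linear (\<lambda>X. second_ff M S p X Y)" for Y by (intro linearI)
  moreover have "(\<lambda>X. second_ff M S p X Y) = second_ff M S p Y" for Y
    by (rule ext) (rule second_ff_sym)
  ultimately show ?thesis unfolding bilinear_def by simp
qed

lemma induced_metric: "induced_metric M S p = (\<lambda>X Y. metric M (f p) (push M S p X) (push M S p Y))"
  by (simp add: fun_eq_iff induced_metric_def metric_at_def)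

text \<open>The same choice as inside \<open>metric_trace\<close>, so that the mean of
  \<open>shape_tensor\<close> unfolds to \<open>mean_curvature\<close>.\<close>

definition onb :: "'s \<Rightarrow> 'f set" where
  "onb p = (SOME B. orthonormal_basis (induced_metric M S p) B)"

lemma shape_tensor:
  "shape_tensor (metric M (f p)) (push M S p) (time_field M (f p)) (second_ff M S p) (onb p)"
proof -
  interpret spacelike_plane "metric M (f p)" "push M S p" "time_field M (f p)" by (rule plane)
  have "\<exists>B. orthonormal_basis (induced_metric M S p) B"
    unfolding induced_metric
    by (rule orthonormal_basis_exists[OF bilinear_induced]) (rule metric_sym, rule pos)
  then have "orthonormal_basis (induced_metric M S p) (onb p)"
    unfolding onb_def by (rule someI_ex)
  then show ?thesis
    unfolding induced_metric
    by (intro shape_tensor.intro plane shape_tensor_axioms.intro second_ff_bilinear)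
      (auto simp: second_ff_normal[unfolded normal_vec_iff] intro: second_ff_sym)
qed

lemma mean_curvature_eq: "mean_curvature M S p = shape_tensor.mean (second_ff M S p) (onb p)"
  unfolding mean_curvature_def metric_trace_def onb_def[symmetric] shape_tensor.mean_def[OF shape_tensor] ..

lemma total_shear_eq:
  "total_shear M S p = shape_tensor.shear (metric M (f p)) (push M S p) (second_ff M S p) (onb p)"
  by (simp add: fun_eq_iff total_shear_def shape_tensor.shear_def[OF shape_tensor] mean_curvature_eq induced_metric)

section \<open>Shape operators, umbilicity and stationarity\<close>

lemma shape_op_iff:
  "shape_op M S \<zeta> p X = Z \<longleftrightarrow>
    (\<forall>Y. induced_metric M S p Z Y = metric M (f p) (second_ff M S p X Y) (\<zeta> p))"
proof -
  interpret spacelike_plane "metric M (f p)" "push M S p" "time_field M (f p)" by (rule plane)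
  have "linear (\<lambda>Y. metric M (f p) (second_ff M S p X Y) (\<zeta> p))"
    by (auto intro!: linearI simp: G_simps bilinear_radd[OF second_ff_bilinear] bilinear_rmul[OF second_ff_bilinear])
  then have "\<exists>!Z. \<forall>Y. induced_metric M S p Z Y = metric M (f p) (second_ff M S p X Y) (\<zeta> p)"
    unfolding induced_metric
    by (rule nondegenerate_represents[OF bilinear_induced, rotated])
      (rule posdef_nondegenerate[of "\<lambda>X Y. metric M (f p) (push M S p X) (push M S p Y)"], rule pos)
  from the1_equality[OF this] theI'[OF this] show ?thesis
    unfolding shape_op_def metric_at_def by blast
qed

lemma shape_op_scaleR_iff:
  "(\<forall>X. shape_op M S \<zeta> p X = r *\<^sub>R X) \<longleftrightarrow>
    (\<forall>X Y. metric M (f p) (second_ff M S p X Y) (\<zeta> p) = r * induced_metric M S p X Y)"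
proof -
  interpret spacelike_plane "metric M (f p)" "push M S p" "time_field M (f p)" by (rule plane)
  have "induced_metric M S p (r *\<^sub>R X) Y = r * induced_metric M S p X Y" for X Y
    unfolding induced_metric using bilinear_lmul[OF bilinear_induced] by simp
  then show ?thesis unfolding shape_op_iff by (auto simp: eq_commute)
qed

lemma shape_op_zero_iff:
  "(\<forall>X. shape_op M S \<zeta> p X = 0) \<longleftrightarrow> (\<forall>X Y. metric M (f p) (second_ff M S p X Y) (\<zeta> p) = 0)"
  using shape_op_scaleR_iff[of \<zeta> p 0] by simp

lemma mean_curvature_umbilical:
  assumes "\<And>X Y. metric M (f p) (second_ff M S p X Y) v = r * induced_metric M S p X Y"
  shows "metric M (f p) (mean_curvature M S p) v = r"
  unfolding mean_curvature_eq
  by (rule shape_tensor.umbilical_mean[OF shape_tensor]) (use assms in \<open>simp add: induced_metric\<close>)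

text \<open>By taking traces, the umbilicity factor of \<open>\<zeta>\<close> is its product with
  the mean curvature, and stationarity makes it zero.\<close>

lemma stationary_umbilical_iff:
  "stationary M S \<zeta> \<and> umbilical M S \<zeta> \<longleftrightarrow> (\<forall>p X. shape_op M S \<zeta> p X = 0)"
proof
  assume L: "stationary M S \<zeta> \<and> umbilical M S \<zeta>"
  then obtain \<rho> where \<rho>: "\<And>p X. shape_op M S \<zeta> p X = \<rho> p *\<^sub>R X" unfolding umbilical_def by blast
  have "\<rho> p = 0" for p
  proof -
    have "metric M (f p) (mean_curvature M S p) (\<zeta> p) = \<rho> p"
      by (rule mean_curvature_umbilical) (use \<rho> shape_op_scaleR_iff in blast)
    moreover have "metric M (f p) (\<zeta> p) (mean_curvature M S p) = 0"
      using L by (simp add: stationary_def metric_at_def)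
    ultimately show ?thesis by (subst (asm) metric_sym) simp
  qed
  then show "\<forall>p X. shape_op M S \<zeta> p X = 0" using \<rho> by simp
next
  assume R: "\<forall>p X. shape_op M S \<zeta> p X = 0"
  then have "umbilical M S \<zeta>" unfolding umbilical_def by (intro exI[of _ "\<lambda>_. 0"]) simp
  moreover have "metric M (f p) (mean_curvature M S p) (\<zeta> p) = 0" for p
    by (rule mean_curvature_umbilical) (use R shape_op_zero_iff in simp)
  then have "stationary M S \<zeta>"
    unfolding stationary_def metric_at_def by (subst metric_sym) simp
  ultimately show "stationary M S \<zeta> \<and> umbilical M S \<zeta>" by simp
qed

lemma pseudo_umbilicalD:
  assumes "pseudo_umbilical M S"
  shows "\<exists>r. \<forall>X Y. metric M (f p) (second_ff M S p X Y) (mean_curvature M S p) = r * induced_metric M S p X Y"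
  using assms shape_op_scaleR_iff[of "mean_curvature M S" p] unfolding pseudo_umbilical_def umbilical_def by blast

text \<open>The two conclusions come from testing umbilicity with the normal vectors
  \<open>0\<close> and \<open>mean_curvature M S p\<close>.\<close>

lemma not_umbilical_point:
  assumes "\<not> umbilical_point M S p"
  shows "\<exists>X Y. second_ff M S p X Y \<noteq> 0" "\<exists>X Y. total_shear M S p X Y \<noteq> 0"
proof -
  interpret shape_tensor "metric M (f p)" "push M S p" "time_field M (f p)" "second_ff M S p" "onb p"
    by (rule shape_tensor)
  have *: "\<exists>X Y. second_ff M S p X Y \<noteq> induced_metric M S p X Y *\<^sub>R \<zeta>" if "normal \<zeta>" for \<zeta>
    using assms that unfolding umbilical_point_def normal_vec_iff by blast
  show "\<exists>X Y. second_ff M S p X Y \<noteq> 0" using *[OF normal_0] by simp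
  have "normal (mean_curvature M S p)" unfolding mean_curvature_eq by (rule mean_normal)
  from *[OF this] show "\<exists>X Y. total_shear M S p X Y \<noteq> 0" by (simp add: total_shear_def)
qed

section \<open>Smoothness of the null field and the equivalence\<close>

lemma time_field_smooth:
  assumes "c \<in> dom_atlas S" "d \<in> atlas M"
  shows "smooth_on (loc_dom c d) (\<lambda>x. coord (atlas M) d (f (chart_inv c x)) (time_field M (f (chart_inv c x))))"
proof -
  let ?t = "\<lambda>y. coord (atlas M) d (chart_inv d y) (time_field M (chart_inv d y))"
  have "smooth_on (chart_map d ` chart_dom d) ?t"
    using M assms(2) unfolding spacetime_def smooth_field_along_def by (force simp: id_def)
  moreover have "open (chart_map d ` chart_dom d)"
    by (rule M.chart_image_open[OF assms(2) M.chart_dom_open[OF assms(2)]]) simp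
  ultimately have "smooth_on (loc_dom c d) (\<lambda>x. ?t (loc c d x))"
    by (intro smooth_on_compose[OF loc_dom_open[OF assms] _ loc_image[OF assms(1)] loc_smooth[OF assms]])
  moreover have "smooth_on (loc_dom c d) (\<lambda>x. ?t (loc c d x)) \<longleftrightarrow> smooth_on (loc_dom c d)
      (\<lambda>x. coord (atlas M) d (f (chart_inv c x)) (time_field M (f (chart_inv c x))))"
    by (rule smooth_on_cong[OF loc_dom_open[OF assms]])
      (auto simp: loc_dom_def loc_map[OF assms(1)] M.chart_inv_map[OF assms(2)] S.chart_inv_map[OF assms(1)])
  ultimately show ?thesis by simp
qed

lemma null_section_smooth_field:
  assumes non: "\<And>p. \<not> umbilical_point M S p"
    and \<xi>: "\<And>p. normal_vec M S p (\<xi> p)" "\<And>p. metric M (f p) (\<xi> p) (\<xi> p) = 0"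
      "\<And>p. metric M (f p) (\<xi> p) (time_field M (f p)) = - 1"
    and ann: "\<And>p X Y. metric M (f p) (second_ff M S p X Y) (\<xi> p) = 0"
  shows "smooth_field_along (dom_atlas S) (atlas M) f \<xi>"
  unfolding smooth_field_along_def
proof (intro ballI)
  fix c d assume cd: "c \<in> dom_atlas S" "d \<in> atlas M"
  let ?U = "loc_dom c d"
  let ?T = "\<lambda>x. coord (atlas M) d (f (chart_inv c x)) (time_field M (f (chart_inv c x)))"
  let ?\<eta> = "\<lambda>x. coord (atlas M) d (f (chart_inv c x)) (\<xi> (chart_inv c x))"
  have point: "\<exists>p. x = chart_map c p \<and> chart_inv c x = p \<and> p \<in> chart_dom c \<and> f p \<in> chart_dom d \<and>
      loc c d x = chart_map d (f p)" if "x \<in> ?U" for x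
    using that by (auto simp: loc_dom_def S.chart_inv_map[OF cd(1)] loc_map[OF cd(1)])
  interpret spacelike_family "chart_map d ` chart_dom d" "mic d" ?U "loc c d" ?T
  proof (rule spacelike_family.intro[OF metric_family_mic[OF cd(2)]], rule spacelike_family_axioms.intro)
    show "spacelike_plane (mic d (loc c d x)) (dv (loc c d) x) (?T x)" if x: "x \<in> ?U" for x
    proof -
      obtain p where "x = chart_map c p" "chart_inv c x = p" "p \<in> chart_dom c" "f p \<in> chart_dom d"
        using point[OF x] by blast
      then show ?thesis using chart_plane(1)[OF cd] by simp
    qed
  qed (rule loc_dom_open[OF cd] loc_smooth[OF cd] loc_image[OF cd(1)] time_field_smooth[OF cd])+
  have "\<exists>V. open V \<and> x0 \<in> V \<and> smooth_on V ?\<eta>" if x0: "x0 \<in> ?U" for x0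
  proof -
    obtain p0 where p0: "x0 = chart_map c p0" "chart_inv c x0 = p0" "p0 \<in> chart_dom c" "f p0 \<in> chart_dom d"
      using point[OF x0] by blast
    \<comment> \<open>\<open>II\<close> is nonzero at \<open>p0\<close> because the point is not
      umbilical, and nondegeneracy of the normal plane supplies a normal \<open>v\<close> that
      detects it.\<close>
    obtain X0 Y0 where "second_ff M S p0 X0 Y0 \<noteq> 0" using not_umbilical_point(1)[OF non] by blast
    moreover have "normal_vec M S p0 0" using normal_vec_scale[OF \<xi>(1), of p0 0] by simp
    ultimately obtain v where v: "normal_vec M S p0 v" "metric M (f p0) (second_ff M S p0 X0 Y0) v \<noteq> 0"
      using normal_eqI[OF second_ff_normal \<open>normal_vec M S p0 0\<close>]
      by (metis bilinear_lzero[OF metric_bilinear])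
    \<comment> \<open>These components stay fixed while the point moves. They denote other tangent
      vectors elsewhere, but \<open>\<xi>\<close> annihilates \<open>II\<close> on all pairs, so
      \<open>koszul\<close> vanishes on them at every point of the chart.\<close>
    let ?X = "coord (dom_atlas S) c p0 X0" and ?Y = "coord (dom_atlas S) c p0 Y0"
    have "\<exists>V. open V \<and> x0 \<in> V \<and> V \<subseteq> ?U \<and> smooth_on V ?\<eta>"
    proof (rule null_section_smooth[OF x0, where X = ?X and Y = ?Y and v = "coord (atlas M) d (f p0) v"])
      show "normal x0 (coord (atlas M) d (f p0) v)"
        using chart_plane(2)[OF cd p0(3,4)] v(1) by (simp add: p0(1))
      show "koszul (mic d) (loc c d) x0 ?X ?Y (coord (atlas M) d (f p0) v) \<noteq> 0"
        using v(2) by (simp add: p0(1) second_ff_koszul[OF cd p0(3,4) v(1)])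
      fix x assume "x \<in> ?U"
      then obtain p where p: "x = chart_map c p" "chart_inv c x = p" "p \<in> chart_dom c" "f p \<in> chart_dom d"
        "loc c d x = chart_map d (f p)"
        using point by blast
      show "normal x (?\<eta> x)"
        using chart_plane(2)[OF cd p(3,4)] \<xi>(1) unfolding p(2) unfolding p(1) by blast
      show "mic d (loc c d x) (?\<eta> x) (?\<eta> x) = 0" "mic d (loc c d x) (?\<eta> x) (?T x) = - 1"
        unfolding p(2,5) by (simp_all add: mic_coord[OF cd(2) p(4)] \<xi>(2,3))
      show "koszul (mic d) (loc c d) x ?X ?Y (?\<eta> x) = 0"
        using ann[of p "from_coord (dom_atlas S) c p ?X" "from_coord (dom_atlas S) c p ?Y"]
        unfolding p(2) second_ff_koszul[OF cd p(3,4) \<xi>(1)] S.coord_from_coord[OF cd(1) p(3)] p(1)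
        by (simp add: S.chart_inv_map[OF cd(1) p(3)])
    qed
    then show ?thesis by blast
  qed
  then have "smooth_on ?U ?\<eta>" by (rule smooth_on_local)
  then show "smooth_on (chart_map c ` {p \<in> chart_dom c. f p \<in> chart_dom d}) ?\<eta>" by (simp add: loc_dom_def)
qed

lemma null_direction_exists:
  assumes "shear_isotropic M S" "pseudo_umbilical M S" "\<not> umbilical_point M S p"
  shows "\<exists>v. normal_vec M S p v \<and> metric M (f p) v v = 0 \<and> metric M (f p) v (time_field M (f p)) = - 1 \<and>
    (\<forall>X Y. metric M (f p) (second_ff M S p X Y) v = 0)"
proof -
  interpret shape_tensor "metric M (f p)" "push M S p" "time_field M (f p)" "second_ff M S p" "onb p"
    by (rule shape_tensor)
  obtain r where r: "\<And>X Y. metric M (f p) (second_ff M S p X Y) mean = r * g X Y"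
    using pseudo_umbilicalD[OF assms(2), of p] unfolding mean_curvature_eq induced_metric by blast
  obtain X0 Y0 where X0: "shear X0 Y0 \<noteq> 0"
    using not_umbilical_point(2)[OF assms(3)] unfolding total_shear_eq by blast
  have iso: "metric M (f p) (shear X X) (shear X X) = metric M (f p) (shear Y Y) (shear Y Y)"
    if "g X X = 1" "g Y Y = 1" for X Y
    using assms(1) that unfolding shear_isotropic_def induced_metric metric_at_def total_shear_eq by blast
  obtain A where A: "normal A" "A \<noteq> 0" "metric M (f p) A A = 0"
    "\<And>X Y. metric M (f p) (second_ff M S p X Y) A = 0"
    using isotropic_pseudo_umbilical_null[OF iso r X0] by blast
  have nz: "metric M (f p) A (time_field M (f p)) \<noteq> 0" by (rule null_not_orthogonal_timelike[OF A(2,3)])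
  \<comment> \<open>The factor gives product \<open>-1\<close> with the time field, so
    \<open>v\<close> is future-pointing.\<close>
  define v where "v = (- 1 / metric M (f p) A (time_field M (f p))) *\<^sub>R A"
  have "normal_vec M S p v" unfolding v_def normal_vec_iff by (rule normal_scale[OF A(1)])
  moreover have "metric M (f p) v v = 0" "metric M (f p) v (time_field M (f p)) = - 1"
    "\<And>X Y. metric M (f p) (second_ff M S p X Y) v = 0"
    using nz by (simp_all add: v_def G_simps A)
  ultimately show ?thesis by blast
qed

theorem isotropic_pseudo_umbilical_iff:
  assumes non: "\<And>p. \<not> umbilical_point M S p"
  shows "shear_isotropic M S \<and> pseudo_umbilical M S \<longleftrightarrow>
    (\<exists>\<xi>. lightlike_normal_section M S \<xi> \<and> stationary M S \<xi> \<and> umbilical M S \<xi>)"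
proof
  assume L: "shear_isotropic M S \<and> pseudo_umbilical M S"
  have "\<forall>p. \<exists>v. normal_vec M S p v \<and> metric M (f p) v v = 0 \<and> metric M (f p) v (time_field M (f p)) = - 1 \<and>
    (\<forall>X Y. metric M (f p) (second_ff M S p X Y) v = 0)"
    using null_direction_exists[OF _ _ non] L by simp
  \<comment> \<open>The choice is pointwise; normalisation and annihilation of \<open>II\<close>
    nevertheless force the chosen field to be smooth.\<close>
  from choice[OF this] obtain \<xi> where "\<forall>p. normal_vec M S p (\<xi> p) \<and> metric M (f p) (\<xi> p) (\<xi> p) = 0 \<and>
    metric M (f p) (\<xi> p) (time_field M (f p)) = - 1 \<and>
    (\<forall>X Y. metric M (f p) (second_ff M S p X Y) (\<xi> p) = 0)" ..
  then have \<xi>: "\<And>p. normal_vec M S p (\<xi> p)" "\<And>p. metric M (f p) (\<xi> p) (\<xi> p) = 0"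
      "\<And>p. metric M (f p) (\<xi> p) (time_field M (f p)) = - 1"
    and ann: "\<And>p X Y. metric M (f p) (second_ff M S p X Y) (\<xi> p) = 0" by simp_all
  have "\<xi> p \<noteq> 0" for p
    using \<xi>(3)[of p] bilinear_lzero[OF metric_bilinear, of "f p" "time_field M (f p)"] by auto
  then have "lightlike_normal_section M S \<xi>"
    using null_section_smooth_field[OF non \<xi> ann] \<xi>
    by (simp add: lightlike_normal_section_def normal_field_def lightlike_def)
  moreover have "\<forall>p X. shape_op M S \<xi> p X = 0" using shape_op_zero_iff ann by blast
  ultimately show "\<exists>\<xi>. lightlike_normal_section M S \<xi> \<and> stationary M S \<xi> \<and> umbilical M S \<xi>"
    using stationary_umbilical_iff by blast
next
  assume "\<exists>\<xi>. lightlike_normal_section M S \<xi> \<and> stationary M S \<xi> \<and> umbilical M S \<xi>"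
  then obtain \<xi> where \<xi>: "lightlike_normal_section M S \<xi>" "\<forall>p X. shape_op M S \<xi> p X = 0"
    using stationary_umbilical_iff by blast
  have *: "metric M (f p) (total_shear M S p X X) (total_shear M S p X X) = 0"
    "metric M (f p) (second_ff M S p X Y) (mean_curvature M S p) = 0" for p X Y
  proof -
    interpret shape_tensor "metric M (f p)" "push M S p" "time_field M (f p)" "second_ff M S p" "onb p"
      by (rule shape_tensor)
    have A: "normal (\<xi> p)" "\<xi> p \<noteq> 0" "metric M (f p) (\<xi> p) (\<xi> p) = 0"
      using \<xi>(1) by (auto simp: lightlike_normal_section_def normal_field_def lightlike_def normal_vec_iff)
    have "metric M (f p) (second_ff M S p X Y) (\<xi> p) = 0" for X Y
      using \<xi>(2) shape_op_zero_iff by blast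
    from null_imp_isotropic_pseudo_umbilical[OF A this]
    show "metric M (f p) (total_shear M S p X X) (total_shear M S p X X) = 0"
      "metric M (f p) (second_ff M S p X Y) (mean_curvature M S p) = 0"
      unfolding total_shear_eq mean_curvature_eq by blast+
  qed
  have "shear_isotropic M S" using *(1) by (simp add: shear_isotropic_def metric_at_def)
  \<comment> \<open>The mean curvature lies on the null line that annihilates \<open>II\<close>, so
    its own shape operator is zero; this is umbilicity with factor 0.\<close>
  moreover have "\<forall>p X. shape_op M S (mean_curvature M S) p X = 0"
    using *(2) shape_op_zero_iff by blast
  then have "pseudo_umbilical M S"
    unfolding pseudo_umbilical_def using stationary_umbilical_iff by blast
  ultimately show "shear_isotropic M S \<and> pseudo_umbilical M S" by simp
qed

end

text \<open>The second conjunct accounts for the clause that describes such a section by a vanishing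
  shape operator.\<close>

theorem corollary3p5:
  fixes M :: "('m::{t2_space, second_countable_topology}, 'e::euclidean_space) spacetime_data"
    and S :: "('s::{t2_space, second_countable_topology}, 'f::euclidean_space, 'm) immersed_data"
    and n :: nat
  assumes "spacetime M"
    and "DIM('e) = n + 2"
    and "n + 2 \<ge> 4"
    and "codim_two_spacelike_submanifold M S"
    and "\<forall>p. \<not> umbilical_point M S p"
  shows "(shear_isotropic M S \<and> pseudo_umbilical M S \<longleftrightarrow>
            (\<exists>\<xi>. lightlike_normal_section M S \<xi> \<and> stationary M S \<xi> \<and> umbilical M S \<xi>)) \<and>
         (\<forall>\<xi>. lightlike_normal_section M S \<xi> \<longrightarrow>
            (stationary M S \<xi> \<and> umbilical M S \<xi> \<longleftrightarrow> (\<forall>p X. shape_op M S \<xi> p X = 0)))"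
proof -
  interpret spacelike_immersion M S by (rule spacelike_immersion.intro[OF assms(1,4)])
  show ?thesis
    using isotropic_pseudo_umbilical_iff assms(5) stationary_umbilical_iff by simp
qed

end
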